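(* Let $M \ge 2$ be an integer, let $k_1,\dots,k_M$ be positive integers (not necessarily distinct or monotone) and $\nu_1,\dots,\nu_M$ integers with $\nu_{j-1} < \frac{k_{j-1}}{k_j}\nu_j$ for $2 \le j \le M$. For $2 \le j \le M$ define the positive quantities $$m_j = k_{j-1}\nu_j - k_j\nu_{j-1},\qquad \tau_j = \frac{k_j(k_j+k_{j-1})k_{j-1}}{m_j},\qquad \gamma_j = \frac{2k_jk_{j-1}}{m_j},$$ and let $J \in \{2,\dots,M\}$ be any index with $\tau_J = \max_{2\le j\le M}\tau_j$. Given parameters $s_1 \ge 0$, $s_J \ge 0$ and $x_{10},\dots,x_{M0} \in \mathbb{R}$, set $s_j = \frac{\tau_J - \tau_j}{\gamma_j} + \frac{\gamma_J}{\gamma_j}s_J$ for $2 \le j \le M$, $j \ne J$, and $q_1 = s_1$, $p_1 = s_1 + k_1$, $q_j = p_{j-1} + s_j$, $p_j = q_j + k_j$ ($2 \le j \le M$). Then $s_j \ge 0$ for all $1\le j\le M$, so $0 \le q_1 < p_1 \le q_2 < p_2 \le \cdots \le q_M < p_M$. Let $\mathcal{M} = \{1,\dots,M\}$; for $S \subseteq \mathcal{M}$ with complement $S' = \mathcal{M}\setminus S$ set $k_S = \sum_{j\in S}k_j$, $\nu_{S'} = \sum_{m\in S'}\nu_m$, $$C_S = \Big(\prod_{(j,m)\in S\times S'} a_{jm}\Big)\Big(\prod_{m\in S'} b_m\Big),\quad a_{jm} = \sqrt{\frac{(p_m-q_j)(q_m-p_j)}{(q_m-q_j)(p_m-p_j)}},\quad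 b_m = \sqrt{\frac{q_m}{p_m}}\,e^{-ik_mx_{m0}},$$ and $P(z,\lambda) = \sum_{S \subseteq \mathcal{M}} C_S\lambda^{\nu_{S'}}z^{k_S}$. Let $N = \sum_{j=1}^M k_j$, $$\alpha_0 = \Big(2N - k_1 + \frac{\nu_1}{k_1}\tau_J\Big) - 2s_1 + \frac{\nu_1}{k_1}\gamma_Js_J,\qquad \omega = \frac{2\pi}{T} = \tau_J + \gamma_Js_J,$$ and let $\beta_1(t),\dots,\beta_N(t)$ be the roots of $z \mapsto P(z,e^{-i\omega t})$. Then $u(x,t) = \alpha_0 + \sum_{l=1}^N u_{\beta_l(t)}(x)$ is a time-periodic solution (period $T$) of the Benjamin-Ono equation; this gives an $(M+2)$-parameter family parametrized by $s_1, s_J, x_{10},\dots,x_{M0}$. Moreover: (i) When $M=2$, setting $N = k_1+k_2$, $N' = k_2$, $\nu = \nu_1+\nu_2$, $\nu' = \nu_2$, $s = s_1$, $s' = s_2$, and choosing $x_0,t_0$ with $x_{10} = x_0 - \frac{\nu_1}{k_1}\omega t_0$, $x_{20} = x_0 - \frac{\nu_2}{k_2}\omega t_0$, this solution coincides with the solution $\alpha_0' + \sum_{l} u_{\beta'_l(t-t_0)}(x-x_0)$, where $\beta'_l(t)$ are the roots of $z^N + A e^{-i\nu'\omega' t}z^{N-N'} + Be^{-i(\nu-\nu')\omega' t}z^{N'} + Ce^{-i\nu\omega' t}$ and $A,B,C,\alpha_0',\omega'$ are given (with $m = N\nu'-N'\nu$) by $A = \sqrt{\tfrac{N-N'+s+s'}{N+s+s'}}\sqrt{\tfrac{(N+s')s'}{N'(N-N')+(N+s')s'}}$,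 $B = \sqrt{\tfrac{(N+s')s'}{N'(N-N')+(N+s')s'}}\sqrt{\tfrac{s}{N-N'+s}}$, $C = \sqrt{\tfrac{s}{N-N'+s}}\sqrt{\tfrac{N-N'+s+s'}{N+s+s'}}$, $\alpha_0' = \frac{N^2\nu'-(N')^2\nu}{m} - 2s - \frac{2N'(\nu'-\nu)}{m}s'$, $\omega' = \frac{N'(N-N')(N+2s')}{m}$; it is a traveling wave when $s=0$ or $s'=0$ and a constant solution when both vanish. (ii) Let $M \ge 3$. If $s_1 = 0$, then $P(z,\lambda) = z^{k_1}\tilde P(z,\lambda)$ and $u$ coincides with the solution given by the same construction with $\tilde M = M-1$ and parameters $\tilde k_j = k_{j+1}$, $\tilde\nu_j = \nu_{j+1}$, $\tilde s_j = s_{j+1}$, $\tilde x_{j0} = x_{j+1,0}$ ($1 \le j \le \tilde M$), $\tilde P$ being its polynomial (an annihilation of $k_1$ particles at the origin). (iii) Let $M \ge 3$. If $s_J = 0$, then $P(z,\lambda) = \tilde P(z,\lambda)$ and $u$ coincides with the solution given by the same construction with $\tilde M = M-1$ and parameters: $\tilde k_j = k_j$, $\tilde\nu_j = \nu_j$, $\tilde s_j = s_j$, $\tilde x_{j0} = x_{j0}$ for $1 \le j \le J-2$; $\tilde k_{J-1} = k_{J-1} + k_J$, $\tilde\nu_{J-1} = \nu_{J-1} + \nu_J$, $\tilde s_{J-1} = s_{J-1}$, $\tilde x_{J-1,0} = \frac{k_{J-1}x_{J-1,0} + k_Jx_{J0}}{k_{J-1}+k_J}$; $\tilde k_j = k_{j+1}$,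 $\tilde\nu_j = \nu_{j+1}$, $\tilde s_j = s_{j+1}$, $\tilde x_{j0} = x_{j+1,0}$ for $J \le j \le \tilde M$. (iv) If several $s_j$ vanish when $s_J = 0$ (which happens when there is a tie in the maximum of $\tau_j$), then for any subset of the indices $j$ with $s_j = 0$, applying the merging rule of (iii) repeatedly, once for each index in the subset, taking the indices in decreasing order, again yields a solution in this hierarchy equal to $u$; thus the bifurcation is degenerate and allows jumps of several levels of the hierarchy at once.
   Context: The Benjamin-Ono equation is $u_t = Hu_{xx} - uu_x$ for $x \in \mathbb{R}/2\pi\mathbb{Z}$, where $H$ is the Hilbert transform with Fourier symbol $\hat H(k) = -i\,\mathrm{sgn}(k)$. For $\beta$ in the open unit disk, writing $\beta = |\beta|e^{-i\theta}$, define $u_\beta(x) = \frac{4|\beta|\{\cos(x-\theta) - |\beta|\}}{1 + |\beta|^2 - 2|\beta|\cos(x-\theta)}$, whose Fourier coefficients are $2\beta^k$ for $k>0$, $0$ for $k=0$, $2\bar\beta^{|k|}$ for $k<0$. The "hierarchy" refers to the family of solutions produced by the construction in the claim for each value of $M$ (the level), with levels $M=1$ being traveling waves and $M=0$ constants. In the degenerate cases where some $s_j$ vanish, the quantity $a_{jm}$ is understood by its formula where a factor in the numerator vanishes (so $a_{jm}=0$), and $b_m=0$ if $q_m=0$. *)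

theory Defs
  imports "HOL-Analysis.Analysis"
begin

definition fcoef :: "(real \<Rightarrow> real) \<Rightarrow> int \<Rightarrow> complex" where
  "fcoef f n = integral {0..2*pi} (\<lambda>y. complex_of_real (f y) * cis (- (real_of_int n * y)))
                 / complex_of_real (2*pi)"

text \<open>Hilbert transform with Fourier symbol -i sgn(k) (modes k and -k paired).\<close>
definition hilbert :: "(real \<Rightarrow> real) \<Rightarrow> real \<Rightarrow> real" where
  "hilbert f x = Re (\<Sum>n. (- \<i>) * fcoef f (int (Suc n)) * cis (real (Suc n) * x)
                        + \<i> * fcoef f (- int (Suc n)) * cis (- (real (Suc n) * x)))"

definition bo_solution :: "(real \<Rightarrow> real \<Rightarrow> real) \<Rightarrow> bool" where
  "bo_solution u \<longleftrightarrow>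
     (\<forall>x t. u (x + 2*pi) t = u x t) \<and>
     (\<forall>x t. (\<lambda>\<tau>. u x \<tau>) differentiable (at t)) \<and>
     (\<forall>x t. (\<lambda>y. u y t) differentiable (at x)) \<and>
     (\<forall>x t. deriv (\<lambda>y. u y t) differentiable (at x)) \<and>
     (\<forall>x t. deriv (\<lambda>\<tau>. u x \<tau>) t =
              hilbert (\<lambda>y. deriv (deriv (\<lambda>z. u z t)) y) x - u x t * deriv (\<lambda>y. u y t) x)"

text \<open>u_beta, with beta = |beta| e^{-i theta}, i.e. theta = - Arg beta.\<close>
definition ubeta :: "complex \<Rightarrow> real \<Rightarrow> real" where
  "ubeta \<beta> x = (let r = cmod \<beta>; \<theta> = - Arg \<beta> in
      4 * r * (cos (x - \<theta>) - r) / (1 + r\<^sup>2 - 2 * r * cos (x - \<theta>)))"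

definition root_list :: "(complex \<Rightarrow> complex) \<Rightarrow> nat \<Rightarrow> complex list" where
  "root_list f n = (SOME bs. length bs = n \<and> (\<forall>z. f z = (\<Prod>b\<leftarrow>bs. z - b)))"

definition mj :: "(nat \<Rightarrow> nat) \<Rightarrow> (nat \<Rightarrow> int) \<Rightarrow> nat \<Rightarrow> real" where
  "mj k \<nu> j = real (k (j-1)) * real_of_int (\<nu> j) - real (k j) * real_of_int (\<nu> (j-1))"

definition tau :: "(nat \<Rightarrow> nat) \<Rightarrow> (nat \<Rightarrow> int) \<Rightarrow> nat \<Rightarrow> real" where
  "tau k \<nu> j = real (k j) * (real (k j) + real (k (j-1))) * real (k (j-1)) / mj k \<nu> j"

definition gam :: "(nat \<Rightarrow> nat) \<Rightarrow> (nat \<Rightarrow> int) \<Rightarrow> nat \<Rightarrow> real" where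
  "gam k \<nu> j = 2 * real (k j) * real (k (j-1)) / mj k \<nu> j"

definition s_of :: "(nat \<Rightarrow> nat) \<Rightarrow> (nat \<Rightarrow> int) \<Rightarrow> nat \<Rightarrow> real \<Rightarrow> real \<Rightarrow> nat \<Rightarrow> real" where
  "s_of k \<nu> J s1 sJ j =
     (if j = 1 then s1 else if j = J then sJ
      else (tau k \<nu> J - tau k \<nu> j) / gam k \<nu> j + gam k \<nu> J / gam k \<nu> j * sJ)"

fun qq :: "(nat \<Rightarrow> nat) \<Rightarrow> (nat \<Rightarrow> real) \<Rightarrow> nat \<Rightarrow> real"
and pp :: "(nat \<Rightarrow> nat) \<Rightarrow> (nat \<Rightarrow> real) \<Rightarrow> nat \<Rightarrow> real" where
  "qq k s 0 = 0"
| "qq k s (Suc 0) = s 1"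
| "qq k s (Suc (Suc j)) = pp k s (Suc j) + s (Suc (Suc j))"
| "pp k s j = qq k s j + real (k j)"

definition aa :: "(nat \<Rightarrow> nat) \<Rightarrow> (nat \<Rightarrow> real) \<Rightarrow> nat \<Rightarrow> nat \<Rightarrow> real" where
  "aa k s j m = sqrt (((pp k s m - qq k s j) * (qq k s m - pp k s j)) /
                      ((qq k s m - qq k s j) * (pp k s m - pp k s j)))"

definition bb :: "(nat \<Rightarrow> nat) \<Rightarrow> (nat \<Rightarrow> real) \<Rightarrow> (nat \<Rightarrow> real) \<Rightarrow> nat \<Rightarrow> complex" where
  "bb k s x0 m = complex_of_real (sqrt (qq k s m / pp k s m)) * cis (- (real (k m) * x0 m))"

definition CS :: "nat \<Rightarrow> (nat \<Rightarrow> nat) \<Rightarrow> (nat \<Rightarrow> real) \<Rightarrow> (nat \<Rightarrow> real) \<Rightarrow> nat set \<Rightarrow> complex" where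
  "CS M k s x0 S =
     (\<Prod>(j,m)\<in>S \<times> ({1..M} - S). complex_of_real (aa k s j m)) * (\<Prod>m\<in>{1..M} - S. bb k s x0 m)"

definition bo_P :: "nat \<Rightarrow> (nat \<Rightarrow> nat) \<Rightarrow> (nat \<Rightarrow> int) \<Rightarrow> (nat \<Rightarrow> real) \<Rightarrow> (nat \<Rightarrow> real)
                    \<Rightarrow> complex \<Rightarrow> complex \<Rightarrow> complex" where
  "bo_P M k \<nu> s x0 z lam =
     (\<Sum>S\<in>Pow {1..M}. CS M k s x0 S * lam powi (\<Sum>m\<in>{1..M} - S. \<nu> m) * z ^ (\<Sum>j\<in>S. k j))"

definition bigN :: "nat \<Rightarrow> (nat \<Rightarrow> nat) \<Rightarrow> nat" where
  "bigN M k = (\<Sum>j=1..M. k j)"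

definition gen_u :: "nat \<Rightarrow> (nat \<Rightarrow> nat) \<Rightarrow> (nat \<Rightarrow> int) \<Rightarrow> (nat \<Rightarrow> real) \<Rightarrow> (nat \<Rightarrow> real)
                     \<Rightarrow> real \<Rightarrow> real \<Rightarrow> real \<Rightarrow> real \<Rightarrow> real" where
  "gen_u M k \<nu> s x0 \<alpha> \<omega> x t =
     \<alpha> + (\<Sum>b\<leftarrow>root_list (\<lambda>z. bo_P M k \<nu> s x0 z (cis (- (\<omega> * t)))) (bigN M k). ubeta b x)"

definition omegaJ :: "(nat \<Rightarrow> nat) \<Rightarrow> (nat \<Rightarrow> int) \<Rightarrow> nat \<Rightarrow> (nat \<Rightarrow> real) \<Rightarrow> real" where
  "omegaJ k \<nu> J s = tau k \<nu> J + gam k \<nu> J * s J"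

definition alphaJ :: "nat \<Rightarrow> (nat \<Rightarrow> nat) \<Rightarrow> (nat \<Rightarrow> int) \<Rightarrow> nat \<Rightarrow> (nat \<Rightarrow> real) \<Rightarrow> real" where
  "alphaJ M k \<nu> J s =
     (2 * real (bigN M k) - real (k 1) + real_of_int (\<nu> 1) / real (k 1) * tau k \<nu> J)
     - 2 * s 1 + real_of_int (\<nu> 1) / real (k 1) * gam k \<nu> J * s J"

definition hier_u :: "nat \<Rightarrow> (nat \<Rightarrow> nat) \<Rightarrow> (nat \<Rightarrow> int) \<Rightarrow> nat \<Rightarrow> (nat \<Rightarrow> real) \<Rightarrow> (nat \<Rightarrow> real)
                      \<Rightarrow> real \<Rightarrow> real \<Rightarrow> real" where
  "hier_u M k \<nu> J s x0 = gen_u M k \<nu> s x0 (alphaJ M k \<nu> J s) (omegaJ k \<nu> J s)"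

definition hier_params :: "nat \<Rightarrow> (nat \<Rightarrow> nat) \<Rightarrow> (nat \<Rightarrow> int) \<Rightarrow> nat \<Rightarrow> (nat \<Rightarrow> real) \<Rightarrow> bool" where
  "hier_params M k \<nu> J s \<longleftrightarrow>
     M \<ge> 2 \<and> (\<forall>j\<in>{1..M}. k j > 0) \<and>
     (\<forall>j\<in>{2..M}. real_of_int (\<nu> (j-1)) < real (k (j-1)) / real (k j) * real_of_int (\<nu> j)) \<and>
     J \<in> {2..M} \<and> (\<forall>j\<in>{2..M}. tau k \<nu> j \<le> tau k \<nu> J) \<and> s 1 \<ge> 0 \<and> s J \<ge> 0 \<and>
     (\<forall>j\<in>{2..M}. j \<noteq> J \<longrightarrow> s j = (tau k \<nu> J - tau k \<nu> j) / gam k \<nu> j + gam k \<nu> J / gam k \<nu> j * s J)"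

definition hier_member :: "nat \<Rightarrow> (nat \<Rightarrow> nat) \<Rightarrow> (nat \<Rightarrow> int) \<Rightarrow> (nat \<Rightarrow> real) \<Rightarrow> (nat \<Rightarrow> real)
                           \<Rightarrow> (real \<Rightarrow> real \<Rightarrow> real) \<Rightarrow> bool" where
  "hier_member M k \<nu> s x0 u \<longleftrightarrow>
     (\<exists>J. hier_params M k \<nu> J s) \<and> (\<forall>J. hier_params M k \<nu> J s \<longrightarrow> hier_u M k \<nu> J s x0 = u)"

definition merge_k :: "nat \<Rightarrow> (nat \<Rightarrow> nat) \<Rightarrow> nat \<Rightarrow> nat" where
  "merge_k J k j = (if j \<le> J - 2 then k j else if j = J - 1 then k (J-1) + k J else k (j+1))"

definition merge_nu :: "nat \<Rightarrow> (nat \<Rightarrow> int) \<Rightarrow> nat \<Rightarrow> int" where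
  "merge_nu J \<nu> j = (if j \<le> J - 2 then \<nu> j else if j = J - 1 then \<nu> (J-1) + \<nu> J else \<nu> (j+1))"

definition merge_s :: "nat \<Rightarrow> (nat \<Rightarrow> real) \<Rightarrow> nat \<Rightarrow> real" where
  "merge_s J s j = (if j \<le> J - 2 then s j else if j = J - 1 then s (J-1) else s (j+1))"

definition merge_x :: "nat \<Rightarrow> (nat \<Rightarrow> nat) \<Rightarrow> (nat \<Rightarrow> real) \<Rightarrow> nat \<Rightarrow> real" where
  "merge_x J k x0 j = (if j \<le> J - 2 then x0 j
     else if j = J - 1 then (real (k (J-1)) * x0 (J-1) + real (k J) * x0 J) / (real (k (J-1)) + real (k J))
     else x0 (j+1))"

type_synonym params = "nat \<times> (nat \<Rightarrow> nat) \<times> (nat \<Rightarrow> int) \<times> (nat \<Rightarrow> real) \<times> (nat \<Rightarrow> real)"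

definition merge_step :: "nat \<Rightarrow> params \<Rightarrow> params" where
  "merge_step J p = (case p of (M, k, \<nu>, s, x0) \<Rightarrow>
     (M - 1, merge_k J k, merge_nu J \<nu>, merge_s J s, merge_x J k x0))"

definition merges :: "nat set \<Rightarrow> params \<Rightarrow> params" where
  "merges D p = fold merge_step (rev (sorted_list_of_set D)) p"

definition A2 :: "real \<Rightarrow> real \<Rightarrow> real \<Rightarrow> real \<Rightarrow> real" where
  "A2 N N' s s' = sqrt ((N - N' + s + s') / (N + s + s')) * sqrt ((N + s') * s' / (N' * (N - N') + (N + s') * s'))"

definition B2 :: "real \<Rightarrow> real \<Rightarrow> real \<Rightarrow> real \<Rightarrow> real" where
  "B2 N N' s s' = sqrt ((N + s') * s' / (N' * (N - N') + (N + s') * s')) * sqrt (s / (N - N' + s))"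

definition C2 :: "real \<Rightarrow> real \<Rightarrow> real \<Rightarrow> real \<Rightarrow> real" where
  "C2 N N' s s' = sqrt (s / (N - N' + s)) * sqrt ((N - N' + s + s') / (N + s + s'))"

definition m2 :: "nat \<Rightarrow> nat \<Rightarrow> int \<Rightarrow> int \<Rightarrow> real" where
  "m2 N N' \<nu> \<nu>' = real N * real_of_int \<nu>' - real N' * real_of_int \<nu>"

definition alpha2 :: "nat \<Rightarrow> nat \<Rightarrow> int \<Rightarrow> int \<Rightarrow> real \<Rightarrow> real \<Rightarrow> real" where
  "alpha2 N N' \<nu> \<nu>' s s' =
     (real N ^ 2 * real_of_int \<nu>' - real N' ^ 2 * real_of_int \<nu>) / m2 N N' \<nu> \<nu>' - 2 * s
     - 2 * real N' * real_of_int (\<nu>' - \<nu>) / m2 N N' \<nu> \<nu>' * s'"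

definition omega2 :: "nat \<Rightarrow> nat \<Rightarrow> int \<Rightarrow> int \<Rightarrow> real \<Rightarrow> real" where
  "omega2 N N' \<nu> \<nu>' s' = real N' * (real N - real N') * (real N + 2 * s') / m2 N N' \<nu> \<nu>'"

definition Q2 :: "nat \<Rightarrow> nat \<Rightarrow> int \<Rightarrow> int \<Rightarrow> real \<Rightarrow> real \<Rightarrow> real \<Rightarrow> complex \<Rightarrow> complex" where
  "Q2 N N' \<nu> \<nu>' s s' t z =
     (let w = omega2 N N' \<nu> \<nu>' s' in
      z ^ N + complex_of_real (A2 N N' s s') * cis (- (real_of_int \<nu>' * w * t)) * z ^ (N - N')
      + complex_of_real (B2 N N' s s') * cis (- (real_of_int (\<nu> - \<nu>') * w * t)) * z ^ N'
      + complex_of_real (C2 N N' s s') * cis (- (real_of_int \<nu> * w * t)))"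

definition u2 :: "nat \<Rightarrow> nat \<Rightarrow> int \<Rightarrow> int \<Rightarrow> real \<Rightarrow> real \<Rightarrow> real \<Rightarrow> real \<Rightarrow> real \<Rightarrow> real \<Rightarrow> real" where
  "u2 N N' \<nu> \<nu>' s s' x0 t0 x t =
     alpha2 N N' \<nu> \<nu>' s s' + (\<Sum>b\<leftarrow>root_list (Q2 N N' \<nu> \<nu>' s s' (t - t0)) N. ubeta b (x - x0))"

end

theory Submission
  imports Defs "HOL-Complex_Analysis.Complex_Analysis"
    "HOL-Computational_Algebra.Fundamental_Theorem_Algebra"
begin

text \<open>
  Put \<open>E(x,t) = e\<^sup>i\<^sup>N\<^sup>x P(e\<^sup>-\<^sup>i\<^sup>x, e\<^sup>-\<^sup>i\<^sup>\<omega>\<^sup>t)\<close>. If the roots of \<open>P\<close> lie in the open unit disk, then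
  \<open>u = \<alpha> - 4 Im (E\<^sub>x / E)\<close>, the Hilbert transform acts on \<open>u\<^sub>x\<^sub>x\<close> by exchanging real and imaginary
  parts, and the Benjamin-Ono equation is the \<open>x\<close>-derivative of a bilinear equation for \<open>E\<close> and
  its conjugate.

  The relations between the \<open>s\<^sub>j\<close> say that \<open>\<omega> \<nu>\<^sub>j = p\<^sub>j\<^sup>2 - q\<^sub>j\<^sup>2 + c (p\<^sub>j - q\<^sub>j)\<close> with a constant \<open>c\<close>
  independent of \<open>j\<close>, and \<open>\<alpha> = 2 N + c\<close>. Then \<open>c\<close> drops out of the bilinear equation, whose
  coefficients reduce, for every finite set of indices, to
  \<open>\<Sum> \<Delta>(X) \<Delta>(Y) (\<Prod> Y\<^sub>j) (\<Sum> (X\<^sub>j\<^sup>2 - Y\<^sub>j\<^sup>2) + (\<Sum> (X\<^sub>j - Y\<^sub>j))\<^sup>2) = 0\<close>, summed over all choices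
  \<open>{X\<^sub>j, Y\<^sub>j} = {p\<^sub>j, q\<^sub>j}\<close>, with \<open>\<Delta>\<close> the Vandermonde product. As \<open>0 \<le> a\<^sub>j\<^sub>m < 1\<close> and \<open>|b\<^sub>m| < 1\<close>,
  the Lee-Yang circle theorem places the roots of \<open>P\<close> in the disk. When \<open>s\<^sub>1 = 0\<close> or \<open>s\<^sub>J = 0\<close>, the
  coefficients \<open>b\<^sub>1\<close> or \<open>a\<^sub>j\<^sub>m\<close> (\<open>{j,m} = {J-1,J}\<close>) vanish and \<open>P\<close> collapses, while the relation
  for \<open>\<omega> \<nu>\<^sub>j\<close> is additive over adjacent intervals and so survives merging.
\<close>


section \<open>An algebraic identity\<close>

text \<open>The bilinear equation is checked at each fixed (x,t): the exponentials are absorbed into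
  the b_m, of which only the modulus matters. In the product of E with its conjugate, the pairs
  (A,B) of index sets are grouped by A - B and B - A. All phases depend on these two sets only, and
  each group vanishes by itself. Within a group the intersection of A and B runs through the subsets
  of the remaining indices, and the squares of the a_jm become quotients of Vandermonde products;
  hence the need for the identity on every finite index set.

  Degenerate parameters require no limit argument: since k_j > 0, the q_j and the p_j are each
  strictly increasing, so only numerators of the a_jm can vanish, never denominators.

  The roots are listed by an arbitrary choice, and one solution may have presentations with
  polynomials of different degree. Where the polynomials differ, solutions are compared through E,
  which does not see roots at the origin. The relation with c also makes sense for M = 1, where
  \<open>hier_params\<close> does not; repeated merging may end there.\<close>

definition pair_prod :: "nat set \<Rightarrow> (nat \<Rightarrow> nat \<Rightarrow> 'a::comm_monoid_mult) \<Rightarrow> 'a" where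
  "pair_prod U f = (\<Prod>(i,j)\<in>{(i,j). i \<in> U \<and> j \<in> U \<and> i < j}. f i j)"

lemma pair_prod_empty [simp]: "pair_prod {} f = 1"
  by (simp add: pair_prod_def)

lemma pair_prod_cong:
  assumes "\<And>i j. i \<in> U \<Longrightarrow> j \<in> U \<Longrightarrow> f i j = g i j"
  shows "pair_prod U f = pair_prod U g"
  unfolding pair_prod_def by (rule prod.cong) (use assms in auto)

lemma pair_prod_insert:
  assumes U: "finite U" "a \<notin> U" and sym: "\<And>i j. f i j = f j i"
  shows "pair_prod (insert a U) f = (\<Prod>j\<in>U. f a j) * pair_prod U f"
proof -
  let ?P = "\<lambda>U. {(i,j). i \<in> U \<and> j \<in> U \<and> i < (j::nat)}"
  let ?g = "\<lambda>j. (min a j, max a j)"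
  have fin: "finite (?P U)"
    by (rule finite_subset[of _ "U \<times> U"]) (use U in auto)
  have eq: "?P (insert a U) = ?g ` U \<union> ?P U"
  proof (intro equalityI subsetI)
    fix z assume z: "z \<in> ?P (insert a U)"
    obtain i j where ij: "z = (i,j)" "i \<in> insert a U" "j \<in> insert a U" "i < j" using z by auto
    show "z \<in> ?g ` U \<union> ?P U"
    proof (cases "i = a \<or> j = a")
      case True
      then show ?thesis
      proof
        assume "i = a"
        then have "z = ?g j" "j \<in> U" using ij by auto
        then show ?thesis by blast
      next
        assume "j = a"
        then have "z = ?g i" "i \<in> U" using ij by auto
        then show ?thesis by blast
      qed
    next
      case False
      then show ?thesis using ij by auto
    qed
  next
    fix z assume "z \<in> ?g ` U \<union> ?P U"
    then show "z \<in> ?P (insert a U)"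
      using U(2) by (auto simp: min_def max_def split: if_splits)
       (metis le_neq_implies_less)
  qed
  have disj: "?g ` U \<inter> ?P U = {}"
    using U(2) by (auto simp: min_def max_def split: if_splits)
  have inj: "inj_on ?g U"
    by (rule inj_onI) (auto simp: min_def max_def split: if_splits)
  have "pair_prod (insert a U) f = (\<Prod>(i,j)\<in>?g ` U. f i j) * pair_prod U f"
    unfolding pair_prod_def eq by (rule prod.union_disjoint) (use U fin disj in auto)
  also have "(\<Prod>(i,j)\<in>?g ` U. f i j) = (\<Prod>j\<in>U. f a j)"
    by (subst prod.reindex[OF inj]) (auto intro!: prod.cong simp: min_def max_def sym)
  finally show ?thesis .
qed

text \<open>Taking differences of \<open>X\<close> and \<open>Y\<close> together makes the factor
  symmetric in \<open>i\<close> and \<open>j\<close>: the two sign changes cancel. This is what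
  \<open>pair_prod_insert\<close> requires.\<close>

definition bil_term :: "nat set \<Rightarrow> (nat \<Rightarrow> real) \<Rightarrow> (nat \<Rightarrow> real) \<Rightarrow> real" where
  "bil_term U X Y = pair_prod U (\<lambda>i j. (X i - X j) * (Y i - Y j)) * (\<Prod>j\<in>U. Y j) *
     ((\<Sum>j\<in>U. (X j)\<^sup>2 - (Y j)\<^sup>2) + (\<Sum>j\<in>U. X j - Y j)\<^sup>2)"

definition sel :: "nat set \<Rightarrow> (nat \<Rightarrow> real) \<Rightarrow> (nat \<Rightarrow> real) \<Rightarrow> nat \<Rightarrow> real" where
  "sel R p q j = (if j \<in> R then p j else q j)"

definition bil :: "nat set \<Rightarrow> (nat \<Rightarrow> real) \<Rightarrow> (nat \<Rightarrow> real) \<Rightarrow> real" where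
  "bil U p q = (\<Sum>R\<in>Pow U. bil_term U (sel R p q) (sel R q p))"

text \<open>The summand after adjoining one more pair with values \<open>x\<close> and \<open>y\<close> to \<open>X\<close> and \<open>Y\<close>.\<close>
definition bil_ext :: "nat set \<Rightarrow> (nat \<Rightarrow> real) \<Rightarrow> (nat \<Rightarrow> real) \<Rightarrow> real \<Rightarrow> real \<Rightarrow> real" where
  "bil_ext U X Y x y = (\<Prod>j\<in>U. (x - X j) * (y - Y j)) *
     (pair_prod U (\<lambda>i j. (X i - X j) * (Y i - Y j)) * (\<Prod>j\<in>U. Y j)) * y *
     ((\<Sum>j\<in>U. (X j)\<^sup>2 - (Y j)\<^sup>2) + x\<^sup>2 - y\<^sup>2 + ((\<Sum>j\<in>U. X j - Y j) + x - y)\<^sup>2)"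

lemma bil_ext_cong:
  assumes "\<And>j. j \<in> U \<Longrightarrow> X j = X' j" "\<And>j. j \<in> U \<Longrightarrow> Y j = Y' j"
  shows "bil_ext U X Y x y = bil_ext U X' Y' x y"
proof -
  have "pair_prod U (\<lambda>i j. (X i - X j) * (Y i - Y j)) = pair_prod U (\<lambda>i j. (X' i - X' j) * (Y' i - Y' j))"
    by (rule pair_prod_cong) (simp add: assms)
  then show ?thesis
    unfolding bil_ext_def using assms by (simp cong: prod.cong sum.cong)
qed

lemma bil_term_insert:
  assumes "finite U" "a \<notin> U"
  shows "bil_term (insert a U) X Y = bil_ext U X Y (X a) (Y a)"
proof -
  have "pair_prod (insert a U) (\<lambda>i j. (X i - X j) * (Y i - Y j)) =
     (\<Prod>j\<in>U. (X a - X j) * (Y a - Y j)) * pair_prod U (\<lambda>i j. (X i - X j) * (Y i - Y j))"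
    by (rule pair_prod_insert) (use assms in \<open>auto simp: algebra_simps\<close>)
  then show ?thesis
    unfolding bil_term_def bil_ext_def using assms by (simp add: algebra_simps)
qed

lemma sum_Pow_insert:
  assumes "finite U" "a \<notin> U"
  shows "(\<Sum>R\<in>Pow (insert a U). f R) = (\<Sum>R\<in>Pow U. f R + f (insert a R))"
proof -
  have inj: "inj_on (insert a) (Pow U)"
    by (rule inj_onI) (metis assms(2) PowD insert_ident subsetD)
  have "(\<Sum>R\<in>Pow (insert a U). f R) = (\<Sum>R\<in>Pow U. f R) + (\<Sum>R\<in>insert a ` Pow U. f R)"
    unfolding Pow_insert by (rule sum.union_disjoint) (use assms in auto)
  then show ?thesis by (simp add: sum.reindex[OF inj] sum.distrib)
qed

lemma bil_insert:
  assumes "finite U" "a \<notin> U"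
  shows "bil (insert a U) p q =
    (\<Sum>R\<in>Pow U. bil_ext U (sel R p q) (sel R q p) (q a) (p a) +
                 bil_ext U (sel R p q) (sel R q p) (p a) (q a))"
  unfolding bil_def sum_Pow_insert[OF assms]
proof (rule sum.cong[OF refl], rule arg_cong2[of _ _ _ _ "(+)"])
  fix R assume R: "R \<in> Pow U"
  have aR: "a \<notin> R" using R assms by auto
  show "bil_term (insert a U) (sel R p q) (sel R q p) =
      bil_ext U (sel R p q) (sel R q p) (q a) (p a)"
    using aR by (simp add: bil_term_insert[OF assms] sel_def)
  have "bil_term (insert a U) (sel (insert a R) p q) (sel (insert a R) q p) =
      bil_ext U (sel (insert a R) p q) (sel (insert a R) q p) (p a) (q a)"
    by (simp add: bil_term_insert[OF assms] sel_def)
  also have "\<dots> = bil_ext U (sel R p q) (sel R q p) (p a) (q a)"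
    by (rule bil_ext_cong) (use assms in \<open>auto simp: sel_def\<close>)
  finally show "bil_term (insert a U) (sel (insert a R) p q) (sel (insert a R) q p) =
      bil_ext U (sel R p q) (sel R q p) (p a) (q a)" .
qed

text \<open>Exchanging the two values of one pair only toggles the membership of \<open>a\<close> in
  the choice \<open>R\<close>. Thus any vanishing proved for a value of \<open>p\<close> transfers
  to the same value of \<open>q\<close>.\<close>

lemma bil_swap:
  assumes "finite W" "a \<in> W"
  shows "bil W (p(a := q a)) (q(a := p a)) = bil W p q"
proof -
  define U where "U = W - {a}"
  have W: "W = insert a U" "finite U" "a \<notin> U" using assms by (auto simp: U_def)
  have "bil_ext U (sel R (p(a := q a)) (q(a := p a))) (sel R (q(a := p a)) (p(a := q a))) x y =
        bil_ext U (sel R p q) (sel R q p) x y" for R x y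
    by (rule bil_ext_cong) (use W in \<open>auto simp: sel_def\<close>)
  then show ?thesis
    unfolding W(1) bil_insert[OF W(2,3)] by (simp add: add.commute)
qed

lemma sel_prod: "sel R p q j * sel R q p j = p j * q j"
  by (simp add: sel_def)

lemma bil_ext_same:
  "bil_ext U X Y x x = (\<Prod>j\<in>U. (x - X j) * (x - Y j)) * x * bil_term U X Y"
  unfolding bil_ext_def bil_term_def by (simp add: algebra_simps)

text \<open>A pair with equal values contributes a factor symmetric in \<open>X j\<close> and
  \<open>Y j\<close>, hence the same for every choice \<open>R\<close>; it can be pulled out of the
  sum.\<close>

lemma bil_same:
  assumes "finite U" "a \<notin> U" "p a = q a" "bil U p q = 0"
  shows "bil (insert a U) p q = 0"
proof -
  have c: "(\<Prod>j\<in>U. (q a - sel R p q j) * (q a - sel R q p j)) =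
        (\<Prod>j\<in>U. (q a - p j) * (q a - q j))" for R
    by (rule prod.cong) (auto simp: sel_def)
  have "bil (insert a U) p q = 2 * (\<Prod>j\<in>U. (q a - p j) * (q a - q j)) * q a * bil U p q"
    unfolding bil_insert[OF assms(1,2)] unfolding assms(3) bil_ext_same c bil_def sum_distrib_left
    by (rule sum.cong) (simp_all only: algebra_simps mult_2)
  then show ?thesis using assms by simp
qed

text \<open>Choices with \<open>Y a = 0\<close> vanish through the product of the
  \<open>Y j\<close>. In the others the new factors turn \<open>Y j\<close> into
  \<open>Y j - y\<close>, where \<open>y = q a\<close>, and the quadratic expression becomes the one
  for values translated by \<open>y\<close>. The smaller instance is therefore the translated
  one.\<close>

lemma bil_zero:
  assumes "finite U" "a \<notin> U" "p a = 0" "bil U (\<lambda>j. p j - q a) (\<lambda>j. q j - q a) = 0"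
  shows "bil (insert a U) p q = 0"
proof -
  define y where "y = q a"
  define K where "K = (\<Prod>j\<in>U. p j * q j)"
  have t: "bil_ext U X Y 0 y = (\<Prod>j\<in>U. X j * Y j) * y * bil_term U (\<lambda>j. X j - y) (\<lambda>j. Y j - y)" for X Y
  proof -
    have 1: "(\<Sum>j\<in>U. (X j - y)\<^sup>2 - (Y j - y)\<^sup>2) = (\<Sum>j\<in>U. (X j)\<^sup>2 - (Y j)\<^sup>2) - 2 * y * (\<Sum>j\<in>U. X j - Y j)"
      by (simp add: sum_distrib_left sum_subtractf[symmetric] power2_eq_square algebra_simps
          del: sum_subtractf)
    have 2: "(\<Prod>j\<in>U. (0 - X j) * (y - Y j)) * (\<Prod>j\<in>U. Y j) = (\<Prod>j\<in>U. X j * Y j) * (\<Prod>j\<in>U. Y j - y)"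
      unfolding prod.distrib[symmetric] by (rule prod.cong) (auto simp: algebra_simps)
    define A where "A = (\<Sum>j\<in>U. (X j)\<^sup>2 - (Y j)\<^sup>2)"
    define B where "B = (\<Sum>j\<in>U. X j - Y j)"
    have "bil_ext U X Y 0 y = ((\<Prod>j\<in>U. (0 - X j) * (y - Y j)) * (\<Prod>j\<in>U. Y j)) *
       pair_prod U (\<lambda>i j. (X i - X j) * (Y i - Y j)) * y * (A + 0 - y\<^sup>2 + (B + 0 - y)\<^sup>2)"
      unfolding bil_ext_def A_def B_def by simp
    also have "\<dots> = (\<Prod>j\<in>U. X j * Y j) * y * (pair_prod U (\<lambda>i j. (X i - X j) * (Y i - Y j)) *
        (\<Prod>j\<in>U. Y j - y) * (A - 2 * y * B + B\<^sup>2))"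
      unfolding 2 by (simp add: power2_eq_square algebra_simps)
    also have "\<dots> = (\<Prod>j\<in>U. X j * Y j) * y * bil_term U (\<lambda>j. X j - y) (\<lambda>j. Y j - y)"
      unfolding bil_term_def 1 A_def B_def by simp
    finally show ?thesis .
  qed
  have e: "bil_ext U X Y y 0 = 0" for X Y by (simp add: bil_ext_def)
  have s: "(\<lambda>j. sel R f g j - y) = sel R (\<lambda>j. f j - y) (\<lambda>j. g j - y)" for R f g
    by (auto simp: sel_def)
  have "bil (insert a U) p q = K * y * bil U (\<lambda>j. p j - y) (\<lambda>j. q j - y)"
    unfolding bil_insert[OF assms(1,2)] unfolding assms(3) y_def[symmetric] e t sel_prod s bil_def K_def
    by (simp add: sum_distrib_left)
  then show ?thesis using assms by (simp add: y_def)
qed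

text \<open>If \<open>p a = q b\<close>, choices that contain exactly one of \<open>a\<close>,
  \<open>b\<close> have a repeated value in \<open>X\<close> or in \<open>Y\<close> and vanish. In
  the remaining ones the common value occurs once in \<open>X\<close> and once in \<open>Y\<close>,
  so its contribution is the constant \<open>K\<close>, and the single pair of \<open>q a\<close>
  and \<open>p b\<close> is left: two adjacent intervals act as their union.\<close>

lemma bil_merge:
  assumes V: "finite V" "a \<notin> V" "b \<notin> V" "a \<noteq> b" and pq: "p a = q b"
    and z: "bil (insert b V) p (q(b := q a)) = 0"
  shows "bil (insert a (insert b V)) p q = 0"
proof -
  define K where "K = (\<Prod>j\<in>V. (p a - p j) * (p a - q j)) * (p a - p b) * (q a - p a) * p a"
  have aU: "a \<notin> insert b V" using V by auto
  have tm: "bil_term (insert a (insert b V)) X Y =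
     ((X a - X b) * (Y a - Y b)) * (\<Prod>j\<in>V. (X a - X j) * (Y a - Y j) * ((X b - X j) * (Y b - Y j))) *
      pair_prod V (\<lambda>i j. (X i - X j) * (Y i - Y j)) * (Y a * Y b * (\<Prod>j\<in>V. Y j)) *
      ((\<Sum>j\<in>V. (X j)\<^sup>2 - (Y j)\<^sup>2) + ((X a)\<^sup>2 - (Y a)\<^sup>2) + ((X b)\<^sup>2 - (Y b)\<^sup>2)
       + ((\<Sum>j\<in>V. X j - Y j) + (X a - Y a) + (X b - Y b))\<^sup>2)" for X Y
  proof -
    have "pair_prod (insert a (insert b V)) (\<lambda>i j. (X i - X j) * (Y i - Y j)) =
       (\<Prod>j\<in>insert b V. (X a - X j) * (Y a - Y j)) *
       ((\<Prod>j\<in>V. (X b - X j) * (Y b - Y j)) * pair_prod V (\<lambda>i j. (X i - X j) * (Y i - Y j)))"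
      by (subst pair_prod_insert | (use V in \<open>simp add: algebra_simps\<close>; fail))+
    then show ?thesis unfolding bil_term_def using V aU by (simp add: prod.distrib ac_simps)
  qed
  have main: "bil_term (insert a (insert b V)) X Y = K * bil_ext V X Y (X b) (Y a)"
    if "X a = p a" "Y b = p a" "X b = p b" "Y a = q a" 
      "\<And>j. j \<in> V \<Longrightarrow> (p a - X j) * (p a - Y j) = (p a - p j) * (p a - q j)" for X Y
  proof -
    have "(\<Prod>j\<in>V. (X a - X j) * (Y a - Y j) * ((X b - X j) * (Y b - Y j))) =
       (\<Prod>j\<in>V. ((p a - p j) * (p a - q j)) * ((X b - X j) * (Y a - Y j)))"
      by (rule prod.cong[OF refl]) (simp add: that(5)[symmetric] that(1,2))
    then have pr: "(\<Prod>j\<in>V. (X a - X j) * (Y a - Y j) * ((X b - X j) * (Y b - Y j))) =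
       (\<Prod>j\<in>V. (p a - p j) * (p a - q j)) * (\<Prod>j\<in>V. (X b - X j) * (Y a - Y j))"
      by (simp add: prod.distrib)
    show ?thesis unfolding tm pr bil_ext_def K_def using that(1-4) by (simp add: algebra_simps)
  qed
  have main2: "bil_term (insert a (insert b V)) X Y = K * bil_ext V X Y (X a) (Y b)"
    if "X b = p a" "Y a = p a" "X a = q a" "Y b = p b" 
      "\<And>j. j \<in> V \<Longrightarrow> (p a - X j) * (p a - Y j) = (p a - p j) * (p a - q j)" for X Y
  proof -
    have "(\<Prod>j\<in>V. (X a - X j) * (Y a - Y j) * ((X b - X j) * (Y b - Y j))) =
       (\<Prod>j\<in>V. ((p a - p j) * (p a - q j)) * ((X a - X j) * (Y b - Y j)))"
      by (rule prod.cong[OF refl]) (simp add: that(5)[symmetric] that(1,2))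
    then have pr: "(\<Prod>j\<in>V. (X a - X j) * (Y a - Y j) * ((X b - X j) * (Y b - Y j))) =
       (\<Prod>j\<in>V. (p a - p j) * (p a - q j)) * (\<Prod>j\<in>V. (X a - X j) * (Y b - Y j))"
      by (simp add: prod.distrib)
    show ?thesis unfolding tm pr bil_ext_def K_def using that(1-4) by (simp add: algebra_simps)
  qed
  have s: "bil_term (insert a (insert b V)) (sel R p q) (sel R q p)
        + bil_term (insert a (insert b V)) (sel (insert b R) p q) (sel (insert b R) q p)
        + (bil_term (insert a (insert b V)) (sel (insert a R) p q) (sel (insert a R) q p)
        + bil_term (insert a (insert b V)) (sel (insert a (insert b R)) p q) (sel (insert a (insert b R)) q p))
      = K * (bil_ext V (sel R p q) (sel R q p) (q a) (p b) + bil_ext V (sel R p q) (sel R q p) (p b) (q a))"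
    if R: "R \<in> Pow V" for R
  proof -
    have nR: "a \<notin> R" "b \<notin> R" using R V by auto
    have cong: "bil_ext V (sel (insert a (insert b R)) p q) (sel (insert a (insert b R)) q p) x y =
        bil_ext V (sel R p q) (sel R q p) x y" for x y
      by (rule bil_ext_cong) (use V in \<open>auto simp: sel_def\<close>)
    have 1: "bil_term (insert a (insert b V)) (sel R p q) (sel R q p) =
       K * bil_ext V (sel R p q) (sel R q p) (q a) (p b)"
      by (subst main2) (use nR V pq in \<open>auto simp: sel_def\<close>)
    have 2: "bil_term (insert a (insert b V)) (sel (insert b R) p q) (sel (insert b R) q p) = 0"
      unfolding tm using nR V pq by (simp add: sel_def)
    have 3: "bil_term (insert a (insert b V)) (sel (insert a R) p q) (sel (insert a R) q p) = 0"
      unfolding tm using nR V pq by (simp add: sel_def)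
    have 4: "bil_term (insert a (insert b V)) (sel (insert a (insert b R)) p q) (sel (insert a (insert b R)) q p) =
       K * bil_ext V (sel R p q) (sel R q p) (p b) (q a)"
      by (subst main) (use nR V pq cong in \<open>auto simp: sel_def\<close>)
    show ?thesis unfolding 1 2 3 4 by (simp add: algebra_simps)
  qed
  have cong: "bil_ext V (sel R p (q(b := q a))) (sel R (q(b := q a)) p) x y =
        bil_ext V (sel R p q) (sel R q p) x y" for R x y
    by (rule bil_ext_cong) (use V in \<open>auto simp: sel_def\<close>)
  have "bil (insert a (insert b V)) p q = (\<Sum>R\<in>Pow V. 
      bil_term (insert a (insert b V)) (sel R p q) (sel R q p)
        + bil_term (insert a (insert b V)) (sel (insert b R) p q) (sel (insert b R) q p)
        + (bil_term (insert a (insert b V)) (sel (insert a R) p q) (sel (insert a R) q p)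
        + bil_term (insert a (insert b V)) (sel (insert a (insert b R)) p q) (sel (insert a (insert b R)) q p)))"
    unfolding bil_def using V aU
    by (simp add: sum_Pow_insert sum.distrib)
  also have "\<dots> = K * bil (insert b V) p (q(b := q a))"
    unfolding bil_insert[OF V(1,3)] sum_distrib_left cong fun_upd_same
    by (rule sum.cong[OF refl], rule s)
  finally show ?thesis using z by simp
qed

text \<open>In the exchanged arrangement \<open>(q, x)\<close> the quadratic terms in \<open>x\<close> cancel; this saves one
  degree.\<close>
lemma bil_poly:
  assumes U: "finite U" "a \<notin> U"
  shows "\<exists>P. degree P \<le> card U + 2 \<and> (\<forall>x. poly P x = bil (insert a U) (p(a := x)) q)"
proof -
  define y where "y = q a"
  define c where "c = (\<lambda>R. pair_prod U (\<lambda>i j. (sel R p q i - sel R p q j) * (sel R q p i - sel R q p j)) * (\<Prod>j\<in>U. sel R q p j))"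
  define D where "D = (\<lambda>R. \<Sum>j\<in>U. (sel R p q j)\<^sup>2 - (sel R q p j)\<^sup>2)"
  define S where "S = (\<lambda>R. \<Sum>j\<in>U. sel R p q j - sel R q p j)"
  define P1 where "P1 = (\<lambda>R. smult (c R * (\<Prod>j\<in>U. y - sel R p q j))
       ((\<Prod>j\<in>U. [:- sel R q p j, 1:]) * [: 0, D R + y\<^sup>2 + (S R + y)\<^sup>2, - 2 * (S R + y) :]))"
  define P2 where "P2 = (\<lambda>R. smult (c R * y * (\<Prod>j\<in>U. y - sel R q p j))
       ((\<Prod>j\<in>U. [:- sel R p q j, 1:]) * [: D R - y\<^sup>2 + (S R - y)\<^sup>2, 2 * (S R - y), 2 :]))"
  have dl: "degree (\<Prod>j\<in>U. [:- f j, 1:]) \<le> card U" for f :: "nat \<Rightarrow> real"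
  proof -
    have "degree (\<Prod>j\<in>U. [:- f j, 1:]) \<le> sum (degree \<circ> (\<lambda>j. [:- f j, 1:])) U"
      by (rule degree_prod_sum_le[OF U(1)])
    then show ?thesis by simp
  qed
  have pe: "poly (\<Prod>j\<in>U. [:- f j, 1:]) x = (\<Prod>j\<in>U. x - f j)" for f :: "nat \<Rightarrow> real" and x
    by (simp add: poly_prod)
  have d1: "degree (P1 R) \<le> card U + 2" and d2: "degree (P2 R) \<le> card U + 2" for R
    unfolding P1_def P2_def
    by (rule order_trans[OF degree_smult_le], rule order_trans[OF degree_mult_le],
        rule add_mono[OF dl], simp)+
  have e1: "poly (P1 R) x = bil_ext U (sel R p q) (sel R q p) y x" for R x
    unfolding P1_def bil_ext_def prod.distrib
      poly_smult poly_mult pe c_def[THEN fun_cong, symmetric] D_def[THEN fun_cong, symmetric]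
      S_def[THEN fun_cong, symmetric]
    by (simp add: power2_eq_square algebra_simps)
  have e2: "poly (P2 R) x = bil_ext U (sel R p q) (sel R q p) x y" for R x
    unfolding P2_def bil_ext_def prod.distrib
      poly_smult poly_mult pe c_def[THEN fun_cong, symmetric] D_def[THEN fun_cong, symmetric]
      S_def[THEN fun_cong, symmetric]
    by (simp add: power2_eq_square algebra_simps)
  have cong: "bil_ext U (sel R (p(a := x)) q) (sel R q (p(a := x))) v w =
        bil_ext U (sel R p q) (sel R q p) v w" for R x v w
    by (rule bil_ext_cong) (use U in \<open>auto simp: sel_def\<close>)
  show ?thesis
  proof (intro exI conjI allI)
    show "degree (\<Sum>R\<in>Pow U. P1 R + P2 R) \<le> card U + 2"
      by (intro degree_sum_le degree_add_le d1 d2) (use U in auto)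
    show "poly (\<Sum>R\<in>Pow U. P1 R + P2 R) x = bil (insert a U) (p(a := x)) q" for x
      unfolding bil_insert[OF U] by (simp add: poly_sum e1 e2 cong y_def)
  qed
qed

text \<open>As a polynomial in \<open>p\<^sub>a\<close>, \<open>bil\<close> has degree at most \<open>n + 1\<close> for \<open>n\<close> pairs, but it vanishes at the
  \<open>2 n\<close> points \<open>0\<close>, \<open>q\<^sub>a\<close>, \<open>p\<^sub>j\<close>, \<open>q\<^sub>j\<close> (\<open>j \<noteq> a\<close>), where it reduces to an instance with fewer pairs.\<close>
lemma bil_eq_0: "finite W \<Longrightarrow> bil W p q = 0"
proof (induction "card W" arbitrary: W p q rule: less_induct)
  case (less W)
  note fin = less.prems
  have IH: "bil V p q = 0" if "card V < card W" "finite V" for V p q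
    using less.hyps[OF that(1) that(2)] .
  have cz: "bil W p q = 0" if "i \<in> W" "p i = 0" for i p q
  proof -
    have "bil (insert i (W - {i})) p q = 0"
      by (rule bil_zero[where p=p and q=q]) (use that fin IH[OF card_Diff1_less[OF fin that(1)]] in auto)
    then show ?thesis using that by (simp add: insert_absorb)
  qed
  have cs: "bil W p q = 0" if "i \<in> W" "p i = q i" for i p q
  proof -
    have "bil (insert i (W - {i})) p q = 0"
      by (rule bil_same) (use that fin IH[OF card_Diff1_less[OF fin that(1)]] in auto)
    then show ?thesis using that by (simp add: insert_absorb)
  qed
  have cm: "bil W p q = 0" if ij: "i \<in> W" "j \<in> W" "i \<noteq> j" "p i = q j" for i j p q
  proof -
    have "insert j (W - {i,j}) = W - {i}" using ij by auto
    then have z: "bil (insert j (W - {i,j})) p (q(j := q i)) = 0"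
      using IH[OF card_Diff1_less[OF fin ij(1)]] fin by simp
    have "bil (insert i (insert j (W - {i,j}))) p q = 0"
      by (rule bil_merge) (use ij fin z in auto)
    moreover have "insert i (insert j (W - {i,j})) = W" using ij by auto
    ultimately show ?thesis by simp
  qed
  \<comment> \<open>Swapping the pair \<open>j\<close> turns the coincidence of two \<open>p\<close>
    values into the case \<open>cm\<close>.\<close>
  have cpp: "bil W p q = 0" if ij: "i \<in> W" "j \<in> W" "i \<noteq> j" "p i = p j" for i j p q
    using cm[of i j "p(j := q j)" "q(j := p j)"] bil_swap[OF fin ij(2), of p q] ij by simp
  have cqq: "bil W p q = 0" if ij: "i \<in> W" "j \<in> W" "i \<noteq> j" "q i = q j" for i j p q
    using cm[of i j "p(i := q i)" "q(i := p i)"] bil_swap[OF fin ij(1), of p q] ij by simp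
  have cqz: "bil W p q = 0" if "i \<in> W" "q i = 0" for i p q
    using cz[of i "p(i := q i)" "q(i := p i)"] bil_swap[OF fin that(1), of p q] that by simp
  show ?case
  proof (cases "W = {}")
    case True
    then show ?thesis by (simp add: bil_def bil_term_def)
  next
    case False
    then obtain a where a: "a \<in> W" by auto
    define U where "U = W - {a}"
    have W: "W = insert a U" "finite U" "a \<notin> U" using a fin by (auto simp: U_def)
    show ?thesis
    proof (cases "U = {}")
      case True
      \<comment> \<open>For a single pair the two known zeros do not exceed the degree bound 2, so
        this case is computed directly.\<close>
      show ?thesis unfolding W(1) bil_insert[OF W(2,3)] unfolding True bil_ext_def
        by (simp add: power2_eq_square algebra_simps)
    next
      case False
      show ?thesis
      proof (rule ccontr)
        \<comment> \<open>Non-vanishing rules out every coincidence among the values, so that the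
          points of \<open>Z\<close> below are distinct and can be counted.\<close>
        assume nz: "bil W p q \<noteq> 0"
        have U_W: "U \<subseteq> W" using W by auto
        define Z where "Z = insert 0 (insert (q a) (p ` U \<union> q ` U))"
        have ip: "inj_on p U" by (rule inj_onI) (use nz cpp U_W in blast)
        have iq: "inj_on q U" by (rule inj_onI) (use nz cqq U_W in blast)
        have dis: "p ` U \<inter> q ` U = {}"
        proof (rule ccontr)
          assume "p ` U \<inter> q ` U \<noteq> {}"
          then obtain i j where "i \<in> U" "j \<in> U" "p i = q j" by auto
          then show False using nz cs[of i p q] cm[of i j p q] U_W by blast
        qed
        have qa: "q a \<notin> p ` U \<union> q ` U"
        proof
          assume "q a \<in> p ` U \<union> q ` U"
          then obtain i where i: "i \<in> U" "q a = p i \<or> q a = q i" by auto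
          have ia: "i \<noteq> a" "i \<in> W" using i W by auto
          from i(2) show False
          proof
            assume "q a = p i" then show False using cm[of i a p q] ia a nz by simp
          next
            assume "q a = q i" then show False using cqq[of a i q p] ia a nz by simp
          qed
        qed
        have z0: "0 \<notin> insert (q a) (p ` U \<union> q ` U)"
        proof
          assume "0 \<in> insert (q a) (p ` U \<union> q ` U)"
          then consider "q a = 0" | i where "i \<in> U" "p i = 0" | i where "i \<in> U" "q i = 0" by force
          then show False using nz cz[of _ p q] cqz[of _ q p] a U_W by cases blast+
        qed
        have cardZ: "card Z = 2 * card U + 2"
          unfolding Z_def using z0 qa W(2) dis
          by (simp add: card_Un_disjoint card_image[OF ip] card_image[OF iq])
        obtain P where P: "degree P \<le> card U + 2" "\<And>x. poly P x = bil W (p(a := x)) q"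
          using bil_poly[OF W(2,3)] W(1) by metis
        have "poly P x = 0" if "x \<in> Z" for x
        proof -
          consider "x = 0" | "x = q a" | i where "i \<in> U" "x = p i" | i where "i \<in> U" "x = q i"
            using \<open>x \<in> Z\<close> by (auto simp: Z_def)
          then show ?thesis
          proof cases
            case 1 then show ?thesis using cz[of a "p(a := x)" q] a P by simp
          next
            case 2 then show ?thesis using cs[of a "p(a := x)" q] a P by simp
          next
            case 3
            then have "i \<noteq> a" "i \<in> W" using W by auto
            then show ?thesis using cpp[of a i "p(a := x)" q] 3 a P by simp
          next
            case 4
            then have "i \<noteq> a" "i \<in> W" using W by auto
            then show ?thesis using cm[of a i "p(a := x)" q] 4 a P by simp
          qed
        qed
        then have sub: "Z \<subseteq> {x. poly P x = 0}" by auto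
        have "P = 0"
        proof (rule ccontr)
          assume "P \<noteq> 0"
          then have "card Z \<le> degree P"
            using card_mono[OF poly_roots_finite sub] card_poly_roots_bound[of P] by fastforce
          moreover have "card U > 0" using False W(2) by (simp add: card_gt_0_iff)
          ultimately show False using P(1) cardZ by linarith
        qed
        then have "bil W (p(a := p a)) q = 0" using P(2)[of "p a"] by simp
        then show False using nz by simp
      qed
    qed
  qed
qed

section \<open>The Lee-Yang circle theorem\<close>

text \<open>An Ising partition function with a weight for either state of each site:
  \<open>z j\<close> inside \<open>S\<close>, \<open>y m\<close> outside. Keeping both weights makes
  it homogeneous in each pair and, for symmetric \<open>a\<close>, invariant under exchanging
  \<open>y\<close> and \<open>z\<close>; both properties are used for the circle theorem.\<close>

definition LY :: "nat set \<Rightarrow> (nat \<Rightarrow> nat \<Rightarrow> real) \<Rightarrow> (nat \<Rightarrow> complex) \<Rightarrow> (nat \<Rightarrow> complex) \<Rightarrow> complex" where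
  "LY I a y z = (\<Sum>S\<in>Pow I. (\<Prod>j\<in>S. \<Prod>m\<in>I - S. complex_of_real (a j m)) *
     (\<Prod>m\<in>I - S. y m) * (\<Prod>j\<in>S. z j))"

lemma LY_cong:
  assumes "\<And>j m. j \<in> I \<Longrightarrow> m \<in> I \<Longrightarrow> j \<noteq> m \<Longrightarrow> a j m = a' j m"
    "\<And>j. j \<in> I \<Longrightarrow> y j = y' j" "\<And>j. j \<in> I \<Longrightarrow> z j = z' j"
  shows "LY I a y z = LY I a' y' z'"
  unfolding LY_def
proof (rule sum.cong[OF refl])
  fix S assume S: "S \<in> Pow I"
  have "(\<Prod>j\<in>S. \<Prod>m\<in>I - S. complex_of_real (a j m)) = (\<Prod>j\<in>S. \<Prod>m\<in>I - S. complex_of_real (a' j m))"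
    by (intro prod.cong refl arg_cong[of _ _ complex_of_real] assms(1)) (use S in auto)
  moreover have "(\<Prod>m\<in>I - S. y m) = (\<Prod>m\<in>I - S. y' m)" "(\<Prod>j\<in>S. z j) = (\<Prod>j\<in>S. z' j)"
    using S assms(2,3) by (auto intro!: prod.cong)
  ultimately show "(\<Prod>j\<in>S. \<Prod>m\<in>I - S. complex_of_real (a j m)) * (\<Prod>m\<in>I - S. y m) * (\<Prod>j\<in>S. z j) =
    (\<Prod>j\<in>S. \<Prod>m\<in>I - S. complex_of_real (a' j m)) * (\<Prod>m\<in>I - S. y' m) * (\<Prod>j\<in>S. z' j)"
    by simp
qed

lemma LY_empty [simp]: "LY {} a y z = 1"
  by (simp add: LY_def)

lemma LY_insert:
  assumes I: "finite I" "n \<notin> I"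
  shows "LY (insert n I) a y z =
    y n * LY I a y (\<lambda>j. of_real (a j n) * z j) + z n * LY I a (\<lambda>m. of_real (a n m) * y m) z"
proof -
  have 1: "(\<Prod>j\<in>S. \<Prod>m\<in>insert n I - S. complex_of_real (a j m)) * (\<Prod>m\<in>insert n I - S. y m) * (\<Prod>j\<in>S. z j)
      = y n * ((\<Prod>j\<in>S. \<Prod>m\<in>I - S. complex_of_real (a j m)) * (\<Prod>m\<in>I - S. y m) *
        (\<Prod>j\<in>S. of_real (a j n) * z j))" if "S \<in> Pow I" for S
  proof -
    have "insert n I - S = insert n (I - S)" using that I by auto
    then show ?thesis using I by (simp add: prod.distrib)
  qed
  have 2: "(\<Prod>j\<in>insert n S. \<Prod>m\<in>insert n I - insert n S. complex_of_real (a j m)) *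
        (\<Prod>m\<in>insert n I - insert n S. y m) * (\<Prod>j\<in>insert n S. z j)
      = z n * ((\<Prod>j\<in>S. \<Prod>m\<in>I - S. complex_of_real (a j m)) *
        (\<Prod>m\<in>I - S. of_real (a n m) * y m) * (\<Prod>j\<in>S. z j))" if "S \<in> Pow I" for S
  proof -
    have "insert n I - insert n S = I - S" using that I by auto
    moreover have "finite S" "n \<notin> S" using that I finite_subset by auto
    ultimately show ?thesis by (simp add: prod.distrib)
  qed
  show ?thesis
    unfolding LY_def sum_Pow_insert[OF I] sum.distrib sum_distrib_left
    by (intro arg_cong2[of _ _ _ _ "(+)"] sum.cong refl 1 2)
qed

lemma LY_commute:
  assumes "\<And>j m. a j m = a m j"
  shows "LY I a y z = LY I a z y"
  unfolding LY_def
proof (rule sum.reindex_bij_witness[of _ "\<lambda>S. I - S" "\<lambda>S. I - S"])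
  fix S assume "S \<in> Pow I"
  then have "I - (I - S) = S" by auto
  moreover have sw: "(\<Prod>j\<in>I - S. \<Prod>m\<in>S. complex_of_real (a j m)) =
      (\<Prod>j\<in>S. \<Prod>m\<in>I - S. complex_of_real (a j m))"
    by (subst prod.swap) (intro prod.cong refl arg_cong[of _ _ complex_of_real] assms)
  ultimately show "(\<Prod>j\<in>I - S. \<Prod>m\<in>I - (I - S). complex_of_real (a j m)) * (\<Prod>m\<in>I - (I - S). z m) * (\<Prod>j\<in>I - S. y j) =
     (\<Prod>j\<in>S. \<Prod>m\<in>I - S. complex_of_real (a j m)) * (\<Prod>m\<in>I - S. y m) * (\<Prod>j\<in>S. z j)"
    using sw by (simp add: mult_ac)
qed auto

lemma LY_scale:
  assumes "finite I"
  shows "LY I a (\<lambda>m. c m * y m) (\<lambda>m. c m * z m) = (\<Prod>m\<in>I. c m) * LY I a y z"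
proof -
  have "(\<Prod>m\<in>I - S. c m) * (\<Prod>m\<in>S. c m) = (\<Prod>m\<in>I. c m)" if "S \<in> Pow I" for S
    using prod.subset_diff[of S I c] that assms by auto
  note c = this
  show ?thesis
    unfolding LY_def sum_distrib_left prod.distrib
    by (rule sum.cong[OF refl]) (simp add: mult_ac flip: c)
qed

lemma cnj_LY: "cnj (LY I a y z) = LY I a (\<lambda>m. cnj (y m)) (\<lambda>m. cnj (z m))"
  by (simp add: LY_def)

text \<open>A zero coupling kills all \<open>S\<close> that separate \<open>d\<close> from
  \<open>d'\<close>. The two sites then act as one, whose weights and couplings are the
  products.\<close>

lemma LY_merge:
  assumes V: "finite V" "d \<notin> V" "d' \<notin> V" "d \<noteq> d'" and a: "a d d' = 0" "a d' d = 0"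
  shows "LY (insert d (insert d' V)) a y z = LY (insert d V)
    (\<lambda>j m. if j = d then a d m * a d' m else if m = d then a j d * a j d' else a j m)
    (y(d := y d * y d')) (z(d := z d * z d'))" (is "_ = LY _ ?a ?y ?z")
proof -
  have dW: "d \<notin> insert d' V" using V by auto
  have 1: "LY V ?a ?y (\<lambda>j. of_real (?a j d) * ?z j) =
      LY V a y (\<lambda>j. of_real (a j d') * (of_real (a j d) * z j))"
    by (rule LY_cong) (use V in auto)
  have 2: "LY V ?a (\<lambda>m. of_real (?a d m) * ?y m) ?z =
      LY V a (\<lambda>m. of_real (a d' m) * (of_real (a d m) * y m)) z"
    by (rule LY_cong) (use V in auto)
  show ?thesis
    unfolding LY_insert[OF V(1,2)] 1 2
    by (subst LY_insert | (use V in \<open>simp; fail\<close>))+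
       (simp add: a algebra_simps)
qed

lemma LY_reindex:
  assumes "inj_on f I"
  shows "LY (f ` I) a y z = LY I (\<lambda>j m. a (f j) (f m)) (\<lambda>j. y (f j)) (\<lambda>j. z (f j))"
proof -
  have inj: "inj_on (\<lambda>S. f ` S) (Pow I)"
    using assms by (simp add: inj_on_image_Pow)
  have "LY (f ` I) a y z = (\<Sum>S\<in>(\<lambda>S. f ` S) ` Pow I. (\<Prod>j\<in>S. \<Prod>m\<in>f ` I - S. complex_of_real (a j m)) *
     (\<Prod>m\<in>f ` I - S. y m) * (\<Prod>j\<in>S. z j))"
    unfolding LY_def by (simp add: image_Pow_surj)
  also have "\<dots> = LY I (\<lambda>j m. a (f j) (f m)) (\<lambda>j. y (f j)) (\<lambda>j. z (f j))"
    unfolding LY_def sum.reindex[OF inj]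
  proof (rule sum.cong[OF refl])
    fix S assume S: "S \<in> Pow I"
    have e: "f ` I - f ` S = f ` (I - S)"
      using inj_on_image_set_diff[OF assms, of I S] S by auto
    have i: "inj_on f S" "inj_on f (I - S)"
      using assms S by (auto intro: inj_on_subset)
    show "((\<lambda>S. (\<Prod>j\<in>S. \<Prod>m\<in>f ` I - S. complex_of_real (a j m)) *
     (\<Prod>m\<in>f ` I - S. y m) * (\<Prod>j\<in>S. z j)) \<circ> (`) f) S =
      (\<Prod>j\<in>S. \<Prod>m\<in>I - S. complex_of_real (a (f j) (f m))) * (\<Prod>m\<in>I - S. y (f m)) * (\<Prod>j\<in>S. z (f j))"
      by (simp add: e prod.reindex[OF i(1)] prod.reindex[OF i(2)])
  qed
  finally show ?thesis .
qed

lemma fun_upd_holomorphic [holomorphic_intros]: "(\<lambda>w. (y(d := w)) m) holomorphic_on A"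
  by (cases "m = d") auto

lemma LY_holomorphic [holomorphic_intros]:
  assumes "\<And>m. (\<lambda>w. y w m) holomorphic_on A"
  shows "(\<lambda>w. LY I a (y w) z) holomorphic_on A"
  unfolding LY_def by (intro holomorphic_intros assms)

text \<open>On the torus both sides have equal modulus, since \<open>LY\<close> is symmetric under
  \<open>y \<leftrightarrow> z\<close>; the maximum principle in one variable at a time extends
  the inequality to the polydisc.\<close>
lemma LY_norm_le:
  assumes I: "finite I" and sym: "\<And>j m. a j m = a m j"
    and nz: "\<And>y. (\<And>j. j \<in> I \<Longrightarrow> norm (y j) < 1) \<Longrightarrow> LY I a y (\<lambda>_. 1) \<noteq> 0"
    and \<alpha>: "\<And>j. j \<in> I \<Longrightarrow> 0 \<le> \<alpha> j" "\<And>j. j \<in> I \<Longrightarrow> \<alpha> j < 1"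
    and y: "\<And>j. j \<in> I \<Longrightarrow> norm (y j) \<le> 1"
  shows "norm (LY I a y (\<lambda>j. of_real (\<alpha> j))) \<le> norm (LY I a (\<lambda>j. of_real (\<alpha> j) * y j) (\<lambda>_. 1))"
proof -
  have nz': "LY I a (\<lambda>j. of_real (\<alpha> j) * y j) (\<lambda>_. 1) \<noteq> 0"
    if "\<And>j. j \<in> I \<Longrightarrow> norm (y j) \<le> 1" for y
  proof (rule nz)
    fix j assume "j \<in> I"
    then have "\<bar>\<alpha> j\<bar> < 1" "norm (y j) \<le> 1" using \<alpha> that by auto
    then show "norm (of_real (\<alpha> j) * y j) < 1"
      using mult_left_mono[of "norm (y j)" 1 "\<bar>\<alpha> j\<bar>"] by (simp add: norm_mult)
  qed
  \<comment> \<open>\<open>D\<close> collects the coordinates already allowed inside the disk; the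
    others are still on the unit circle.\<close>
  have main: "norm (LY I a y (\<lambda>j. of_real (\<alpha> j))) \<le> norm (LY I a (\<lambda>j. of_real (\<alpha> j) * y j) (\<lambda>_. 1))"
    if "finite D" "D \<subseteq> I" "\<And>j. j \<in> I - D \<Longrightarrow> norm (y j) = 1" "\<And>j. j \<in> D \<Longrightarrow> norm (y j) \<le> 1" for D y
    using that
  proof (induction D arbitrary: y rule: finite_induct)
    case empty
    then have y1: "norm (y j) = 1" if "j \<in> I" for j using that by auto
    have yy: "y j * cnj (y j) = 1" if "j \<in> I" for j
      using y1[OF that] by (metis complex_norm_square of_real_1 power_one)
    have "LY I a y (\<lambda>j. of_real (\<alpha> j)) = LY I a (\<lambda>j. of_real (\<alpha> j)) y"
      by (rule LY_commute[OF sym])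
    also have "\<dots> = LY I a (\<lambda>j. y j * (of_real (\<alpha> j) * cnj (y j))) (\<lambda>j. y j * 1)"
      by (rule LY_cong) (auto simp: yy mult.left_commute)
    also have "\<dots> = (\<Prod>j\<in>I. y j) * LY I a (\<lambda>j. of_real (\<alpha> j) * cnj (y j)) (\<lambda>_. 1)"
      by (rule LY_scale[OF I])
    also have "LY I a (\<lambda>j. of_real (\<alpha> j) * cnj (y j)) (\<lambda>_. 1)
        = cnj (LY I a (\<lambda>j. of_real (\<alpha> j) * y j) (\<lambda>_. 1))"
      by (simp add: cnj_LY)
    finally show ?case by (simp add: norm_mult prod_norm[symmetric] y1)
  next
    case (insert d D)
    \<comment> \<open>As \<open>\<alpha> j < 1\<close>, the arguments in the denominator stay in the
      open polydisk even for \<open>w\<close> on the unit circle, so \<open>f\<close> has no pole on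
      the closed disk.\<close>
    define f where "f = (\<lambda>w. LY I a (y(d := w)) (\<lambda>j. of_real (\<alpha> j)) /
        LY I a (\<lambda>j. of_real (\<alpha> j) * (y(d := w)) j) (\<lambda>_. 1))"
    have y': "norm (y j) \<le> 1" if "j \<in> I" for j
      using insert.prems(2,3)[of j] that by (cases "j \<in> insert d D") auto
    have den: "LY I a (\<lambda>j. of_real (\<alpha> j) * (y(d := w)) j) (\<lambda>_. 1) \<noteq> 0" if "norm w \<le> 1" for w
      by (rule nz') (use y' that in auto)
    have hol: "f holomorphic_on cball 0 1"
      unfolding f_def by (intro holomorphic_intros den) auto
    have "norm (f (y d)) \<le> 1"
    proof (rule maximum_modulus_frontier[of f "cball 0 1"])
      show "f holomorphic_on interior (cball 0 1)"
        by (rule holomorphic_on_subset[OF hol]) (auto simp: interior_subset)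
      show "continuous_on (closure (cball 0 1)) f"
        using holomorphic_on_imp_continuous_on[OF hol] by simp
      show "bounded (cball (0::complex) 1)" by simp
      show "y d \<in> cball 0 1" using insert.prems(3) by auto
      fix w :: complex assume "w \<in> frontier (cball 0 1)"
      then have w: "norm w = 1" by (simp add: frontier_cball)
      have "norm (LY I a (y(d := w)) (\<lambda>j. of_real (\<alpha> j)))
          \<le> norm (LY I a (\<lambda>j. of_real (\<alpha> j) * (y(d := w)) j) (\<lambda>_. 1))"
        by (rule insert.IH) (use insert.prems w in auto)
      then show "norm (f w) \<le> 1"
        using den[of w] w by (simp add: f_def norm_divide)
    qed
    moreover have "LY I a (\<lambda>j. of_real (\<alpha> j) * y j) (\<lambda>_. 1) \<noteq> 0" by (rule nz'[OF y'])
    ultimately show ?case by (simp add: f_def norm_divide del: fun_upd_apply)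
  qed
  show ?thesis by (rule main[of I y]) (use I y in auto)
qed

text \<open>Adjoining a site \<open>n\<close> gives \<open>y n * B + A\<close>, where
  \<open>A\<close> is nonzero by induction and \<open>norm B \<le> norm A\<close> by
  \<open>LY_norm_le\<close>; since \<open>norm (y n) < 1\<close>, the two terms cannot
  cancel.\<close>

theorem Lee_Yang:
  assumes "finite I" and sym: "\<And>j m. a j m = a m j"
    and "\<And>j m. j \<in> I \<Longrightarrow> m \<in> I \<Longrightarrow> j \<noteq> m \<Longrightarrow> 0 \<le> a j m \<and> a j m < 1"
    and "\<And>j. j \<in> I \<Longrightarrow> norm (y j) < 1"
  shows "LY I a y (\<lambda>_. 1) \<noteq> 0"
  using assms(1,3,4)
proof (induction I arbitrary: y rule: finite_induct)
  case (insert n I)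
  have IH: "LY I a y (\<lambda>_. 1) \<noteq> 0" if "\<And>j. j \<in> I \<Longrightarrow> norm (y j) < 1" for y
    by (rule insert.IH) (use insert.prems that in auto)
  have an: "0 \<le> a n j" "a n j < 1" if "j \<in> I" for j
    using insert.prems(1)[of n j] insert.hyps that by auto
  define A where "A = LY I a (\<lambda>j. of_real (a n j) * y j) (\<lambda>_. 1)"
  define B where "B = LY I a y (\<lambda>j. of_real (a n j))"
  have "norm B \<le> norm A"
    unfolding A_def B_def
    by (rule LY_norm_le[OF insert.hyps(1) sym IH an]) (use insert.prems in \<open>auto intro: less_imp_le\<close>)
  moreover have "A \<noteq> 0"
    unfolding A_def
  proof (rule IH)
    fix j assume j: "j \<in> I"
    then have "norm (y j) < 1" "\<bar>a n j\<bar> < 1" using insert.prems an by auto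
    then show "norm (of_real (a n j) * y j) < 1"
      using mult_left_mono[of "norm (y j)" 1 "\<bar>a n j\<bar>"] by (simp add: norm_mult)
  qed
  moreover have "norm (y n) < 1" using insert.prems by auto
  ultimately have "norm (y n * B) < norm A"
  proof (cases "B = 0")
    case False
    then have "norm (y n) * norm B < 1 * norm B"
      by (intro mult_strict_right_mono) (use \<open>norm (y n) < 1\<close> in auto)
    then show ?thesis using \<open>norm B \<le> norm A\<close> by (simp add: norm_mult)
  qed simp
  then have "y n * B + A \<noteq> 0"
    by (metis add_eq_0_iff less_irrefl norm_minus_cancel)
  moreover have "LY (insert n I) a y (\<lambda>_. 1) = y n * B + A"
    unfolding LY_insert[OF insert.hyps(1,2)] A_def B_def by (simp add: sym[of _ n])
  ultimately show ?case by simp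
qed simp

section \<open>The bilinear identity\<close>

lemma pair_prod_mult:
  "pair_prod U (\<lambda>i j. f i j * g i j) = pair_prod U f * pair_prod U g"
  by (simp add: pair_prod_def case_prod_unfold prod.distrib)

lemma pair_prod_nonzero:
  fixes f :: "nat \<Rightarrow> nat \<Rightarrow> 'a::semidom"
  assumes "finite U" "\<And>i j. i \<in> U \<Longrightarrow> j \<in> U \<Longrightarrow> i \<noteq> j \<Longrightarrow> f i j \<noteq> 0"
  shows "pair_prod U f \<noteq> 0"
proof -
  have "finite {(i,j). i \<in> U \<and> j \<in> U \<and> i < j}"
    by (rule finite_subset[of _ "U \<times> U"]) (use assms(1) in auto)
  then show ?thesis unfolding pair_prod_def using assms(2) by auto
qed

lemma pair_prod_mixed:
  assumes "finite U" and sym: "\<And>i j. g i j = g j i"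
  shows "pair_prod U (\<lambda>i j. if (i \<in> R) = (j \<in> R) then 1 else g i j) =
    (\<Prod>j\<in>U - R. \<Prod>m\<in>U \<inter> R. g j m)"
  using assms(1)
proof (induction U rule: finite_induct)
  case (insert a U)
  have "pair_prod (insert a U) (\<lambda>i j. if (i \<in> R) = (j \<in> R) then 1 else g i j) =
     (\<Prod>j\<in>U. if (a \<in> R) = (j \<in> R) then 1 else g a j) * (\<Prod>j\<in>U - R. \<Prod>m\<in>U \<inter> R. g j m)"
    by (subst pair_prod_insert) (use insert sym in auto)
  also have "\<dots> = (\<Prod>j\<in>insert a U - R. \<Prod>m\<in>insert a U \<inter> R. g j m)"
  proof (cases "a \<in> R")
    case True
    have "(\<Prod>j\<in>U. if (a \<in> R) = (j \<in> R) then 1 else g a j) = (\<Prod>j\<in>U - R. g a j)"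
      using insert.hyps(1) True by (intro prod.mono_neutral_cong_right) auto
    moreover have "insert a U - R = U - R" "insert a U \<inter> R = insert a (U \<inter> R)" using True by auto
    ultimately show ?thesis using insert.hyps by (simp add: prod.distrib sym[of a])
  next
    case False
    have "(\<Prod>j\<in>U. if (a \<in> R) = (j \<in> R) then 1 else g a j) = (\<Prod>j\<in>U \<inter> R. g a j)"
      using insert.hyps(1) False by (intro prod.mono_neutral_cong_right) auto
    moreover have "insert a U - R = insert a (U - R)" "insert a U \<inter> R = U \<inter> R" using False by auto
    ultimately show ?thesis using insert.hyps by simp
  qed
  finally show ?case .
qed simp

text \<open>Multiplication by the nonzero factor \<open>K\<close>, which belongs to the choice
  \<open>R = {}\<close>, turns the sum into \<open>bil U p q\<close>. Passing to another
  \<open>R\<close> changes only the factors of pairs split by \<open>R\<close>, each by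
  \<open>(a j m)^2\<close>, and the product of the \<open>Y j\<close>, by the weights
  \<open>w m = q m / p m\<close>.\<close>

lemma weighted_bil:
  fixes a :: "nat \<Rightarrow> nat \<Rightarrow> real"
  assumes U: "finite U" and sym: "\<And>i j. a i j = a j i"
    and a: "\<And>j m. j \<in> U \<Longrightarrow> m \<in> U \<Longrightarrow> j \<noteq> m \<Longrightarrow>
      (a j m)\<^sup>2 * ((q m - q j) * (p m - p j)) = (p m - q j) * (q m - p j)"
    and w: "\<And>m. m \<in> U \<Longrightarrow> w m * p m = q m" "\<And>m. m \<in> U \<Longrightarrow> p m \<noteq> 0"
    and inj: "inj_on p U" "inj_on q U"
  shows "(\<Sum>R\<in>Pow U. ((\<Prod>j\<in>U - R. \<Prod>m\<in>R. (a j m)\<^sup>2) * (\<Prod>m\<in>R. w m)) *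
     ((\<Sum>j\<in>R. (p j)\<^sup>2 - (q j)\<^sup>2) - (\<Sum>j\<in>U - R. (p j)\<^sup>2 - (q j)\<^sup>2)
       + ((\<Sum>j\<in>R. p j - q j) - (\<Sum>j\<in>U - R. p j - q j))\<^sup>2)) = 0"
proof -
  define K where "K = pair_prod U (\<lambda>i j. (q i - q j) * (p i - p j)) * (\<Prod>j\<in>U. p j)"
  have "pair_prod U (\<lambda>i j. (q i - q j) * (p i - p j)) \<noteq> 0"
    using inj by (intro pair_prod_nonzero[OF U]) (auto simp: inj_on_def)
  then have K: "K \<noteq> 0" unfolding K_def using U w(2) by auto
  have t: "K * (((\<Prod>j\<in>U - R. \<Prod>m\<in>R. (a j m)\<^sup>2) * (\<Prod>m\<in>R. w m)) *
     ((\<Sum>j\<in>R. (p j)\<^sup>2 - (q j)\<^sup>2) - (\<Sum>j\<in>U - R. (p j)\<^sup>2 - (q j)\<^sup>2)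
       + ((\<Sum>j\<in>R. p j - q j) - (\<Sum>j\<in>U - R. p j - q j))\<^sup>2))
     = bil_term U (sel R p q) (sel R q p)" if R: "R \<in> Pow U" for R
  proof -
    have UR: "U = R \<union> (U - R)" "R \<inter> (U - R) = {}" "finite R" "finite (U - R)" "U \<inter> R = R"
      using R U finite_subset by auto
    have sum_split: "sum f U = sum f R + sum f (U - R)" for f :: "nat \<Rightarrow> real"
      using UR by (metis sum.union_disjoint)
    have prod_split: "prod f U = prod f R * prod f (U - R)" for f :: "nat \<Rightarrow> real"
      using UR by (metis prod.union_disjoint)
    have "pair_prod U (\<lambda>i j. (sel R p q i - sel R p q j) * (sel R q p i - sel R q p j)) =
       pair_prod U (\<lambda>i j. (if (i \<in> R) = (j \<in> R) then 1 else (a i j)\<^sup>2) * ((q i - q j) * (p i - p j)))"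
    proof (rule pair_prod_cong)
      fix i j assume ij: "i \<in> U" "j \<in> U"
      show "(sel R p q i - sel R p q j) * (sel R q p i - sel R q p j) =
         (if (i \<in> R) = (j \<in> R) then 1 else (a i j)\<^sup>2) * ((q i - q j) * (p i - p j))"
      proof (cases "(i \<in> R) = (j \<in> R)")
        case False
        then have "i \<noteq> j" by auto
        from a[OF ij this] False show ?thesis
          by (auto simp: sel_def algebra_simps)
      qed (auto simp: sel_def)
    qed
    also have "\<dots> = (\<Prod>j\<in>U - R. \<Prod>m\<in>R. (a j m)\<^sup>2) * pair_prod U (\<lambda>i j. (q i - q j) * (p i - p j))"
      unfolding pair_prod_mult by (subst pair_prod_mixed) (use U sym UR in auto)
    finally have 1: "pair_prod U (\<lambda>i j. (sel R p q i - sel R p q j) * (sel R q p i - sel R q p j)) = \<dots>" .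
    have "(\<Prod>j\<in>U. sel R q p j) = (\<Prod>j\<in>R. w j * p j) * (\<Prod>j\<in>U - R. p j)"
      unfolding prod_split using w R by (intro arg_cong2[of _ _ _ _ "(*)"] prod.cong) (auto simp: sel_def)
    then have 2: "(\<Prod>j\<in>U. sel R q p j) = (\<Prod>j\<in>R. w j) * (\<Prod>j\<in>U. p j)"
      unfolding prod_split by (simp add: prod.distrib)
    have 3: "(\<Sum>j\<in>U. (sel R p q j)\<^sup>2 - (sel R q p j)\<^sup>2) =
       (\<Sum>j\<in>R. (p j)\<^sup>2 - (q j)\<^sup>2) - (\<Sum>j\<in>U - R. (p j)\<^sup>2 - (q j)\<^sup>2)"
      unfolding sum_split by (simp add: sel_def sum_negf[symmetric])
    have 4: "(\<Sum>j\<in>U. sel R p q j - sel R q p j) = (\<Sum>j\<in>R. p j - q j) - (\<Sum>j\<in>U - R. p j - q j)"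
      unfolding sum_split by (simp add: sel_def sum_negf[symmetric])
    show ?thesis unfolding bil_term_def 1 2 3 4 K_def by (simp only: mult_ac)
  qed
  have "K * (\<Sum>R\<in>Pow U. ((\<Prod>j\<in>U - R. \<Prod>m\<in>R. (a j m)\<^sup>2) * (\<Prod>m\<in>R. w m)) *
     ((\<Sum>j\<in>R. (p j)\<^sup>2 - (q j)\<^sup>2) - (\<Sum>j\<in>U - R. (p j)\<^sup>2 - (q j)\<^sup>2)
       + ((\<Sum>j\<in>R. p j - q j) - (\<Sum>j\<in>U - R. p j - q j))\<^sup>2)) = bil U p q"
    unfolding bil_def sum_distrib_left by (rule sum.cong[OF refl t])
  then show ?thesis using bil_eq_0[OF U] K by auto
qed

definition mixed_prod :: "(nat \<Rightarrow> nat \<Rightarrow> real) \<Rightarrow> nat set \<Rightarrow> nat set \<Rightarrow> complex" where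
  "mixed_prod a A B = (\<Prod>j\<in>A. \<Prod>m\<in>B. complex_of_real (a j m))"

lemma mixed_prod_Un1:
  "finite A \<Longrightarrow> finite B \<Longrightarrow> A \<inter> B = {} \<Longrightarrow> mixed_prod a (A \<union> B) C = mixed_prod a A C * mixed_prod a B C"
  by (simp add: mixed_prod_def prod.union_disjoint)

lemma mixed_prod_Un2:
  "finite A \<Longrightarrow> finite B \<Longrightarrow> A \<inter> B = {} \<Longrightarrow> mixed_prod a C (A \<union> B) = mixed_prod a C A * mixed_prod a C B"
  by (simp add: mixed_prod_def prod.union_disjoint prod.distrib)

lemma mixed_prod_commute:
  assumes "\<And>i j. a i j = a j i"
  shows "mixed_prod a A B = mixed_prod a B A"
  unfolding mixed_prod_def
  by (subst prod.swap) (intro prod.cong refl arg_cong[of _ _ complex_of_real] assms)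

text \<open>The double sum splits into the groups with fixed \<open>X = A - B\<close> and
  \<open>Y = B - A\<close>. Each group is a constant times an instance of
  \<open>weighted_bil\<close> on the indices outside \<open>X\<close> and \<open>Y\<close>.\<close>

lemma bilinear_identity:
  fixes a :: "nat \<Rightarrow> nat \<Rightarrow> real" and \<beta> :: "nat \<Rightarrow> complex"
  assumes I: "finite I" and sym: "\<And>i j. a i j = a j i"
    and a: "\<And>j m. j \<in> I \<Longrightarrow> m \<in> I \<Longrightarrow> j \<noteq> m \<Longrightarrow>
      (a j m)\<^sup>2 * ((q m - q j) * (p m - p j)) = (p m - q j) * (q m - p j)"
    and \<beta>: "\<And>m. m \<in> I \<Longrightarrow> (cmod (\<beta> m))\<^sup>2 * p m = q m" "\<And>m. m \<in> I \<Longrightarrow> p m \<noteq> 0"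
    and inj: "inj_on p I" "inj_on q I"
  defines "h \<equiv> \<lambda>A. mixed_prod a (I - A) A * (\<Prod>m\<in>A. \<beta> m)"
    and "D \<equiv> \<lambda>A. \<Sum>j\<in>A. (p j)\<^sup>2 - (q j)\<^sup>2" and "\<kappa> \<equiv> \<lambda>A. \<Sum>j\<in>A. p j - q j"
  shows "(\<Sum>A\<in>Pow I. \<Sum>B\<in>Pow I. of_real (D A + D B - D I + (\<kappa> A + \<kappa> B - \<kappa> I)\<^sup>2) * (h A * cnj (h B))) = 0"
proof -
  define \<sigma> where "\<sigma> = (\<lambda>A B. D A + D B - D I + (\<kappa> A + \<kappa> B - \<kappa> I)\<^sup>2)"
  define T where "T = {(X,Y). X \<subseteq> I \<and> Y \<subseteq> I \<and> X \<inter> Y = {}}"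
  have T: "finite T" by (rule finite_subset[of _ "Pow I \<times> Pow I"]) (use I in \<open>auto simp: T_def\<close>)
  have inner: "(\<Sum>R\<in>Pow (I - X - Y). of_real (\<sigma> (X \<union> R) (Y \<union> R)) * (h (X \<union> R) * cnj (h (Y \<union> R)))) = 0"
    if XY: "X \<subseteq> I" "Y \<subseteq> I" "X \<inter> Y = {}" for X Y
  proof -
    define U where "U = I - X - Y"
    have fin: "finite U" "finite X" "finite Y" using I XY finite_subset by (auto simp: U_def)
    define w where "w = (\<lambda>m. (cmod (\<beta> m))\<^sup>2)"
    define K where "K = mixed_prod a U X * mixed_prod a U Y * mixed_prod a X Y * mixed_prod a Y X *
        (\<Prod>m\<in>X. \<beta> m) * (\<Prod>m\<in>Y. cnj (\<beta> m))"
    have t: "of_real (\<sigma> (X \<union> R) (Y \<union> R)) * (h (X \<union> R) * cnj (h (Y \<union> R))) = K * of_real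
       (((\<Prod>j\<in>U - R. \<Prod>m\<in>R. (a j m)\<^sup>2) * (\<Prod>m\<in>R. w m)) *
     ((\<Sum>j\<in>R. (p j)\<^sup>2 - (q j)\<^sup>2) - (\<Sum>j\<in>U - R. (p j)\<^sup>2 - (q j)\<^sup>2)
       + ((\<Sum>j\<in>R. p j - q j) - (\<Sum>j\<in>U - R. p j - q j))\<^sup>2))" if R: "R \<in> Pow U" for R
    proof -
      have finR: "finite R" "finite (U - R)" using R fin finite_subset by auto
      have disj: "X \<inter> R = {}" "Y \<inter> R = {}" "(U - R) \<inter> Y = {}" "(U - R) \<inter> X = {}" "(U - R) \<inter> R = {}"
        using R by (auto simp: U_def)
      have comp: "I - (X \<union> R) = (U - R) \<union> Y" "I - (Y \<union> R) = (U - R) \<union> X"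
        using R XY by (auto simp: U_def)
      have UR: "U = (U - R) \<union> R" using R by auto
      have cm: "cnj (mixed_prod a A B) = mixed_prod a A B" for A B by (simp add: mixed_prod_def)
      note C = mixed_prod_commute[of a, OF sym]
      have hX: "h (X \<union> R) = mixed_prod a (U - R) X * mixed_prod a (U - R) R * mixed_prod a Y X *
          mixed_prod a R Y * ((\<Prod>m\<in>X. \<beta> m) * (\<Prod>m\<in>R. \<beta> m))"
        unfolding h_def comp using fin finR disj
        by (simp add: mixed_prod_Un1 mixed_prod_Un2 C[of Y R] prod.union_disjoint)
      have hY: "h (Y \<union> R) = mixed_prod a (U - R) Y * mixed_prod a (U - R) R * mixed_prod a X Y *
          mixed_prod a R X * ((\<Prod>m\<in>Y. \<beta> m) * (\<Prod>m\<in>R. \<beta> m))"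
        unfolding h_def comp using fin finR disj
        by (simp add: mixed_prod_Un1 mixed_prod_Un2 C[of X R] prod.union_disjoint)
      have U1: "mixed_prod a U Z = mixed_prod a (U - R) Z * mixed_prod a R Z" for Z
        by (subst UR) (rule mixed_prod_Un1[OF finR(2,1) disj(5)])
      have bb: "(\<Prod>m\<in>R. \<beta> m) * (\<Prod>m\<in>R. cnj (\<beta> m)) = of_real (\<Prod>m\<in>R. w m)"
        unfolding w_def of_real_prod prod.distrib[symmetric]
        by (rule prod.cong) (simp_all add: complex_norm_square[symmetric] of_real_power[symmetric] del: of_real_power)
      have aa: "of_real (\<Prod>j\<in>U - R. \<Prod>m\<in>R. (a j m)\<^sup>2) = mixed_prod a (U - R) R * mixed_prod a (U - R) R"
        unfolding mixed_prod_def by (simp add: prod.distrib[symmetric] power2_eq_square)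
      \<comment> \<open>The couplings of \<open>X\<close> with \<open>R\<close> and of
        \<open>X\<close> with \<open>U - R\<close> come from different factors and combine to a
        coupling with all of \<open>U\<close>; likewise for \<open>Y\<close>. Hence \<open>K\<close>
        does not depend on \<open>R\<close>.\<close>
      have "h (X \<union> R) * cnj (h (Y \<union> R)) = K * (mixed_prod a (U - R) R * mixed_prod a (U - R) R) *
           ((\<Prod>m\<in>R. \<beta> m) * (\<Prod>m\<in>R. cnj (\<beta> m)))"
        unfolding hX hY K_def U1 by (simp add: cm mult_ac)
      also have "\<dots> = K * of_real ((\<Prod>j\<in>U - R. \<Prod>m\<in>R. (a j m)\<^sup>2) * (\<Prod>m\<in>R. w m))"
        unfolding bb aa[symmetric] by simp
      finally have hh: "h (X \<union> R) * cnj (h (Y \<union> R)) = \<dots>" .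
      have sumI: "sum f I = sum f X + sum f Y + sum f R + sum f (U - R)"
        and sumX: "sum f (X \<union> R) = sum f X + sum f R" and sumY: "sum f (Y \<union> R) = sum f Y + sum f R"
        for f :: "nat \<Rightarrow> real"
      proof -
        have "I = (X \<union> Y) \<union> (R \<union> (U - R))" using XY R by (auto simp: U_def)
        then have "sum f I = sum f (X \<union> Y) + sum f (R \<union> (U - R))"
          using sum.union_disjoint[of "X \<union> Y" "R \<union> (U - R)" f] fin finR disj by auto
        then show "sum f I = sum f X + sum f Y + sum f R + sum f (U - R)"
          using sum.union_disjoint[of X Y f] sum.union_disjoint[of R "U - R" f] fin finR disj XY by auto
      qed (use fin finR disj in \<open>auto simp: sum.union_disjoint\<close>)
      \<comment> \<open>The contributions of \<open>X\<close> and \<open>Y\<close> cancel, because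
        \<open>I\<close> is the disjoint union of \<open>X\<close>, \<open>Y\<close>,
        \<open>R\<close> and \<open>U - R\<close>.\<close>
      have "\<sigma> (X \<union> R) (Y \<union> R) = (\<Sum>j\<in>R. (p j)\<^sup>2 - (q j)\<^sup>2) - (\<Sum>j\<in>U - R. (p j)\<^sup>2 - (q j)\<^sup>2)
       + ((\<Sum>j\<in>R. p j - q j) - (\<Sum>j\<in>U - R. p j - q j))\<^sup>2"
        unfolding \<sigma>_def D_def \<kappa>_def sumI sumX sumY by (simp add: algebra_simps)
      then show ?thesis unfolding hh by (simp add: mult_ac)
    qed
    have "(\<Sum>R\<in>Pow U. of_real (\<sigma> (X \<union> R) (Y \<union> R)) * (h (X \<union> R) * cnj (h (Y \<union> R)))) = K * of_real
       (\<Sum>R\<in>Pow U. ((\<Prod>j\<in>U - R. \<Prod>m\<in>R. (a j m)\<^sup>2) * (\<Prod>m\<in>R. w m)) *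
     ((\<Sum>j\<in>R. (p j)\<^sup>2 - (q j)\<^sup>2) - (\<Sum>j\<in>U - R. (p j)\<^sup>2 - (q j)\<^sup>2)
       + ((\<Sum>j\<in>R. p j - q j) - (\<Sum>j\<in>U - R. p j - q j))\<^sup>2))"
      unfolding of_real_sum sum_distrib_left by (rule sum.cong[OF refl t])
    also have "\<dots> = K * of_real 0"
    proof -
      have s: "U \<subseteq> I" by (auto simp: U_def)
      have aU: "(a j m)\<^sup>2 * ((q m - q j) * (p m - p j)) = (p m - q j) * (q m - p j)"
        if "j \<in> U" "m \<in> U" "j \<noteq> m" for j m
        by (rule a) (use s that in auto)
      show ?thesis
        by (subst weighted_bil[OF fin(1) sym aU])
           (use s \<beta> inj in \<open>auto simp: w_def intro: inj_on_subset\<close>)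
    qed
    finally show ?thesis by (simp add: U_def)
  qed
  have e1: "A - B \<union> A \<inter> B = A" and e2: "B - A \<union> A \<inter> B = B" for A B :: "nat set" by auto
  have "(\<Sum>A\<in>Pow I. \<Sum>B\<in>Pow I. of_real (\<sigma> A B) * (h A * cnj (h B))) =
      (\<Sum>(A,B)\<in>Pow I \<times> Pow I. of_real (\<sigma> A B) * (h A * cnj (h B)))"
    by (simp add: sum.cartesian_product)
  also have "\<dots> = (\<Sum>(Z,R)\<in>Sigma T (\<lambda>Z. Pow (I - fst Z - snd Z)).
      of_real (\<sigma> (fst Z \<union> R) (snd Z \<union> R)) * (h (fst Z \<union> R) * cnj (h (snd Z \<union> R))))"
    by (rule sum.reindex_bij_witness[where j = "\<lambda>(A,B). ((A - B, B - A), A \<inter> B)"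
          and i = "\<lambda>(Z,R). (fst Z \<union> R, snd Z \<union> R)"]) (auto simp: T_def e1 e2)
  also have "\<dots> = (\<Sum>Z\<in>T. \<Sum>R\<in>Pow (I - fst Z - snd Z).
      of_real (\<sigma> (fst Z \<union> R) (snd Z \<union> R)) * (h (fst Z \<union> R) * cnj (h (snd Z \<union> R))))"
    by (rule sum.Sigma[symmetric]) (use I T in auto)
  also have "\<dots> = 0"
    by (rule sum.neutral) (use inner in \<open>auto simp: T_def\<close>)
  finally show ?thesis by (simp add: \<sigma>_def)
qed

section \<open>Fourier coefficients and the Hilbert transform\<close>

lemma has_integral_cis_int:
  "((\<lambda>y. cis (real_of_int l * y)) has_integral (if l = 0 then 2 * of_real pi else 0)) {0..2*pi}"
proof (cases "l = 0")
  case True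
  then show ?thesis using has_integral_const_real[of "1::complex" 0 "2*pi"] by (simp add: scaleR_conv_of_real)
next
  case False
  define F where "F = (\<lambda>y. cis (real_of_int l * y) / (\<i> * of_int l))"
  have "((\<lambda>y. cis (real_of_int l * y)) has_integral (F (2*pi) - F 0)) {0..2*pi}"
  proof (rule fundamental_theorem_of_calculus)
    fix x assume "x \<in> {0..2*pi}"
    have "((\<lambda>z. exp (\<i> * (of_int l * z)) / (\<i> * of_int l)) has_field_derivative exp (\<i> * (of_int l * of_real x))) (at (of_real x))"
      using False by (auto intro!: derivative_eq_intros simp: mult_ac)
    from has_vector_derivative_real_field[OF this]
    show "(F has_vector_derivative cis (real_of_int l * x)) (at x within {0..2*pi})"
      by (simp add: F_def cis_conv_exp)
  qed auto
  moreover have "cis (real_of_int l * (2 * pi)) = 1"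
    using cis_multiple_2pi[of "real_of_int l"] by (simp add: mult_ac)
  ultimately show ?thesis using False by (simp add: F_def)
qed

context
  fixes g :: "complex \<Rightarrow> complex" and r :: real and c :: "nat \<Rightarrow> complex"
  assumes hol: "g holomorphic_on ball 0 r" and r: "1 < r"
  defines "c \<equiv> \<lambda>n. (deriv ^^ n) g 0 / fact n"
begin

lemma Taylor_sums: "norm z < r \<Longrightarrow> (\<lambda>n. c n * z ^ n) sums g z"
  using holomorphic_power_series[OF hol, of z] by (simp add: c_def)

lemma Taylor_summable: "summable (\<lambda>n. norm (c n))"
proof -
  define \<rho> where "\<rho> = (1 + r) / 2"
  have \<rho>: "1 < \<rho>" "\<rho> < r" using r by (auto simp: \<rho>_def)
  have "summable (\<lambda>n. c n * of_real \<rho> ^ n)"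
    by (rule sums_summable[OF Taylor_sums]) (use \<rho> in simp)
  from powser_insidea[OF this, of 1] show ?thesis using \<rho> by simp
qed

text \<open>Because \<open>r > 1\<close>, the Taylor series converges absolutely, hence uniformly,
  on the unit circle and may be integrated termwise against the orthogonal exponentials. Negative
  frequencies do not occur.\<close>

lemma has_integral_Fourier:
  "((\<lambda>y. g (cis y) * cis (- (real_of_int m * y))) has_integral
     (if m < 0 then 0 else 2 * of_real pi * c (nat m))) {0..2*pi}"
proof -
  let ?J = "if m < 0 then 0 else 2 * of_real pi * c (nat m)"
  define f where "f = (\<lambda>n y. c n * cis (real_of_int (int n - m) * y))"
  have fe: "f n y = c n * cis y ^ n * cis (- (real_of_int m * y))" for n y
    by (simp add: f_def Complex.DeMoivre cis_mult algebra_simps)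
  have "uniform_limit {0..2*pi} (\<lambda>N y. \<Sum>n<N. f n y) (\<lambda>y. \<Sum>n. f n y) sequentially"
    by (rule Weierstrass_m_test[OF _ Taylor_summable]) (simp add: f_def norm_mult)
  moreover have "(\<Sum>n. f n y) = g (cis y) * cis (- (real_of_int m * y))" for y
    unfolding fe using sums_mult2[OF Taylor_sums[of "cis y"]] r by (auto simp: sums_iff)
  ultimately have "uniform_limit {0..2*pi} (\<lambda>N y. \<Sum>n<N. f n y)
      (\<lambda>y. g (cis y) * cis (- (real_of_int m * y))) sequentially" by simp
  then obtain I J where IJ: "\<And>N. ((\<lambda>y. \<Sum>n<N. f n y) has_integral I N) {0..2*pi}"
     "((\<lambda>y. g (cis y) * cis (- (real_of_int m * y))) has_integral J) {0..2*pi}" "I \<longlonglongrightarrow> J"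
    by (rule uniform_limit_integral) (auto simp: f_def intro!: continuous_intros)
  have "((\<lambda>y. \<Sum>n<N. f n y) has_integral (\<Sum>n<N. c n * (if int n - m = 0 then 2 * of_real pi else 0))) {0..2*pi}" for N
    unfolding f_def by (intro has_integral_sum has_integral_mult_right has_integral_cis_int) auto
  then have I: "I N = (\<Sum>n<N. c n * (if int n - m = 0 then 2 * of_real pi else 0))" for N
    using has_integral_unique IJ(1) by blast
  have "I N = ?J" if "N > nat m" for N
  proof (cases "m < 0")
    case True
    then show ?thesis unfolding I by (intro trans[OF sum.neutral]) auto
  next
    case False
    have "I N = (\<Sum>n<N. if n = nat m then 2 * of_real pi * c (nat m) else 0)"
      unfolding I by (rule sum.cong) (use False in auto)
    then show ?thesis using False that by simp
  qed
  then have "eventually (\<lambda>N. I N = ?J) sequentially"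
    using eventually_gt_at_top[of "nat m"] by (rule eventually_mono[rotated])
  then have "I \<longlonglongrightarrow> ?J" by (rule tendsto_eventually)
  then have "J = ?J" using IJ(3) LIMSEQ_unique by blast
  then show ?thesis using IJ(2) by simp
qed

text \<open>Comes from \<open>Re g = (g + cnj g) / 2\<close>. Both conditionals contribute at
  \<open>m = 0\<close>, where the result is the real part of \<open>c 0\<close>.\<close>

lemma fcoef_Re:
  "fcoef (\<lambda>y. Re (g (cis y))) m =
     ((if m < 0 then 0 else c (nat m)) + (if m > 0 then 0 else cnj (c (nat (- m))))) / 2"
proof -
  let ?C = "\<lambda>m. if m < 0 then 0 else 2 * of_real pi * c (nat m)"
  have 1: "((\<lambda>y. g (cis y) * cis (- (real_of_int m * y))) has_integral ?C m) {0..2*pi}"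
    by (rule has_integral_Fourier)
  have "((\<lambda>y. cnj (g (cis y) * cis (- (real_of_int (- m) * y)))) has_integral cnj (?C (- m))) {0..2*pi}"
    using has_integral_linear[OF has_integral_Fourier[of "- m"] bounded_linear_cnj] by (simp add: o_def)
  then have 2: "((\<lambda>y. cnj (g (cis y)) * cis (- (real_of_int m * y))) has_integral cnj (?C (- m))) {0..2*pi}"
    by (simp add: cis_cnj)
  have "((\<lambda>y. (g (cis y) * cis (- (real_of_int m * y)) + cnj (g (cis y)) * cis (- (real_of_int m * y))) / 2)
      has_integral (?C m + cnj (?C (- m))) / 2) {0..2*pi}"
    by (intro has_integral_divide has_integral_add 1 2)
  moreover have "(g (cis y) * cis (- (real_of_int m * y)) + cnj (g (cis y)) * cis (- (real_of_int m * y))) / 2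
     = complex_of_real (Re (g (cis y))) * cis (- (real_of_int m * y))" for y
    by (simp add: complex_add_cnj distrib_right[symmetric])
  ultimately have "((\<lambda>y. complex_of_real (Re (g (cis y))) * cis (- (real_of_int m * y)))
      has_integral (?C m + cnj (?C (- m))) / 2) {0..2*pi}" by simp
  from integral_unique[OF this] show ?thesis
    unfolding fcoef_def by (simp add: field_simps)
qed

text \<open>The paired modes of frequency n and -n add up to the imaginary part of the Taylor term
  of order n. The series for \<open>hilbert\<close> starts at order 1, so the constant term of
  \<open>g\<close> has to vanish.\<close>

lemma hilbert_Re:
  assumes g0: "g 0 = 0"
  shows "hilbert (\<lambda>y. Re (g (cis y))) x = Im (g (cis x))"
proof -
  define w where "w = (\<lambda>n. c n * cis x ^ n)"
  have "w sums g (cis x)" unfolding w_def by (rule Taylor_sums) (use r in simp)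
  moreover have "w 0 = 0" using g0 by (simp add: w_def c_def)
  ultimately have w: "(\<lambda>n. w (Suc n)) sums g (cis x)"
    by (simp add: sums_Suc_iff)
  have t: "(- \<i>) * fcoef (\<lambda>y. Re (g (cis y))) (int (Suc n)) * cis (real (Suc n) * x)
      + \<i> * fcoef (\<lambda>y. Re (g (cis y))) (- int (Suc n)) * cis (- (real (Suc n) * x))
      = of_real (Im (w (Suc n)))" for n
  proof -
    have 1: "w (Suc n) = c (Suc n) * cis (real (Suc n) * x)"
      by (simp only: w_def Complex.DeMoivre)
    have 2: "cnj (w (Suc n)) = cnj (c (Suc n)) * cis (- (real (Suc n) * x))"
      by (simp only: 1 complex_cnj_mult cis_cnj)
    have f1: "fcoef (\<lambda>y. Re (g (cis y))) (int (Suc n)) = c (Suc n) / 2"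
      unfolding fcoef_Re by (simp del: of_nat_Suc)
    have f2: "fcoef (\<lambda>y. Re (g (cis y))) (- int (Suc n)) = cnj (c (Suc n)) / 2"
      unfolding fcoef_Re by (simp del: of_nat_Suc)
    have "(- \<i>) * (c (Suc n) / 2) * cis (real (Suc n) * x) + \<i> * (cnj (c (Suc n)) / 2) * cis (- (real (Suc n) * x))
      = - \<i> / 2 * (w (Suc n) - cnj (w (Suc n)))"
      unfolding 1 2[unfolded 1] by (simp add: algebra_simps)
    also have "\<dots> = of_real (Im (w (Suc n)))"
      unfolding complex_diff_cnj by (simp add: complex_eq_iff)
    finally show ?thesis unfolding f1 f2 .
  qed
  have "(\<lambda>n. of_real (Im (w (Suc n))) :: complex) sums of_real (Im (g (cis x)))"
    using sums_of_real[OF sums_Im[OF w]] .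
  then show ?thesis unfolding hilbert_def t by (simp add: sums_iff)
qed

end

section \<open>Logarithmic derivatives and exponential sums\<close>

text \<open>The quotient is the logarithmic x-derivative of \<open>1 - b * cis x\<close>. Since
  \<theta> is minus the argument of \<open>b\<close>, the angle \<open>x - \<theta>\<close> in
  \<open>ubeta\<close> is the argument of \<open>b * cis x\<close>.\<close>

lemma ubeta_eq:
  assumes "cmod b < 1"
  shows "ubeta b x = - 4 * Im (- \<i> * b * cis x / (1 - b * cis x))"
proof -
  define r where "r = cmod b"
  define \<phi> where "\<phi> = x + Arg b"
  have w: "b * cis x = of_real r * cis \<phi>"
    unfolding r_def \<phi>_def using rcis_cmod_Arg[of b]
    by (metis add.commute cis_mult mult.assoc rcis_def)
  have "\<bar>r * cos \<phi>\<bar> < 1"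
    using assms abs_cos_le_one[of \<phi>] mult_left_mono[of "\<bar>cos \<phi>\<bar>" 1 r]
    by (simp add: abs_mult r_def)
  then have d: "(1 - r * cos \<phi>)\<^sup>2 + (r * sin \<phi>)\<^sup>2 \<noteq> 0"
    using zero_le_power2[of "r * sin \<phi>"] zero_less_power2[of "1 - r * cos \<phi>"] by linarith
  have rs: "(r * cos \<phi>)\<^sup>2 + (r * sin \<phi>)\<^sup>2 = r\<^sup>2"
    by (simp add: power_mult_distrib flip: distrib_left)
  have d': "(1 - r * cos \<phi>)\<^sup>2 + (r * sin \<phi>)\<^sup>2 = 1 + r\<^sup>2 - 2 * r * cos \<phi>"
    using rs by (simp add: power2_eq_square algebra_simps)
  have "- 4 * Im (- \<i> * b * cis x / (1 - b * cis x)) = 4 * Re ((b * cis x) / (1 - b * cis x))"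
  proof -
    have "- \<i> * b * cis x / (1 - b * cis x) = - \<i> * (b * cis x / (1 - b * cis x))" by simp
    moreover have "Im (- \<i> * z) = - Re z" for z by simp
    ultimately show ?thesis by (simp only:)
  qed
  also have "\<dots> = 4 * ((r * cos \<phi>) * (1 - r * cos \<phi>) - (r * sin \<phi>)\<^sup>2) / ((1 - r * cos \<phi>)\<^sup>2 + (r * sin \<phi>)\<^sup>2)"
    unfolding w by (simp add: Re_divide power2_eq_square)
  also have "(r * cos \<phi>) * (1 - r * cos \<phi>) - (r * sin \<phi>)\<^sup>2 = r * (cos \<phi> - r)"
    using rs by (simp add: power2_eq_square algebra_simps)
  finally show ?thesis unfolding d' by (simp add: ubeta_def Let_def r_def \<phi>_def algebra_simps)
qed

text \<open>The logarithmic derivative in x of the product of the \<open>1 - b * \<zeta>\<close>,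
  written in the variable \<open>\<zeta> = cis x\<close>; in this variable it extends
  holomorphically across the unit circle when all roots lie in the open disk.\<close>

definition prod_logderiv :: "complex list \<Rightarrow> complex \<Rightarrow> complex" where
  "prod_logderiv bs \<zeta> = (\<Sum>b\<leftarrow>bs. - \<i> * b * \<zeta> / (1 - b * \<zeta>))"

lemma sum_ubeta:
  assumes "\<forall>b\<in>set bs. cmod b < 1"
  shows "(\<Sum>b\<leftarrow>bs. ubeta b x) = - 4 * Im (prod_logderiv bs (cis x))"
  using assms by (induction bs) (auto simp: prod_logderiv_def ubeta_eq algebra_simps)

lemma DERIV_prod_list_exp:
  assumes "\<forall>b\<in>set bs. 1 - b * exp (\<i> * x) \<noteq> 0"
  shows "((\<lambda>x. \<Prod>b\<leftarrow>bs. 1 - b * exp (\<i> * x)) has_field_derivative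
     (\<Prod>b\<leftarrow>bs. 1 - b * exp (\<i> * x)) * prod_logderiv bs (exp (\<i> * x))) (at x)"
  using assms
proof (induction bs)
  case (Cons b bs)
  have "((\<lambda>x. 1 - b * exp (\<i> * x)) has_field_derivative - \<i> * b * exp (\<i> * x)) (at x)"
    by (auto intro!: derivative_eq_intros)
  then have "((\<lambda>x. (1 - b * exp (\<i> * x)) * (\<Prod>b\<leftarrow>bs. 1 - b * exp (\<i> * x))) has_field_derivative
    (- \<i> * b * exp (\<i> * x)) * (\<Prod>b\<leftarrow>bs. 1 - b * exp (\<i> * x)) +
    (\<Prod>b\<leftarrow>bs. 1 - b * exp (\<i> * x)) * prod_logderiv bs (exp (\<i> * x)) * (1 - b * exp (\<i> * x))) (at x)"
    by (rule DERIV_mult[OF _ Cons.IH]) (use Cons.prems in auto)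
  moreover have "(- \<i> * b * exp (\<i> * x)) * (\<Prod>b\<leftarrow>bs. 1 - b * exp (\<i> * x)) +
    (\<Prod>b\<leftarrow>bs. 1 - b * exp (\<i> * x)) * prod_logderiv bs (exp (\<i> * x)) * (1 - b * exp (\<i> * x)) =
    (\<Prod>b\<leftarrow>b # bs. 1 - b * exp (\<i> * x)) * prod_logderiv (b # bs) (exp (\<i> * x))"
    using Cons.prems by (simp add: prod_logderiv_def field_simps)
  ultimately show ?case by simp
qed (auto simp: prod_logderiv_def)

lemma one_minus_mult_nonzero: "cmod b < 1 \<Longrightarrow> cmod \<zeta> \<le> 1 \<Longrightarrow> 1 - b * \<zeta> \<noteq> 0"
proof
  assume *: "cmod b < 1" "cmod \<zeta> \<le> 1" "1 - b * \<zeta> = 0"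
  then have "cmod (b * \<zeta>) = 1" by simp
  moreover have "cmod (b * \<zeta>) \<le> cmod b * 1"
    unfolding norm_mult by (rule mult_left_mono) (use * in auto)
  ultimately show False using * by simp
qed

text \<open>The poles 1/b are finitely many and lie outside the closed unit disk. A radius strictly
  above 1 is what \<open>hilbert_Re\<close> asks for.\<close>

lemma unit_disk_radius:
  assumes "\<forall>b\<in>set bs. cmod b < 1"
  shows "\<exists>r>1. \<forall>b\<in>set bs. \<forall>\<zeta>\<in>ball 0 r. 1 - b * \<zeta> \<noteq> 0"
  using assms
proof (induction bs)
  case Nil
  show ?case by (intro exI[of _ 2]) auto
next
  case (Cons b bs)
  then obtain r where r: "r > 1" "\<forall>b\<in>set bs. \<forall>\<zeta>\<in>ball 0 r. 1 - b * \<zeta> \<noteq> 0" by auto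
  define r' where "r' = (if b = 0 then r else min r (1 / cmod b))"
  have "1 - b * \<zeta> \<noteq> 0" if "\<zeta> \<in> ball 0 r'" for \<zeta>
  proof
    assume "1 - b * \<zeta> = 0"
    then have *: "b * \<zeta> = 1" by simp
    then have "b \<noteq> 0" by auto
    then have "cmod \<zeta> < 1 / cmod b" using that by (auto simp: r'_def)
    then have "cmod b * cmod \<zeta> < 1" using \<open>b \<noteq> 0\<close> by (simp add: field_simps)
    then show False using * by (metis less_irrefl norm_mult norm_one)
  qed
  moreover have "r' > 1" using r Cons.prems by (auto simp: r'_def)
  ultimately show ?case using r by (intro exI[of _ r']) (auto simp: r'_def split: if_splits)
qed

lemma prod_logderiv_holomorphic:
  assumes "\<forall>b\<in>set bs. \<forall>\<zeta>\<in>A. 1 - b * \<zeta> \<noteq> 0"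
  shows "prod_logderiv bs holomorphic_on A"
  using assms
proof (induction bs)
  case (Cons b bs)
  have "(\<lambda>\<zeta>. - \<i> * b * \<zeta> / (1 - b * \<zeta>) + prod_logderiv bs \<zeta>) holomorphic_on A"
    by (intro holomorphic_intros Cons.IH) (use Cons.prems in auto)
  then show ?case by (simp add: prod_logderiv_def)
qed (simp add: prod_logderiv_def[abs_def])

text \<open>The indices \<open>i\<close> and \<open>j\<close> count derivatives in x and in t, so
  one family contains all derivatives of E. The arguments are complex in order to use complex
  differentiation, although only real x and t matter.\<close>

definition expsum :: "'i set \<Rightarrow> ('i \<Rightarrow> complex) \<Rightarrow> ('i \<Rightarrow> real) \<Rightarrow> ('i \<Rightarrow> real) \<Rightarrow> nat \<Rightarrow> nat \<Rightarrow> complex \<Rightarrow> complex \<Rightarrow> complex" where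
  "expsum \<A> c \<kappa> \<omega> i j x t =
     (\<Sum>A\<in>\<A>. c A * (\<i> * of_real (\<kappa> A)) ^ i * (- \<i> * of_real (\<omega> A)) ^ j *
        exp (\<i> * (of_real (\<kappa> A) * x - of_real (\<omega> A) * t)))"

lemma expsum_deriv_x:
  "((\<lambda>x. expsum \<A> c \<kappa> \<omega> i j x t) has_field_derivative expsum \<A> c \<kappa> \<omega> (Suc i) j x t) (at x)"
  unfolding expsum_def
  by (rule DERIV_sum) (auto intro!: derivative_eq_intros simp: algebra_simps)

lemma expsum_deriv_t:
  "((\<lambda>t. expsum \<A> c \<kappa> \<omega> i j x t) has_field_derivative expsum \<A> c \<kappa> \<omega> i (Suc j) x t) (at t)"
  unfolding expsum_def
  by (rule DERIV_sum) (auto intro!: derivative_eq_intros simp: algebra_simps)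

lemma has_real_derivative_Im:
  assumes "(f has_field_derivative f') (at (complex_of_real x))"
  shows "((\<lambda>x. Im (f (of_real x))) has_real_derivative Im f') (at x)"
  using bounded_linear.has_vector_derivative[OF bounded_linear_Im has_vector_derivative_real_field[OF assms]]
  by (simp add: has_real_derivative_iff_has_vector_derivative)

lemma has_real_derivative_Re:
  assumes "(f has_field_derivative f') (at (complex_of_real x))"
  shows "((\<lambda>x. Re (f (of_real x))) has_real_derivative Re f') (at x)"
  using bounded_linear.has_vector_derivative[OF bounded_linear_Re has_vector_derivative_real_field[OF assms]]
  by (simp add: has_real_derivative_iff_has_vector_derivative)

section \<open>From the bilinear equation to the Benjamin-Ono equation\<close>

text \<open>\<open>K\<close> plays the role of an integration constant and disappears on
  differentiating in x. The product form serves twice: it keeps E away from zero on the real axis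
  and it provides the holomorphic extension for the Hilbert transform.\<close>

lemma bo_solution_of_bilinear:
  fixes c :: "'i \<Rightarrow> complex" and a K :: real
  assumes prod_form: "\<And>t::real. \<exists>bs. (\<forall>b\<in>set bs. cmod b < 1) \<and>
      (\<forall>x. expsum \<A> c \<kappa> \<omega> 0 0 x (of_real t) = (\<Prod>b\<leftarrow>bs. 1 - b * exp (\<i> * x)))"
    and bil: "\<And>(x::real) (t::real). let e = (\<lambda>i j. expsum \<A> c \<kappa> \<omega> i j (of_real x) (of_real t)) in
      \<i> * (e 0 1 * cnj (e 0 0) - e 0 0 * cnj (e 0 1))
      - (e 2 0 * cnj (e 0 0) - 2 * e 1 0 * cnj (e 1 0) + e 0 0 * cnj (e 2 0))
      + \<i> * of_real a * (e 1 0 * cnj (e 0 0) - e 0 0 * cnj (e 1 0)) = of_real K * e 0 0 * cnj (e 0 0)"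
  shows "bo_solution (\<lambda>x t. a - 4 * Im (expsum \<A> c \<kappa> \<omega> 1 0 (of_real x) (of_real t) /
      expsum \<A> c \<kappa> \<omega> 0 0 (of_real x) (of_real t)))"
proof -
  define E where "E = expsum \<A> c \<kappa> \<omega>"
  note dx = expsum_deriv_x[of \<A> c \<kappa> \<omega>, folded E_def]
  note dt = expsum_deriv_t[of \<A> c \<kappa> \<omega>, folded E_def]
  define Y where "Y = (\<lambda>x t. E 1 0 x t / E 0 0 x t)"
  define Y1 where "Y1 = (\<lambda>x t. E 2 0 x t / E 0 0 x t - (E 1 0 x t / E 0 0 x t)\<^sup>2)"
  define Y2 where "Y2 = (\<lambda>x t. E 3 0 x t / E 0 0 x t - 3 * E 2 0 x t * E 1 0 x t / (E 0 0 x t)\<^sup>2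
      + 2 * (E 1 0 x t / E 0 0 x t) ^ 3)"
  define Yt where "Yt = (\<lambda>x t. E 1 1 x t / E 0 0 x t - E 1 0 x t * E 0 1 x t / (E 0 0 x t)\<^sup>2)"
  define R where "R = (\<lambda>x t. E 0 1 x t / E 0 0 x t)"
  have nz: "E 0 0 (of_real x) (of_real t) \<noteq> 0" for x t :: real
  proof -
    obtain bs where bs: "\<forall>b\<in>set bs. cmod b < 1" "\<And>x. E 0 0 x (of_real t) = (\<Prod>b\<leftarrow>bs. 1 - b * exp (\<i> * x))"
      using prod_form[of t] unfolding E_def by blast
    have "1 - b * exp (\<i> * of_real x) \<noteq> 0" if "b \<in> set bs" for b
      using one_minus_mult_nonzero[of b "cis x"] bs(1) that by (simp add: cis_conv_exp)
    then show ?thesis by (auto simp: bs(2) prod_list_zero_iff)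
  qed
  have dY: "((\<lambda>x. Y x (of_real t)) has_field_derivative Y1 (of_real x) (of_real t)) (at (of_real x))" for x t :: real
    unfolding Y_def Y1_def
    by (rule derivative_eq_intros dx nz refl)+
       (use nz[of x t] in \<open>simp add: field_simps power2_eq_square numeral_2_eq_2\<close>)
  have dY1: "((\<lambda>x. Y1 x (of_real t)) has_field_derivative Y2 (of_real x) (of_real t)) (at (of_real x))" for x t :: real
    unfolding Y1_def Y2_def
    by (rule derivative_eq_intros dx nz refl)+
       (use nz[of x t] in \<open>simp add: field_simps power2_eq_square power3_eq_cube eval_nat_numeral\<close>)
  have dYt: "((\<lambda>t. Y (of_real x) t) has_field_derivative Yt (of_real x) (of_real t)) (at (of_real t))" for x t :: real
    unfolding Y_def Yt_def
    by (rule derivative_eq_intros dt nz refl)+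
       (use nz[of x t] in \<open>simp add: field_simps power2_eq_square\<close>)
  \<comment> \<open>\<open>R\<close> and \<open>Y\<close> are the t- and x-derivatives of log E, so
    that \<open>Yt\<close> is at once the x-derivative of \<open>R\<close> and the t-derivative of
    \<open>Y\<close>.\<close>
  have dR: "((\<lambda>x. R x (of_real t)) has_field_derivative Yt (of_real x) (of_real t)) (at (of_real x))" for x t :: real
    unfolding R_def Yt_def
    by (rule derivative_eq_intros dx nz refl)+
       (use nz[of x t] in \<open>simp add: field_simps power2_eq_square\<close>)
  define u where "u = (\<lambda>x t. a - 4 * Im (Y (complex_of_real x) (complex_of_real t)))"
  have ut: "((\<lambda>t. u x t) has_real_derivative - 4 * Im (Yt (of_real x) (of_real t))) (at t)" for x t
    unfolding u_def by (rule derivative_eq_intros has_real_derivative_Im[OF dYt] refl)+ simp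
  have ux: "((\<lambda>x. u x t) has_real_derivative - 4 * Im (Y1 (of_real x) (of_real t))) (at x)" for x t
    unfolding u_def by (rule derivative_eq_intros has_real_derivative_Im[OF dY] refl)+ simp
  have uxx: "((\<lambda>x. - 4 * Im (Y1 (of_real x) (of_real t))) has_real_derivative - 4 * Im (Y2 (of_real x) (of_real t))) (at x)" for x t
    by (rule derivative_eq_intros has_real_derivative_Im[OF dY1] refl)+ simp
  have dux: "deriv (\<lambda>x. u x t) = (\<lambda>x. - 4 * Im (Y1 (of_real x) (of_real t)))" for t
    by (rule ext, rule DERIV_imp_deriv, rule ux)
  have duxx: "deriv (deriv (\<lambda>x. u x t)) = (\<lambda>x. - 4 * Im (Y2 (of_real x) (of_real t)))" for t
    unfolding dux by (rule ext, rule DERIV_imp_deriv, rule uxx)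
  have hil_per: "hilbert (\<lambda>x. - 4 * Im (Y2 (of_real x) (of_real t))) x = 4 * Re (Y2 (of_real x) (of_real t))
      \<and> u (x + 2*pi) t = u x t" for x t
  proof -
    obtain bs where bs: "\<forall>b\<in>set bs. cmod b < 1" "\<And>x. E 0 0 x (of_real t) = (\<Prod>b\<leftarrow>bs. 1 - b * exp (\<i> * x))"
      using prod_form[of t] unfolding E_def by blast
    obtain r where r: "r > 1" "\<forall>b\<in>set bs. \<forall>\<zeta>\<in>ball 0 r. 1 - b * \<zeta> \<noteq> 0"
      using unit_disk_radius[OF bs(1)] by blast
    define h where "h = prod_logderiv bs"
    have h: "h holomorphic_on ball 0 r" unfolding h_def by (rule prod_logderiv_holomorphic) (use r in auto)
    have h': "deriv h holomorphic_on ball 0 r" "deriv (deriv h) holomorphic_on ball 0 r"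
      by (intro holomorphic_deriv h open_ball)+
    have inb: "exp (\<i> * complex_of_real x) \<in> ball 0 r" for x using r by simp
    have dh: "(h has_field_derivative deriv h (exp (\<i> * of_real x))) (at (exp (\<i> * of_real x)))"
      "(deriv h has_field_derivative deriv (deriv h) (exp (\<i> * of_real x))) (at (exp (\<i> * of_real x)))" for x :: real
      by (rule holomorphic_derivI[OF _ open_ball inb], rule h h')+
    have Yh: "Y (of_real x) (of_real t) = h (cis x)" for x
    proof -
      have "((\<lambda>x. E 0 0 x (of_real t)) has_field_derivative
         E 0 0 (of_real x) (of_real t) * prod_logderiv bs (exp (\<i> * of_real x))) (at (of_real x))"
        unfolding bs(2) using r inb by (intro DERIV_prod_list_exp) auto
      from DERIV_unique[OF this dx] show ?thesis
        using nz[of x t] by (simp add: Y_def h_def cis_conv_exp field_simps)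
    qed
    have Y1h: "Y1 (of_real x) (of_real t) = \<i> * cis x * deriv h (cis x)" for x
    proof -
      have "((\<lambda>z. h (exp (\<i> * z))) has_field_derivative deriv h (exp (\<i> * of_real x)) * (\<i> * exp (\<i> * of_real x))) (at (of_real x))"
        by (rule DERIV_chain2[where g = "\<lambda>z. exp (\<i> * z)" and x = "of_real x", OF dh(1)]) (auto intro!: derivative_eq_intros)
      from has_vector_derivative_real_field[OF this]
      have 1: "((\<lambda>x. h (cis x)) has_vector_derivative \<i> * cis x * deriv h (cis x)) (at x)"
        by (simp add: cis_conv_exp mult_ac)
      have 2: "((\<lambda>x. Y (of_real x) (of_real t)) has_vector_derivative Y1 (of_real x) (of_real t)) (at x)"
        by (rule has_vector_derivative_real_field[OF dY])
      show ?thesis by (rule vector_derivative_unique_at[OF 2[unfolded Yh] 1])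
    qed
    \<comment> \<open>Each x-derivative acts as i \<zeta> d/d\<zeta>; \<open>g\<close> is the result
      of applying this operator twice to \<open>h\<close>, and it vanishes at 0.\<close>
    define g where "g = (\<lambda>\<zeta>. - (\<zeta> * deriv h \<zeta> + \<zeta>\<^sup>2 * deriv (deriv h) \<zeta>))"
    have Y2h: "Y2 (of_real x) (of_real t) = g (cis x)" for x
    proof -
      have A: "((\<lambda>z. \<i> * exp (\<i> * z)) has_field_derivative \<i> * (\<i> * exp (\<i> * of_real x))) (at (of_real x))"
        by (auto intro!: derivative_eq_intros simp: mult_ac)
      have B: "((\<lambda>z. deriv h (exp (\<i> * z))) has_field_derivative
          deriv (deriv h) (exp (\<i> * of_real x)) * (\<i> * exp (\<i> * of_real x))) (at (of_real x))"
        by (rule DERIV_chain2[where g = "\<lambda>z. exp (\<i> * z)" and x = "of_real x", OF dh(2)])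
           (auto intro!: derivative_eq_intros)
      have "((\<lambda>z. \<i> * exp (\<i> * z) * deriv h (exp (\<i> * z))) has_field_derivative
          \<i> * exp (\<i> * of_real x) * (deriv (deriv h) (exp (\<i> * of_real x)) * (\<i> * exp (\<i> * of_real x)))
          + \<i> * (\<i> * exp (\<i> * of_real x)) * deriv h (exp (\<i> * of_real x))) (at (of_real x))"
        by (rule DERIV_mult'[OF A B])
      from has_vector_derivative_real_field[OF this]
      have 1: "((\<lambda>x. \<i> * cis x * deriv h (cis x)) has_vector_derivative g (cis x)) (at x)"
        by (simp add: cis_conv_exp g_def power2_eq_square algebra_simps)
      have 2: "((\<lambda>x. Y1 (of_real x) (of_real t)) has_vector_derivative Y2 (of_real x) (of_real t)) (at x)"
        by (rule has_vector_derivative_real_field[OF dY1])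
      show ?thesis by (rule vector_derivative_unique_at[OF 2[unfolded Y1h] 1])
    qed
    \<comment> \<open>The factor \<open>4 * \<i>\<close> is chosen so that the real part is
      \<open>- 4 * Im (g (cis y))\<close>, which is the second x-derivative of
      \<open>u\<close>.\<close>
    have "hilbert (\<lambda>y. Re (4 * \<i> * g (cis y))) x = Im (4 * \<i> * g (cis x))"
      by (rule hilbert_Re[of "\<lambda>\<zeta>. 4 * \<i> * g \<zeta>" r]) (auto simp: g_def intro!: holomorphic_intros h' r)
    moreover have "cis (x + 2 * pi) = cis x" by (simp add: complex_eq_iff)
    ultimately show ?thesis unfolding Y2h u_def Yh by simp
  qed
  have key: "- Im (Yt (of_real x) (of_real t)) - Re (Y2 (of_real x) (of_real t))
     + 4 * Im (Y (of_real x) (of_real t)) * Im (Y1 (of_real x) (of_real t))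
     - a * Im (Y1 (of_real x) (of_real t)) = 0" for x t :: real
  proof -
    \<comment> \<open>an \<open>x\<close>-antiderivative of the equation; it is constant because it is the bilinear equation
      divided by \<open>|E|\<^sup>2\<close>\<close>
    define L where "L = (\<lambda>x::real. - Im (R (of_real x) (of_real t)) - Re (Y1 (of_real x) (of_real t))
       + 2 * (Im (Y (of_real x) (of_real t)))\<^sup>2 - a * Im (Y (of_real x) (of_real t)))"
    have const: "L x = K / 2" for x
    proof -
      define e where "e = (\<lambda>i j. E i j (of_real x) (of_real t))"
      have e0: "e 0 0 \<noteq> 0" using nz by (simp add: e_def)
      define y where "y = e 1 0 / e 0 0"
      define \<rho> where "\<rho> = e 0 1 / e 0 0"
      define y2 where "y2 = e 2 0 / e 0 0"
      have e': "e 1 0 = y * e 0 0" "e 0 1 = \<rho> * e 0 0" "e 2 0 = y2 * e 0 0"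
        using e0 by (simp_all add: y_def \<rho>_def y2_def)
      have "(\<i> * (\<rho> - cnj \<rho>) - (y2 - 2 * y * cnj y + cnj y2) + \<i> * of_real a * (y - cnj y)) * (e 0 0 * cnj (e 0 0))
          = of_real K * (e 0 0 * cnj (e 0 0))"
        using bil[of x t, folded E_def] unfolding Let_def e_def[symmetric] fun_cong[OF fun_cong[OF e_def], symmetric] e'
        by (simp add: algebra_simps)
      then have "\<i> * (\<rho> - cnj \<rho>) - (y2 - 2 * y * cnj y + cnj y2) + \<i> * of_real a * (y - cnj y) = of_real K"
        using e0 by simp
      then have "- 2 * Im \<rho> - 2 * Re y2 + 2 * ((Re y)\<^sup>2 + (Im y)\<^sup>2) - 2 * a * Im y = K"
        by (simp add: complex_eq_iff power2_eq_square)
      \<comment> \<open>In the form \<open>|y|^2 = Re (y^2) + 2 * (Im y)^2\<close> this trades the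
        mixed term of the bilinear equation for the second logarithmic derivative and the square of
        \<open>Im y\<close> in \<open>L\<close>.\<close>
      moreover have "Re (y2 - y\<^sup>2) = Re y2 - ((Re y)\<^sup>2 - (Im y)\<^sup>2)" by (simp add: power2_eq_square)
      ultimately show ?thesis
        unfolding L_def R_def Y1_def Y_def fun_cong[OF fun_cong[OF e_def], symmetric] y_def[symmetric] \<rho>_def[symmetric] y2_def[symmetric]
        by (simp add: field_simps)
    qed
    have "(L has_real_derivative - Im (Yt (of_real x) (of_real t)) - Re (Y2 (of_real x) (of_real t))
     + 2 * (2 * Im (Y (of_real x) (of_real t)) * Im (Y1 (of_real x) (of_real t)))
     - a * Im (Y1 (of_real x) (of_real t))) (at x)"
      unfolding L_def
      by (rule derivative_eq_intros has_real_derivative_Im[OF dR] has_real_derivative_Re[OF dY1]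
          has_real_derivative_Im[OF dY] refl)+ simp
    moreover have "(L has_real_derivative 0) (at x)"
    proof -
      have "L = (\<lambda>_. K / 2)" by (simp add: fun_eq_iff const)
      then show ?thesis by simp
    qed
    ultimately show ?thesis using DERIV_unique by fastforce
  qed
  have "bo_solution u"
    unfolding bo_solution_def dux
  proof (intro conjI allI)
    fix x t
    show "u (x + 2*pi) t = u x t" using hil_per by blast
    show "(\<lambda>\<tau>. u x \<tau>) differentiable (at t)" "(\<lambda>y. u y t) differentiable (at x)"
      "(\<lambda>x. - 4 * Im (Y1 (of_real x) (of_real t))) differentiable (at x)"
      using ut ux uxx real_differentiable_def by blast+
    have "deriv (\<lambda>\<tau>. u x \<tau>) t = - 4 * Im (Yt (of_real x) (of_real t))"
      by (rule DERIV_imp_deriv[OF ut])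
    moreover have "hilbert (\<lambda>y. deriv (\<lambda>x. - 4 * Im (Y1 (of_real x) (of_real t))) y) x = 4 * Re (Y2 (of_real x) (of_real t))"
      using hil_per duxx[of t] dux[of t] by simp
    ultimately show "deriv (\<lambda>\<tau>. u x \<tau>) t = hilbert (\<lambda>y. deriv (\<lambda>x. - 4 * Im (Y1 (of_real x) (of_real t))) y) x
        - u x t * (- 4 * Im (Y1 (of_real x) (of_real t)))"
      using key[of x t] by (simp add: u_def algebra_simps)
  qed
  then show ?thesis by (simp add: u_def[abs_def] Y_def E_def)
qed

section \<open>Solutions from phase data\<close>

lemma qq_Suc: "j \<ge> 1 \<Longrightarrow> qq k s (Suc j) = pp k s j + s (Suc j)"
  by (cases j) auto

lemma root_list_props:
  assumes "\<exists>bs. length bs = n \<and> (\<forall>z. f z = (\<Prod>b\<leftarrow>bs. z - b))"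
  shows "length (root_list f n) = n" "f z = (\<Prod>b\<leftarrow>root_list f n. z - b)"
  using someI_ex[OF assms] unfolding root_list_def by blast+

text \<open>A unique index \<open>T\<close> of top degree makes the polynomial monic of degree
  \<open>n\<close> whatever the other coefficients are, so the number of roots with multiplicity is
  \<open>n\<close> even when many of them vanish.\<close>

lemma monic_factorization:
  fixes C :: "'i \<Rightarrow> complex"
  assumes A: "finite A" "T \<in> A" "C T = 1" "d T = n" and lt: "\<And>S. S \<in> A \<Longrightarrow> S \<noteq> T \<Longrightarrow> d S < n"
    and f: "\<And>z. f z = (\<Sum>S\<in>A. C S * z ^ d S)"
  shows "\<exists>bs. length bs = n \<and> (\<forall>z. f z = (\<Prod>b\<leftarrow>bs. z - b))"
proof -
  define P where "P = (\<Sum>S\<in>A. monom (C S) (d S))"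
  have c: "coeff P m = (\<Sum>S\<in>A. if d S = m then C S else 0)" for m
    by (simp add: P_def coeff_sum)
  have "coeff P n = (\<Sum>S\<in>A. if S = T then C T else 0)"
    unfolding c by (rule sum.cong) (use A lt in fastforce)+
  then have cn: "coeff P n = 1" using A by simp
  have "coeff P m = 0" if "m > n" for m
    unfolding c by (rule sum.neutral) (use A(4) lt that in fastforce)
  then have "degree P \<le> n" by (simp add: degree_le)
  moreover have "n \<le> degree P" by (rule le_degree) (simp add: cn)
  ultimately have deg: "degree P = n" by simp
  have "P \<noteq> 0" using cn by auto
  from alg_closed_imp_factorization[OF this]
  obtain B where B: "size B = n" "P = (\<Prod>x\<in>#B. [:- x, 1:])" using deg cn by auto
  obtain bs where bs: "mset bs = B" using ex_mset by blast
  have "f z = (\<Prod>b\<leftarrow>bs. z - b)" for z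
  proof -
    have "f z = poly P z" by (simp add: f P_def poly_sum poly_monom)
    also have "P = (\<Prod>b\<leftarrow>bs. [:- b, 1:])"
      unfolding B(2) bs[symmetric] by (induction bs) auto
    also have "poly \<dots> z = (\<Prod>b\<leftarrow>bs. z - b)" by (induction bs) (auto simp: algebra_simps)
    finally show ?thesis .
  qed
  moreover have "length bs = n" using B(1) bs by auto
  ultimately show ?thesis by blast
qed

lemma prod_list_reversed:
  assumes "\<And>z. f z = (\<Prod>b\<leftarrow>bs. z - b)"
  shows "exp (\<i> * (of_nat (length bs) * x)) * f (exp (- (\<i> * x))) = (\<Prod>b\<leftarrow>bs. 1 - b * exp (\<i> * x))"
proof -
  have "(\<Prod>b\<leftarrow>bs. 1 - b * exp (\<i> * x)) = (exp (\<i> * x)) ^ length bs * (\<Prod>b\<leftarrow>bs. exp (- (\<i> * x)) - b)"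
    by (induction bs) (auto simp: algebra_simps exp_minus)
  then show ?thesis unfolding assms by (simp add: exp_of_nat_mult[symmetric] mult_ac)
qed

text \<open>\<open>E\<close> is the reversed polynomial in \<open>exp (\<i> * x)\<close>, so a root
  b becomes a factor \<open>1 - b * exp (\<i> * x)\<close>. The right-hand side of the first claim
  no longer mentions roots: the sum does not depend on the list picked by
  \<open>root_list\<close>.\<close>

lemma sum_ubeta_root_list:
  assumes ex: "\<exists>bs. length bs = n \<and> (\<forall>z. f z = (\<Prod>b\<leftarrow>bs. z - b))"
    and nz: "\<And>z. cmod z \<ge> 1 \<Longrightarrow> f z \<noteq> 0"
    and E: "\<And>x. E x = exp (\<i> * (of_nat n * x)) * f (exp (- (\<i> * x)))"
    and E': "(E has_field_derivative E') (at (of_real x))"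
  shows "(\<Sum>b\<leftarrow>root_list f n. ubeta b x) = - 4 * Im (E' / E (of_real x))"
    and "\<forall>b\<in>set (root_list f n). cmod b < 1"
    and "E y = (\<Prod>b\<leftarrow>root_list f n. 1 - b * exp (\<i> * y))"
proof -
  define bs where "bs = root_list f n"
  have bs: "length bs = n" "\<And>z. f z = (\<Prod>b\<leftarrow>bs. z - b)"
    unfolding bs_def using root_list_props[OF ex] by blast+
  have lt: "\<forall>b\<in>set bs. cmod b < 1"
  proof
    fix b assume "b \<in> set bs"
    then have "f b = 0" unfolding bs(2) by (auto simp: prod_list_zero_iff)
    then show "cmod b < 1" using nz[of b] by (cases "cmod b < 1") auto
  qed
  then show "\<forall>b\<in>set (root_list f n). cmod b < 1" by (simp add: bs_def)
  have Ep: "E y = (\<Prod>b\<leftarrow>bs. 1 - b * exp (\<i> * y))" for y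
    unfolding E using prod_list_reversed[of f bs y, OF bs(2)] bs(1) by simp
  then show "E y = (\<Prod>b\<leftarrow>root_list f n. 1 - b * exp (\<i> * y))" by (simp add: bs_def)
  have nz': "\<forall>b\<in>set bs. 1 - b * exp (\<i> * of_real x) \<noteq> 0"
    using lt one_minus_mult_nonzero by simp
  then have E0: "E (of_real x) \<noteq> 0" unfolding Ep by (auto simp: prod_list_zero_iff)
  have "(E has_field_derivative E (of_real x) * prod_logderiv bs (cis x)) (at (of_real x))"
    using DERIV_prod_list_exp[OF nz'] unfolding Ep[symmetric] by (simp add: cis_conv_exp)
  from DERIV_unique[OF this E'] have "E' / E (of_real x) = prod_logderiv bs (cis x)"
    using E0 by (simp add: field_simps)
  then show "(\<Sum>b\<leftarrow>root_list f n. ubeta b x) = - 4 * Im (E' / E (of_real x))"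
    using sum_ubeta[OF lt, of x] by (simp add: bs_def)
qed

text \<open>The last condition is \<open>\<omega> \<nu>\<^sub>j = p\<^sub>j\<^sup>2 - q\<^sub>j\<^sup>2 + c (p\<^sub>j - q\<^sub>j)\<close>. It encodes \<open>hier_params\<close> without
  reference to \<open>J\<close>.\<close>
definition phase_data :: "nat \<Rightarrow> (nat \<Rightarrow> nat) \<Rightarrow> (nat \<Rightarrow> int) \<Rightarrow> (nat \<Rightarrow> real) \<Rightarrow> real \<Rightarrow> real \<Rightarrow> bool" where
  "phase_data M k \<nu> s \<omega> c \<longleftrightarrow> M \<ge> 1 \<and> \<omega> > 0 \<and> (\<forall>j\<in>{1..M}. k j > 0) \<and> (\<forall>j\<in>{1..M}. s j \<ge> 0) \<and>
     (\<forall>j\<in>{1..M}. \<omega> * of_int (\<nu> j) = real (k j) * (pp k s j + qq k s j + c))"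

text \<open>The function \<open>E\<close> and its derivatives as exponential sums; the index \<open>A\<close> is the complement of
  the set \<open>S\<close> in \<open>bo_P\<close>, so that the exponents are \<open>k\<^sub>A\<close> and \<open>\<omega> \<nu>\<^sub>A\<close>.\<close>
definition hier_E :: "nat \<Rightarrow> (nat \<Rightarrow> nat) \<Rightarrow> (nat \<Rightarrow> int) \<Rightarrow> (nat \<Rightarrow> real) \<Rightarrow> (nat \<Rightarrow> real) \<Rightarrow> real
    \<Rightarrow> nat \<Rightarrow> nat \<Rightarrow> complex \<Rightarrow> complex \<Rightarrow> complex" where
  "hier_E M k \<nu> s x0 \<omega> = expsum (Pow {1..M})
     (\<lambda>A. mixed_prod (aa k s) ({1..M} - A) A * (\<Prod>m\<in>A. bb k s x0 m))
     (\<lambda>A. \<Sum>m\<in>A. real (k m)) (\<lambda>A. \<omega> * (\<Sum>m\<in>A. of_int (\<nu> m)))"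

lemma powi_sum:
  fixes z :: "'a::field"
  shows "z \<noteq> 0 \<Longrightarrow> z powi (\<Sum>i\<in>A. f i) = (\<Prod>i\<in>A. z powi f i)"
  by (induction A rule: infinite_finite_induct) (auto simp: power_int_add)

text \<open>The factor \<open>lam powi \<nu> m\<close> belongs to each site outside
  \<open>S\<close>; \<open>lam \<noteq> 0\<close> is needed to split the power over a sum of
  integers that may be negative.\<close>

lemma bo_P_LY:
  assumes "lam \<noteq> 0"
  shows "bo_P M k \<nu> s x0 z lam = LY {1..M} (aa k s) (\<lambda>m. bb k s x0 m * lam powi \<nu> m) (\<lambda>j. z ^ k j)"
  unfolding bo_P_def LY_def CS_def using assms
  by (intro sum.cong refl)
     (simp add: prod.cartesian_product prod.distrib powi_sum power_sum case_prod_unfold mult_ac)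

lemma hier_E_bo_P:
  "hier_E M k \<nu> s x0 \<omega> 0 0 x (of_real t) =
    exp (\<i> * (of_nat (bigN M k) * x)) * bo_P M k \<nu> s x0 (exp (- (\<i> * x))) (cis (- (\<omega> * t)))"
  unfolding bo_P_def hier_E_def expsum_def
proof (rule trans[OF _ sum_distrib_left[symmetric]], rule sum.reindex_bij_witness[of _ "\<lambda>S. {1..M} - S" "\<lambda>S. {1..M} - S"])
  fix A assume A: "A \<in> Pow {1..M}"
  then have cc: "{1..M} - ({1..M} - A) = A" by auto
  have CS: "CS M k s x0 ({1..M} - A) = mixed_prod (aa k s) ({1..M} - A) A * (\<Prod>m\<in>A. bb k s x0 m)"
    unfolding CS_def cc mixed_prod_def by (simp add: prod.cartesian_product)
  have "bigN M k = (\<Sum>m\<in>A. k m) + (\<Sum>j\<in>{1..M} - A. k j)"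
    unfolding bigN_def using sum.subset_diff[of A "{1..M}" k] A by auto
  then have N: "of_nat (bigN M k) = (of_nat (\<Sum>m\<in>A. k m) + of_nat (\<Sum>j\<in>{1..M} - A. k j) :: complex)"
    by simp
  have 1: "exp (\<i> * (of_nat (bigN M k) * x)) * exp (- (\<i> * x)) ^ (\<Sum>j\<in>{1..M} - A. k j)
      = exp (\<i> * (of_nat (\<Sum>m\<in>A. k m) * x))"
    unfolding N exp_of_nat_mult[symmetric] exp_add[symmetric] by (simp add: algebra_simps)
  have 2: "cis (- (\<omega> * t)) powi (\<Sum>m\<in>A. \<nu> m) = exp (- (\<i> * (of_real \<omega> * of_int (\<Sum>m\<in>A. \<nu> m) * of_real t)))"
    unfolding cis_power_int by (simp add: cis_conv_exp mult_ac)
  have "exp (\<i> * (of_real (\<Sum>m\<in>A. real (k m)) * x - of_real (\<omega> * (\<Sum>m\<in>A. of_int (\<nu> m))) * of_real t))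
     = exp (\<i> * (of_nat (\<Sum>m\<in>A. k m) * x)) * exp (- (\<i> * (of_real \<omega> * of_int (\<Sum>m\<in>A. \<nu> m) * of_real t)))"
    unfolding exp_add[symmetric] by (simp add: algebra_simps)
  then show "exp (\<i> * (of_nat (bigN M k) * x)) * (CS M k s x0 ({1..M} - A) *
      cis (- (\<omega> * t)) powi (\<Sum>m\<in>{1..M} - ({1..M} - A). \<nu> m) *
      exp (- (\<i> * x)) ^ (\<Sum>j\<in>{1..M} - A. k j)) =
     mixed_prod (aa k s) ({1..M} - A) A * (\<Prod>m\<in>A. bb k s x0 m) *
     (\<i> * of_real (\<Sum>m\<in>A. real (k m))) ^ 0 * (- \<i> * of_real (\<omega> * (\<Sum>m\<in>A. of_int (\<nu> m)))) ^ 0 *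
     exp (\<i> * (of_real (\<Sum>m\<in>A. real (k m)) * x - of_real (\<omega> * (\<Sum>m\<in>A. of_int (\<nu> m))) * of_real t))"
    unfolding CS cc 2 1[symmetric] by (simp add: mult_ac)
qed auto

lemma aa_commute: "aa k s j m = aa k s m j"
  unfolding aa_def by (intro arg_cong[of _ _ sqrt] arg_cong2[of _ _ _ _ "(/)"]) (simp_all only: algebra_simps)

section \<open>Ordering of the endpoints and location of the roots\<close>

context
  fixes M :: nat and k :: "nat \<Rightarrow> nat" and s :: "nat \<Rightarrow> real"
  assumes kpos: "\<And>j. j \<in> {1..M} \<Longrightarrow> k j > 0" and spos: "\<And>j. j \<in> {1..M} \<Longrightarrow> s j \<ge> 0"
begin

lemma pp_le_qq:
  assumes "1 \<le> j" "j < m" "m \<le> M"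
  shows "pp k s j \<le> qq k s m"
  using assms(2,3)
proof (induction m)
  case (Suc m)
  have m: "m \<ge> 1" "m \<in> {1..M}" "Suc m \<in> {1..M}" using Suc.prems assms(1) by auto
  show ?case
  proof (cases "j = m")
    case True
    then show ?thesis using qq_Suc[OF m(1), of k s] spos[OF m(3)] by simp
  next
    case False
    then have "pp k s j \<le> qq k s m" using Suc by auto
    then show ?thesis using qq_Suc[OF m(1), of k s] spos[OF m(3)] by simp
  qed
qed simp

lemma qq_less_pp: "j \<in> {1..M} \<Longrightarrow> qq k s j < pp k s j"
  using kpos[of j] by simp

lemma qq_nonneg: "j \<in> {1..M} \<Longrightarrow> 0 \<le> qq k s j"
proof (cases "j = 1")
  case False
  assume "j \<in> {1..M}"
  moreover have "pp k s 1 \<ge> 0" using spos[of 1] \<open>j \<in> {1..M}\<close> by simp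
  ultimately show ?thesis using pp_le_qq[of 1 j] False by fastforce
qed (use spos[of 1] in simp)

lemma pp_pos: "j \<in> {1..M} \<Longrightarrow> 0 < pp k s j"
  using qq_less_pp[of j] qq_nonneg[of j] by linarith

text \<open>The denominator exceeds the numerator by \<open>k j * k m > 0\<close>, which gives
  \<open>aa k s j m < 1\<close>. Both factors of the denominator are positive even if
  \<open>s m = 0\<close>, so the division is a genuine one.\<close>

lemma aa_less:
  assumes "1 \<le> j" "j < m" "m \<le> M"
  defines "p \<equiv> pp k s" and "q \<equiv> qq k s"
  shows "q j < q m" "p j < p m" "0 \<le> aa k s j m" "aa k s j m < 1"
    "(aa k s j m)\<^sup>2 * ((q m - q j) * (p m - p j)) = (p m - q j) * (q m - p j)"
proof -
  have *: "q j < p j" "p j \<le> q m" "q m < p m"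
    unfolding p_def q_def using qq_less_pp pp_le_qq assms by auto
  show q: "q j < q m" and p: "p j < p m" using * by auto
  have n: "(p m - q j) * (q m - p j) \<ge> 0" using * by auto
  have d: "(q m - q j) * (p m - p j) > 0" using * by auto
  have "(q m - q j) * (p m - p j) - (p m - q j) * (q m - p j) = (p m - q m) * (p j - q j)"
    by (simp add: algebra_simps)
  moreover have "(p m - q m) * (p j - q j) > 0" using * by auto
  ultimately have lt: "(p m - q j) * (q m - p j) < (q m - q j) * (p m - p j)" by linarith
  have aa: "aa k s j m = sqrt (((p m - q j) * (q m - p j)) / ((q m - q j) * (p m - p j)))"
    by (simp only: aa_def p_def q_def)
  have quot: "0 \<le> ((p m - q j) * (q m - p j)) / ((q m - q j) * (p m - p j))"
    using n d by (simp only: divide_nonneg_pos)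
  show "0 \<le> aa k s j m" unfolding aa using quot by (simp only: real_sqrt_ge_zero)
  show "aa k s j m < 1" unfolding aa using lt d by (simp only: real_sqrt_lt_1_iff divide_less_eq_1_pos)
  show "(aa k s j m)\<^sup>2 * ((q m - q j) * (p m - p j)) = (p m - q j) * (q m - p j)"
    unfolding aa real_sqrt_pow2[OF quot] using d by (simp only: nonzero_eq_divide_eq[symmetric] less_imp_neq not_sym times_divide_eq_left nonzero_mult_div_cancel_right)
qed

lemma aa_props:
  assumes "j \<in> {1..M}" "m \<in> {1..M}" "j \<noteq> m"
  defines "p \<equiv> pp k s" and "q \<equiv> qq k s"
  shows "0 \<le> aa k s j m" "aa k s j m < 1"
    "(aa k s j m)\<^sup>2 * ((q m - q j) * (p m - p j)) = (p m - q j) * (q m - p j)"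
proof -
  consider "j < m" | "m < j" using assms by linarith
  then have "0 \<le> aa k s j m \<and> aa k s j m < 1 \<and>
    (aa k s j m)\<^sup>2 * ((q m - q j) * (p m - p j)) = (p m - q j) * (q m - p j)"
  proof cases
    case 1
    then show ?thesis unfolding p_def q_def using aa_less[of j m] assms by auto
  next
    case 2
    have e: "(q m - q j) * (p m - p j) = (q j - q m) * (p j - p m)"
      "(p m - q j) * (q m - p j) = (p j - q m) * (q j - p m)" by (simp_all add: algebra_simps)
    show ?thesis unfolding e aa_commute[of k s j m] unfolding p_def q_def
      using aa_less[of m j] assms 2 by auto
  qed
  then show "0 \<le> aa k s j m" "aa k s j m < 1"
    "(aa k s j m)\<^sup>2 * ((q m - q j) * (p m - p j)) = (p m - q j) * (q m - p j)" by auto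
qed

lemma inj_pp: "inj_on (pp k s) {1..M}" and inj_qq: "inj_on (qq k s) {1..M}"
  by (rule linorder_inj_onI; use aa_less(1,2) in fastforce)+

lemma bb_props:
  assumes m: "m \<in> {1..M}"
  shows "cmod (bb k s x0 m) < 1" "(cmod (bb k s x0 m))\<^sup>2 * pp k s m = qq k s m"
proof -
  have b: "cmod (bb k s x0 m) = sqrt (qq k s m / pp k s m)"
    using qq_nonneg[OF m] pp_pos[OF m] by (simp add: bb_def norm_mult)
  show "cmod (bb k s x0 m) < 1"
    unfolding b using qq_less_pp[OF m] pp_pos[OF m] by (simp del: pp.simps)
  show "(cmod (bb k s x0 m))\<^sup>2 * pp k s m = qq k s m"
    unfolding b using qq_nonneg[OF m] pp_pos[OF m] by (simp del: pp.simps)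
qed

text \<open>By homogeneity the powers \<open>z ^ k m\<close> can be divided out. This leaves weights
  1 on one side and, as \<open>cmod z \<ge> 1\<close> and the \<open>bb\<close> have modulus below
  1, weights in the open unit disk on the other: the situation of \<open>Lee_Yang\<close>.\<close>

lemma bo_P_nonzero:
  assumes z: "1 \<le> cmod z" and lam: "cmod lam = 1"
  shows "bo_P M k \<nu> s x0 z lam \<noteq> 0"
proof -
  define y where "y = (\<lambda>m. bb k s x0 m * lam powi \<nu> m / z ^ k m)"
  have nz: "z \<noteq> 0" "lam \<noteq> 0" using z lam by auto
  have "bo_P M k \<nu> s x0 z lam = LY {1..M} (aa k s) (\<lambda>m. z ^ k m * y m) (\<lambda>j. z ^ k j * 1)"
    unfolding bo_P_LY[OF nz(2)] y_def using nz by simp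
  also have "\<dots> = (\<Prod>m\<in>{1..M}. z ^ k m) * LY {1..M} (aa k s) y (\<lambda>_. 1)"
    by (rule LY_scale) simp
  also have "\<dots> \<noteq> 0"
  proof -
    have "LY {1..M} (aa k s) y (\<lambda>_. 1) \<noteq> 0"
    proof (rule Lee_Yang)
      show "aa k s j m = aa k s m j" for j m by (rule aa_commute)
      show "0 \<le> aa k s j m \<and> aa k s j m < 1" if "j \<in> {1..M}" "m \<in> {1..M}" "j \<noteq> m" for j m
        using aa_props(1,2)[OF that] by blast
      fix j assume j: "j \<in> {1..M}"
      have "1 \<le> cmod z ^ k j" using z by (rule one_le_power)
      then show "cmod (y j) < 1"
        using bb_props(1)[OF j, of x0] lam
        by (simp add: y_def norm_divide norm_mult norm_power norm_power_int divide_less_eq)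
    qed simp
    then show ?thesis using nz by simp
  qed
  finally show ?thesis .
qed

lemma bo_P_factorization:
  assumes "M \<ge> 1"
  shows "\<exists>bs. length bs = bigN M k \<and> (\<forall>z. bo_P M k \<nu> s x0 z lam = (\<Prod>b\<leftarrow>bs. z - b))"
proof (rule monic_factorization[where A = "Pow {1..M}" and T = "{1..M}" and d = "\<lambda>S. \<Sum>j\<in>S. k j"])
  fix S assume S: "S \<in> Pow {1..M}" "S \<noteq> {1..M}"
  then obtain m where m: "m \<in> {1..M}" "m \<notin> S" by blast
  have "(\<Sum>j\<in>S. k j) \<le> (\<Sum>j\<in>{1..M} - {m}. k j)"
    by (rule sum_mono2) (use S m in auto)
  also have "\<dots> < (\<Sum>j\<in>{1..M}. k j)"
    using kpos[OF m(1)] m by (subst (2) sum.remove[of _ m]) auto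
  finally show "(\<Sum>j\<in>S. k j) < bigN M k" by (simp add: bigN_def)
qed (auto simp: bo_P_def bigN_def CS_def)

end

lemma hier_E_root_list:
  fixes \<nu> :: "nat \<Rightarrow> int" and x0 :: "nat \<Rightarrow> real" and \<omega> :: real
  assumes "\<And>j. j \<in> {1..M} \<Longrightarrow> k j > 0" "\<And>j. j \<in> {1..M} \<Longrightarrow> s j \<ge> 0" "M \<ge> 1"
  defines "bs \<equiv> \<lambda>t. root_list (\<lambda>z. bo_P M k \<nu> s x0 z (cis (- (\<omega> * t)))) (bigN M k)"
  shows "\<forall>b\<in>set (bs t). cmod b < 1"
    and "hier_E M k \<nu> s x0 \<omega> 0 0 x (of_real t) = (\<Prod>b\<leftarrow>bs t. 1 - b * exp (\<i> * x))"
    and "(\<Sum>b\<leftarrow>bs t. ubeta b r) = - 4 * Im (hier_E M k \<nu> s x0 \<omega> 1 0 (of_real r) (of_real t) /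
       hier_E M k \<nu> s x0 \<omega> 0 0 (of_real r) (of_real t))"
proof -
  note ex = bo_P_factorization[where M=M and k=k and s=s and \<nu>=\<nu> and ?x0.0=x0 and lam="cis (- (\<omega> * t))", OF assms(1-3)]
  have nz: "bo_P M k \<nu> s x0 z (cis (- (\<omega> * t))) \<noteq> 0" if "cmod z \<ge> 1" for z
    by (rule bo_P_nonzero) (use assms that in auto)
  have D: "((\<lambda>x. hier_E M k \<nu> s x0 \<omega> 0 0 x (of_real t)) has_field_derivative
      hier_E M k \<nu> s x0 \<omega> 1 0 (of_real r) (of_real t)) (at (of_real r))"
    unfolding hier_E_def using expsum_deriv_x by fastforce
  have E: "hier_E M k \<nu> s x0 \<omega> 0 0 x (of_real t) = exp (\<i> * (of_nat (bigN M k) * x)) *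
      bo_P M k \<nu> s x0 (exp (- (\<i> * x))) (cis (- (\<omega> * t)))" for x
    by (rule hier_E_bo_P)
  note * = sum_ubeta_root_list[OF ex nz E D]
  show "\<forall>b\<in>set (bs t). cmod b < 1" unfolding bs_def by (rule *(2))
  show "hier_E M k \<nu> s x0 \<omega> 0 0 x (of_real t) = (\<Prod>b\<leftarrow>bs t. 1 - b * exp (\<i> * x))"
    unfolding bs_def by (rule *(3))
  show "(\<Sum>b\<leftarrow>bs t. ubeta b r) = - 4 * Im (hier_E M k \<nu> s x0 \<omega> 1 0 (of_real r) (of_real t) /
       hier_E M k \<nu> s x0 \<omega> 0 0 (of_real r) (of_real t))"
    unfolding bs_def by (rule *(1))
qed

lemma gen_u_hier_E:
  assumes "\<And>j. j \<in> {1..M} \<Longrightarrow> k j > 0" "\<And>j. j \<in> {1..M} \<Longrightarrow> s j \<ge> 0" "M \<ge> 1"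
  shows "gen_u M k \<nu> s x0 \<alpha> \<omega> x t = \<alpha> - 4 * Im (hier_E M k \<nu> s x0 \<omega> 1 0 (of_real x) (of_real t) /
       hier_E M k \<nu> s x0 \<omega> 0 0 (of_real x) (of_real t))"
  unfolding gen_u_def using hier_E_root_list(3)[OF assms, where t=t and r=x] by simp

text \<open>The bilinear expression multiplies \<open>h A * cnj (h B)\<close> by \<open>\<Omega> A +
  \<Omega> B + (\<kappa> A + \<kappa> B)^2 - a * (\<kappa> A + \<kappa> B) - K\<close>. With
  \<open>\<Omega> A = D A + c * \<kappa> A\<close> and \<open>a = 2 * \<kappa> I + c\<close> the
  terms in \<open>c\<close> cancel and the quadratic part can be completed to a square centred at
  \<open>\<kappa> I\<close>.\<close>

theorem bo_solution_gen_u: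
  assumes "phase_data M k \<nu> s \<omega> c"
  shows "bo_solution (gen_u M k \<nu> s x0 (2 * real (bigN M k) + c) \<omega>)"
proof -
  note pd = assms[unfolded phase_data_def]
  have kpos: "k j > 0" and spos: "s j \<ge> 0" if "j \<in> {1..M}" for j using pd that by auto
  have M: "M \<ge> 1" using pd by auto
  define a where "a = 2 * real (bigN M k) + c"
  define p q where "p = pp k s" and "q = qq k s"
  have pq: "p j - q j = real (k j)" for j by (simp add: p_def q_def)
  define I where "I = {1..M}"
  define C where "C = (\<lambda>A. mixed_prod (aa k s) (I - A) A * (\<Prod>m\<in>A. bb k s x0 m))"
  define \<kappa> where "\<kappa> = (\<lambda>A. \<Sum>m\<in>A. real (k m))"
  define \<Omega> where "\<Omega> = (\<lambda>A. \<omega> * (\<Sum>m\<in>A. real_of_int (\<nu> m)))"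
  define D where "D = (\<lambda>A. \<Sum>j\<in>A. (p j)\<^sup>2 - (q j)\<^sup>2)"
  \<comment> \<open>This value supplies the missing \<open>(\<kappa> I)^2\<close> of the completed
    square and the term \<open>- D I\<close> of \<open>bilinear_identity\<close>.\<close>
  define K where "K = D I - (\<kappa> I)\<^sup>2"
  have E: "hier_E M k \<nu> s x0 \<omega> = expsum (Pow I) C \<kappa> \<Omega>"
    by (simp only: hier_E_def I_def C_def \<kappa>_def \<Omega>_def)
  have \<kappa>I: "\<kappa> I = real (bigN M k)" by (simp add: \<kappa>_def I_def bigN_def)
  have \<Omega>: "\<Omega> A = D A + c * \<kappa> A" if "A \<in> Pow I" for A
  proof -
    have "\<omega> * of_int (\<nu> j) = ((p j)\<^sup>2 - (q j)\<^sup>2) + c * real (k j)" if "j \<in> A" for j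
    proof -
      have "\<omega> * of_int (\<nu> j) = real (k j) * (p j + q j + c)"
        using pd that \<open>A \<in> Pow I\<close> unfolding p_def q_def I_def by blast
      then show ?thesis unfolding pq[symmetric] by (simp add: algebra_simps power2_eq_square)
    qed
    then show ?thesis
      unfolding \<Omega>_def D_def \<kappa>_def sum_distrib_left sum.distrib[symmetric] by (intro sum.cong) auto
  qed
  have "bo_solution (\<lambda>x t. a - 4 * Im (expsum (Pow I) C \<kappa> \<Omega> 1 0 (of_real x) (of_real t) /
      expsum (Pow I) C \<kappa> \<Omega> 0 0 (of_real x) (of_real t)))"
  proof (rule bo_solution_of_bilinear[where K = K])
    fix t :: real
    show "\<exists>bs. (\<forall>b\<in>set bs. cmod b < 1) \<and>
      (\<forall>x. expsum (Pow I) C \<kappa> \<Omega> 0 0 x (of_real t) = (\<Prod>b\<leftarrow>bs. 1 - b * exp (\<i> * x)))"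
      using hier_E_root_list(1,2)[where M=M and k=k and s=s, OF kpos spos M] unfolding E[symmetric] by blast
  next
    fix x t :: real
    \<comment> \<open>For real x and t the exponential has modulus 1, so \<open>\<beta> m\<close>
      has the modulus of \<open>bb k s x0 m\<close>, and \<open>bilinear_identity\<close> applies
      with these weights.\<close>
    define \<beta> where "\<beta> = (\<lambda>m. bb k s x0 m * exp (\<i> * (of_real (real (k m)) * of_real x - of_real (\<omega> * of_int (\<nu> m)) * of_real t)))"
    define h where "h = (\<lambda>A. mixed_prod (aa k s) (I - A) A * (\<Prod>m\<in>A. \<beta> m))"
    have hA: "C A * exp (\<i> * (of_real (\<kappa> A) * of_real x - of_real (\<Omega> A) * of_real t)) = h A" if "A \<in> Pow I" for A
    proof -
      have fin: "finite A" using that by (auto simp: I_def intro: finite_subset)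
      have "\<i> * (of_real (\<kappa> A) * of_real x - of_real (\<Omega> A) * of_real t) =
         (\<Sum>m\<in>A. \<i> * (of_real (real (k m)) * of_real x - of_real (\<omega> * of_int (\<nu> m)) * of_real t))"
        unfolding \<kappa>_def \<Omega>_def by (simp add: sum_distrib_left sum_distrib_right sum_subtractf algebra_simps)
      then show ?thesis unfolding h_def C_def \<beta>_def by (simp add: exp_sum[OF fin] prod.distrib mult_ac)
    qed
    define e where "e = (\<lambda>i j. expsum (Pow I) C \<kappa> \<Omega> i j (of_real x) (of_real t))"
    have e: "e i j = (\<Sum>A\<in>Pow I. (\<i> * of_real (\<kappa> A)) ^ i * (- \<i> * of_real (\<Omega> A)) ^ j * h A)" for i j
      unfolding e_def expsum_def by (rule sum.cong[OF refl]) (simp add: hA[symmetric] mult_ac)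
    have prod: "e i j * cnj (e i' j') = (\<Sum>A\<in>Pow I. \<Sum>B\<in>Pow I.
        ((\<i> * of_real (\<kappa> A)) ^ i * (- \<i> * of_real (\<Omega> A)) ^ j *
         cnj ((\<i> * of_real (\<kappa> B)) ^ i' * (- \<i> * of_real (\<Omega> B)) ^ j')) * (h A * cnj (h B)))" for i j i' j'
      unfolding e cnj_sum sum_product by (intro sum.cong refl) (simp add: mult_ac)
    have z: "(\<Sum>A\<in>Pow I. \<Sum>B\<in>Pow I. of_real (D A + D B - D I + (\<kappa> A + \<kappa> B - \<kappa> I)\<^sup>2) * (h A * cnj (h B))) = 0"
    proof -
      have k\<kappa>: "\<kappa> = (\<lambda>A. \<Sum>j\<in>A. p j - q j)" by (simp only: \<kappa>_def pq)
      have b: "(cmod (\<beta> m))\<^sup>2 * p m = q m" if "m \<in> I" for m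
        using bb_props(2)[where M=M and k=k and s=s, OF kpos spos, of m x0] that
        unfolding \<beta>_def norm_mult I_def p_def q_def
        by (simp del: pp.simps add: norm_exp_eq_Re)
      have "finite I" by (simp add: I_def)
      moreover have "inj_on p I" "inj_on q I"
        unfolding p_def q_def I_def using inj_pp[where M=M and k=k and s=s] inj_qq[where M=M and k=k and s=s] kpos spos by blast+
      moreover have "p m \<noteq> 0" if "m \<in> I" for m
        using pp_pos[where M=M and k=k and s=s, OF kpos spos, of m] that unfolding p_def I_def by linarith
      moreover have "(aa k s j m)\<^sup>2 * ((q m - q j) * (p m - p j)) = (p m - q j) * (q m - p j)"
        if "j \<in> I" "m \<in> I" "j \<noteq> m" for j m
        using aa_props(3)[where M=M and k=k and s=s, OF kpos spos, of j m] that unfolding p_def q_def I_def by blast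
      ultimately show ?thesis
        unfolding h_def D_def k\<kappa> by (intro bilinear_identity aa_commute b)
    qed
    have "\<i> * (e 0 1 * cnj (e 0 0) - e 0 0 * cnj (e 0 1))
      - (e 2 0 * cnj (e 0 0) - 2 * (e 1 0 * cnj (e 1 0)) + e 0 0 * cnj (e 2 0))
      + \<i> * of_real a * (e 1 0 * cnj (e 0 0) - e 0 0 * cnj (e 1 0)) - of_real K * (e 0 0 * cnj (e 0 0)) =
      (\<Sum>A\<in>Pow I. \<Sum>B\<in>Pow I. of_real (D A + D B - D I + (\<kappa> A + \<kappa> B - \<kappa> I)\<^sup>2) * (h A * cnj (h B)))"
      unfolding prod sum_distrib_left sum_subtractf[symmetric] sum.distrib[symmetric]
    proof (intro sum.cong refl, goal_cases)
      case (1 A B)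
      define H where "H = h A * cnj (h B)"
      have "D A + D B - D I + (\<kappa> A + \<kappa> B - \<kappa> I)\<^sup>2 =
         \<Omega> A + \<Omega> B + (\<kappa> A + \<kappa> B)\<^sup>2 - a * (\<kappa> A + \<kappa> B) - K"
        unfolding \<Omega>[OF 1(1)] \<Omega>[OF 1(2)] K_def a_def \<kappa>I by (simp add: power2_eq_square algebra_simps)
      then have eq: "of_real (D A + D B - D I + (\<kappa> A + \<kappa> B - \<kappa> I)\<^sup>2) =
         (of_real (\<Omega> A) + of_real (\<Omega> B) + (of_real (\<kappa> A) + of_real (\<kappa> B))\<^sup>2
           - of_real a * (of_real (\<kappa> A) + of_real (\<kappa> B)) - of_real K :: complex)"
        by simp
      show ?case unfolding H_def[symmetric] eq by (simp add: power2_eq_square algebra_simps)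
    qed
    then show "let e = (\<lambda>i j. expsum (Pow I) C \<kappa> \<Omega> i j (of_real x) (of_real t)) in
      \<i> * (e 0 1 * cnj (e 0 0) - e 0 0 * cnj (e 0 1))
      - (e 2 0 * cnj (e 0 0) - 2 * e 1 0 * cnj (e 1 0) + e 0 0 * cnj (e 2 0))
      + \<i> * of_real a * (e 1 0 * cnj (e 0 0) - e 0 0 * cnj (e 1 0)) = of_real K * e 0 0 * cnj (e 0 0)"
      unfolding Let_def e_def[THEN fun_cong, THEN fun_cong, symmetric] z by (simp add: mult_ac)
  qed
  moreover have "gen_u M k \<nu> s x0 a \<omega> = (\<lambda>x t. a - 4 * Im (expsum (Pow I) C \<kappa> \<Omega> 1 0 (of_real x) (of_real t) /
      expsum (Pow I) C \<kappa> \<Omega> 0 0 (of_real x) (of_real t)))"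
    unfolding E[symmetric] using gen_u_hier_E[where M=M and k=k and s=s, OF kpos spos M] by (intro ext) blast
  ultimately show ?thesis by (simp add: a_def)
qed

section \<open>Admissible parameters and merging\<close>

lemma phase_dataD:
  assumes "phase_data M k \<nu> s \<omega> c"
  shows "M \<ge> 1" "\<omega> > 0" "\<And>j. j \<in> {1..M} \<Longrightarrow> k j > 0" "\<And>j. j \<in> {1..M} \<Longrightarrow> s j \<ge> 0"
    "\<And>j. j \<in> {1..M} \<Longrightarrow> \<omega> * of_int (\<nu> j) = real (k j) * (pp k s j + qq k s j + c)"
  using assms unfolding phase_data_def by blast+

lemma pp_qq_pred:
  assumes "j \<ge> 2"
  shows "pp k s j + qq k s j = pp k s (j - 1) + qq k s (j - 1) + (real (k j) + real (k (j - 1)) + 2 * s j)"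
  using qq_Suc[of "j - 1" k s] assms by simp

text \<open>\<open>tau\<close> and \<open>gam\<close> are the coefficients obtained on solving the
  right-hand equation for \<open>\<omega>\<close> as an affine function of
  \<open>s j\<close>.\<close>

lemma omega_mj_iff:
  assumes "mj k \<nu> j \<noteq> 0"
  shows "tau k \<nu> j + gam k \<nu> j * s j = \<omega> \<longleftrightarrow>
    \<omega> * mj k \<nu> j = real (k j) * real (k (j - 1)) * (real (k j) + real (k (j - 1)) + 2 * s j)"
  unfolding tau_def gam_def using assms by (auto simp: field_simps)

text \<open>Cross-multiplying the relations for \<open>j\<close> and \<open>j - 1\<close> eliminates
  \<open>c\<close> and leaves an equation for \<open>\<omega> * mj k \<nu> j\<close> whose
  right-hand side is positive.\<close>

lemma phase_data_tau:
  assumes pd: "phase_data M k \<nu> s \<omega> c" and j: "j \<in> {2..M}"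
  shows "mj k \<nu> j > 0" "tau k \<nu> j + gam k \<nu> j * s j = \<omega>"
proof -
  have jj: "j \<in> {1..M}" "j - 1 \<in> {1..M}" "j \<ge> 2" using j by auto
  note k = phase_dataD(3)[OF pd]
  have "\<omega> * mj k \<nu> j = real (k (j - 1)) * (\<omega> * of_int (\<nu> j)) - real (k j) * (\<omega> * of_int (\<nu> (j - 1)))"
    by (simp add: mj_def algebra_simps)
  also have "\<dots> = real (k j) * real (k (j - 1)) * ((pp k s j + qq k s j) - (pp k s (j - 1) + qq k s (j - 1)))"
    unfolding phase_dataD(5)[OF pd jj(1)] phase_dataD(5)[OF pd jj(2)] by (simp del: pp.simps add: algebra_simps)
  finally have *: "\<omega> * mj k \<nu> j = real (k j) * real (k (j - 1)) * (real (k j) + real (k (j - 1)) + 2 * s j)"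
    unfolding pp_qq_pred[OF jj(3)] by simp
  have "real (k j) * real (k (j - 1)) * (real (k j) + real (k (j - 1)) + 2 * s j) > 0"
    using k[OF jj(1)] k[OF jj(2)] phase_dataD(4)[OF pd jj(1)] by (intro mult_pos_pos add_pos_nonneg) auto
  then show m: "mj k \<nu> j > 0"
    unfolding *[symmetric] using phase_dataD(2)[OF pd] by (simp add: zero_less_mult_iff)
  show "tau k \<nu> j + gam k \<nu> j * s j = \<omega>"
    by (subst omega_mj_iff) (use m * in auto)
qed

lemma mj_pos_iff:
  assumes "k j > 0"
  shows "real_of_int (\<nu> (j-1)) < real (k (j-1)) / real (k j) * real_of_int (\<nu> j) \<longleftrightarrow> mj k \<nu> j > 0"
  using assms by (simp add: mj_def field_simps)

lemma gam_pos: "mj k \<nu> j > 0 \<Longrightarrow> k j > 0 \<Longrightarrow> k (j - 1) > 0 \<Longrightarrow> gam k \<nu> j > 0"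
  and tau_pos: "mj k \<nu> j > 0 \<Longrightarrow> k j > 0 \<Longrightarrow> k (j - 1) > 0 \<Longrightarrow> tau k \<nu> j > 0"
  by (simp_all add: gam_def tau_def)

text \<open>The values do not depend on \<open>J\<close>. This settles the quantification over all
  admissible \<open>J\<close> in \<open>hier_member\<close> when the maximum of \<open>tau\<close>
  is attained more than once.\<close>

lemma phase_data_hier_params:
  assumes pd: "phase_data M k \<nu> s \<omega> c" and hp: "hier_params M k \<nu> J s"
  shows "omegaJ k \<nu> J s = \<omega>" "alphaJ M k \<nu> J s = 2 * real (bigN M k) + c"
proof -
  have J: "J \<in> {2..M}" using hp by (simp add: hier_params_def)
  show w: "omegaJ k \<nu> J s = \<omega>" unfolding omegaJ_def by (rule phase_data_tau(2)[OF pd J])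
  have 1: "1 \<in> {1..M}" using phase_dataD(1)[OF pd] by simp
  have "alphaJ M k \<nu> J s = 2 * real (bigN M k) - real (k 1) - 2 * s 1
      + real_of_int (\<nu> 1) / real (k 1) * omegaJ k \<nu> J s"
    by (simp add: alphaJ_def omegaJ_def algebra_simps)
  also have "real_of_int (\<nu> 1) / real (k 1) * omegaJ k \<nu> J s = pp k s 1 + qq k s 1 + c"
    using phase_dataD(5)[OF pd 1] phase_dataD(3)[OF pd 1] unfolding w by (simp add: field_simps)
  finally show "alphaJ M k \<nu> J s = 2 * real (bigN M k) + c" by simp
qed

text \<open>All the numbers \<open>tau k \<nu> j + gam k \<nu> j * s j\<close> equal
  \<open>\<omega>\<close>, so any maximiser \<open>J\<close> of \<open>tau\<close> expresses the
  other \<open>s j\<close> through \<open>s J\<close>.\<close>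

lemma phase_data_ex_hier_params:
  assumes pd: "phase_data M k \<nu> s \<omega> c" and M: "M \<ge> 2"
  shows "\<exists>J. hier_params M k \<nu> J s"
proof -
  have "\<exists>J\<in>{2..M}. \<forall>j\<in>{2..M}. tau k \<nu> j \<le> tau k \<nu> J"
  proof -
    have "finite (tau k \<nu> ` {2..M})" "tau k \<nu> ` {2..M} \<noteq> {}" using M by auto
    from Max_in[OF this] Max_ge[OF this(1)] show ?thesis by fastforce
  qed
  then obtain J where J: "J \<in> {2..M}" "\<And>j. j \<in> {2..M} \<Longrightarrow> tau k \<nu> j \<le> tau k \<nu> J" by blast
  have k: "k j > 0" "k (j - 1) > 0" if "j \<in> {2..M}" for j
  proof -
    have "j \<in> {1..M}" "j - 1 \<in> {1..M}" using that by auto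
    then show "k j > 0" "k (j - 1) > 0" using phase_dataD(3)[OF pd] by blast+
  qed
  have sj: "s j = (tau k \<nu> J - tau k \<nu> j) / gam k \<nu> j + gam k \<nu> J / gam k \<nu> j * s J" if j: "j \<in> {2..M}" for j
    using phase_data_tau(2)[OF pd j] phase_data_tau(2)[OF pd J(1)] gam_pos[OF phase_data_tau(1)[OF pd j] k[OF j]]
    by (simp add: field_simps)
  have nu: "real_of_int (\<nu> (j-1)) < real (k (j-1)) / real (k j) * real_of_int (\<nu> j)" if j: "j \<in> {2..M}" for j
    using mj_pos_iff[of k j \<nu>] k(1)[OF j] phase_data_tau(1)[OF pd j] by blast
  have s0: "s 1 \<ge> 0" "s J \<ge> 0" using phase_dataD(1,4)[OF pd] J(1) by auto
  show ?thesis unfolding hier_params_def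
    using J M nu sj s0 phase_dataD(3)[OF pd] by (intro exI[of _ J]) blast
qed

lemma hier_memberI:
  assumes "phase_data M k \<nu> s \<omega> c" "M \<ge> 2" "gen_u M k \<nu> s x0 (2 * real (bigN M k) + c) \<omega> = u"
  shows "hier_member M k \<nu> s x0 u"
  unfolding hier_member_def hier_u_def
  using phase_data_ex_hier_params[OF assms(1,2)] phase_data_hier_params[OF assms(1)] assms(3) by auto

text \<open>The constant is fixed by the relation at \<open>j = 1\<close>, where
  \<open>pp + qq\<close> is \<open>k 1 + 2 * s 1\<close>; the equations for \<open>s j\<close> carry
  it from \<open>j\<close> to \<open>j + 1\<close>. Maximality of \<open>tau k \<nu> J\<close> makes
  every \<open>s j\<close> nonnegative.\<close>

lemma hier_params_phase_data:
  assumes hp: "hier_params M k \<nu> J s"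
  defines "\<omega> \<equiv> omegaJ k \<nu> J s"
  shows "phase_data M k \<nu> s \<omega> (\<omega> * of_int (\<nu> 1) / real (k 1) - (real (k 1) + 2 * s 1))"
proof -
  define c where "c = \<omega> * of_int (\<nu> 1) / real (k 1) - (real (k 1) + 2 * s 1)"
  note h = hp[unfolded hier_params_def]
  have kp: "k j > 0" if "j \<in> {1..M}" for j using h that by blast
  have kj: "k j > 0" "k (j - 1) > 0" if "j \<in> {2..M}" for j
  proof -
    have "j \<in> {1..M}" "j - 1 \<in> {1..M}" using that by auto
    then show "k j > 0" "k (j - 1) > 0" using kp by blast+
  qed
  have m: "mj k \<nu> j > 0" if j: "j \<in> {2..M}" for j
    using mj_pos_iff[of k j \<nu>] kj(1)[OF j] h j by blast
  note g = gam_pos[OF m kj]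
  have J: "J \<in> {2..M}" using h by blast
  have eqj: "tau k \<nu> j + gam k \<nu> j * s j = \<omega>" if j: "j \<in> {2..M}" for j
  proof (cases "j = J")
    case False
    then have "s j = (tau k \<nu> J - tau k \<nu> j) / gam k \<nu> j + gam k \<nu> J / gam k \<nu> j * s J" using h j by blast
    then show ?thesis using g[OF j j j] by (simp add: \<omega>_def omegaJ_def field_simps)
  qed (simp add: \<omega>_def omegaJ_def)
  have w: "\<omega> > 0"
    unfolding \<omega>_def omegaJ_def
    using tau_pos[OF m kj] g J h by (intro add_pos_nonneg mult_nonneg_nonneg) (auto intro: less_imp_le)
  have s0: "s j \<ge> 0" if j: "j \<in> {1..M}" for j
  proof -
    consider "j = 1" | "j = J" | "j \<in> {2..M}" "j \<noteq> J" using j by force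
    then show ?thesis
    proof cases
      case 3
      then have "s j = (tau k \<nu> J - tau k \<nu> j) / gam k \<nu> j + gam k \<nu> J / gam k \<nu> j * s J" using h by blast
      moreover have "tau k \<nu> j \<le> tau k \<nu> J" "s J \<ge> 0" using h 3 by blast+
      ultimately show ?thesis using g[OF 3(1) 3(1) 3(1)] g[OF J J J] by simp
    qed (use h in blast)+
  qed
  have "\<omega> * of_int (\<nu> j) = real (k j) * (pp k s j + qq k s j + c)" if "1 \<le> j" "j \<le> M" for j
    using that
  proof (induction j rule: dec_induct)
    case base
    then show ?case using kp[of 1] by (simp add: c_def field_simps)
  next
    case (step j)
    have j: "Suc j \<in> {2..M}" "j \<in> {1..M}" using step by auto
    have "\<omega> * mj k \<nu> (Suc j) = real (k (Suc j)) * real (k j) * (real (k (Suc j)) + real (k j) + 2 * s (Suc j))"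
      using omega_mj_iff[of k \<nu> "Suc j" s \<omega>] m[OF j(1)] eqj[OF j(1)] by simp
    then have "real (k j) * (\<omega> * of_int (\<nu> (Suc j))) = real (k (Suc j)) * (\<omega> * of_int (\<nu> j)) +
       real (k (Suc j)) * real (k j) * (real (k (Suc j)) + real (k j) + 2 * s (Suc j))"
      by (simp add: mj_def algebra_simps)
    also have "\<omega> * of_int (\<nu> j) = real (k j) * (pp k s j + qq k s j + c)" using step by simp
    also have "real (k (Suc j)) * (real (k j) * (pp k s j + qq k s j + c)) +
       real (k (Suc j)) * real (k j) * (real (k (Suc j)) + real (k j) + 2 * s (Suc j))
      = real (k j) * (real (k (Suc j)) * (pp k s (Suc j) + qq k s (Suc j) + c))"
      using pp_qq_pred[of "Suc j" k s] step(1) by (simp del: pp.simps qq.simps add: algebra_simps)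
    finally show ?case using kp[OF j(2)] by (simp del: pp.simps qq.simps)
  qed
  then show ?thesis unfolding phase_data_def c_def[symmetric] using w kp s0 h by auto
qed

section \<open>Merging two adjacent intervals\<close>

text \<open>Square root of a cross-ratio of the endpoints of the intervals from a to b and from c to
  d.\<close>

definition pair_coeff :: "real \<Rightarrow> real \<Rightarrow> real \<Rightarrow> real \<Rightarrow> real" where
  "pair_coeff a b c d = sqrt (((d - a) * (c - b)) / ((c - a) * (d - b)))"

lemma aa_pair_coeff: "aa k s j m = pair_coeff (qq k s j) (pp k s j) (qq k s m) (pp k s m)"
  by (simp only: aa_def pair_coeff_def)

text \<open>The factors with the common endpoint \<open>r\<close> cancel, so couplings multiply over
  adjacent intervals. No signs have to be controlled, because \<open>sqrt\<close> is multiplicative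
  on all reals.\<close>

lemma pair_coeff_mult: "c \<noteq> r \<Longrightarrow> d \<noteq> r \<Longrightarrow> pair_coeff a r c d * pair_coeff r b c d = pair_coeff a b c d"
proof -
  assume "c \<noteq> r" "d \<noteq> r"
  then have nz: "c - r \<noteq> 0" "d - r \<noteq> 0" by auto
  have "(A * X / (B * Y)) * (Y * C / (X * D)) = A * C / (B * D)" if "X \<noteq> 0" "Y \<noteq> 0" for A B C D X Y :: real
    using that by (cases "B = 0"; cases "D = 0") (auto simp: field_simps)
  from this[OF nz] show ?thesis
    unfolding pair_coeff_def real_sqrt_mult[symmetric] by (rule arg_cong[of _ _ sqrt])
qed

context
  fixes M :: nat and k :: "nat \<Rightarrow> nat" and \<nu> :: "nat \<Rightarrow> int" and s :: "nat \<Rightarrow> real" and \<omega> c :: real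
    and x0 :: "nat \<Rightarrow> real"
  assumes pd: "phase_data M k \<nu> s \<omega> c"
begin

lemma phase_data_inj_pp: "inj_on (pp k s) {1..M}" and phase_data_inj_qq: "inj_on (qq k s) {1..M}"
  using inj_pp inj_qq phase_dataD(3,4)[OF pd] by blast+

lemma phase_data_pp_pos: "j \<in> {1..M} \<Longrightarrow> 0 < pp k s j"
  using pp_pos phase_dataD(3,4)[OF pd] by blast

lemma phase_data_pp_le_qq: "1 \<le> j \<Longrightarrow> j < m \<Longrightarrow> m \<le> M \<Longrightarrow> pp k s j \<le> qq k s m"
  using pp_le_qq phase_dataD(3,4)[OF pd] by blast

context
  fixes J :: nat
  assumes J: "J \<in> {2..M}" and sJ: "s J = 0"
begin

lemma qq_merged: "qq k s J = pp k s (J - 1)"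
proof -
  have "1 \<le> J - 1" "Suc (J - 1) = J" using J by auto
  then show ?thesis using qq_Suc[of "J - 1" k s] sJ by simp
qed

text \<open>The merged interval, number \<open>J - 1\<close>, keeps the left end of
  \<open>J - 1\<close> and the right end of \<open>J\<close>. Therefore the shift of indices begins
  one place earlier for \<open>pp\<close> than for \<open>qq\<close>.\<close>

lemma merge_qq_pp:
  assumes "1 \<le> j"
  shows "qq (merge_k J k) (merge_s J s) j = (if j \<le> J - 1 then qq k s j else qq k s (j + 1))"
    and "pp (merge_k J k) (merge_s J s) j = (if j \<le> J - 2 then pp k s j else pp k s (j + 1))"
proof -
  let ?k = "merge_k J k" and ?s = "merge_s J s"
  have Jle: "J \<ge> 2" using J by simp
  then have Jn: "\<not> J - 1 \<le> J - 2" by linarith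
  have p: "pp ?k ?s j = (if j \<le> J - 2 then pp k s j else pp k s (j + 1))"
    if q: "qq ?k ?s j = (if j \<le> J - 1 then qq k s j else qq k s (j + 1))" for j
  proof -
    consider "j \<le> J - 2" | "j = J - 1" | "j \<ge> J" by linarith
    then show ?thesis
    proof cases
      case 2
      then have "pp ?k ?s j = qq k s (J - 1) + (real (k (J - 1)) + real (k J))"
        using q Jle Jn by (simp add: merge_k_def)
      also have "\<dots> = pp k s J" using qq_merged by simp
      finally show ?thesis using 2 Jle Jn by simp
    qed (use q Jle in \<open>auto simp: merge_k_def\<close>)
  qed
  have q: "qq ?k ?s j = (if j \<le> J - 1 then qq k s j else qq k s (j + 1))"
    using assms
  proof (induction j rule: dec_induct)
    case base
    then show ?case using Jle by (auto simp: merge_s_def)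
  next
    case (step j)
    have "qq ?k ?s (Suc j) = (if j \<le> J - 2 then pp k s j else pp k s (Suc j)) + ?s (Suc j)"
      unfolding qq_Suc[OF step(1)] using p[OF step.IH] by simp
    also have "\<dots> = (if Suc j \<le> J - 1 then qq k s (Suc j) else qq k s (Suc j + 1))"
      using qq_Suc[of j k s] qq_Suc[of "Suc j" k s] step(1) Jle by (auto simp: merge_s_def)
    finally show ?case .
  qed
  show "qq ?k ?s j = (if j \<le> J - 1 then qq k s j else qq k s (j + 1))" by (rule q)
  show "pp ?k ?s j = (if j \<le> J - 2 then pp k s j else pp k s (j + 1))" by (rule p[OF q])
qed

lemma merge_phase_data: "phase_data (M - 1) (merge_k J k) (merge_nu J \<nu>) (merge_s J s) \<omega> c"
proof -
  have Jle: "2 \<le> J" "J \<le> M" "\<not> J - 1 \<le> J - 2" using J by auto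
  have k': "merge_k J k j > 0" and s': "merge_s J s j \<ge> 0" if "j \<in> {1..M - 1}" for j
    using phase_dataD(3,4)[OF pd] that Jle by (auto simp: merge_k_def merge_s_def)
  have "\<omega> * of_int (merge_nu J \<nu> j) = real (merge_k J k j) *
     (pp (merge_k J k) (merge_s J s) j + qq (merge_k J k) (merge_s J s) j + c)" if j: "j \<in> {1..M - 1}" for j
  proof -
    have j1: "1 \<le> j" using j by simp
    consider "j \<le> J - 2" | "j = J - 1" | "j \<ge> J" by linarith
    then show ?thesis
    proof cases
      case 1
      then have "j \<le> J - 1" by linarith
      then show ?thesis using 1 phase_dataD(5)[OF pd, of j] j Jle
        unfolding merge_qq_pp[OF j1] by (simp add: merge_nu_def merge_k_def)
    next
      case 2
      define a b where "a = qq k s (J - 1)" and "b = pp k s (J - 1)"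
      have b: "b = a + real (k (J - 1))" by (simp add: a_def b_def)
      have qq_merged: "qq k s J = b" unfolding b_def by (rule qq_merged)
      have pJ: "pp k s J = b + real (k J)" using qq_merged by simp
      have 3: "J - 1 \<in> {1..M}" "J \<in> {1..M}" using Jle by auto
      have "\<omega> * of_int (merge_nu J \<nu> j) = \<omega> * of_int (\<nu> (J - 1)) + \<omega> * of_int (\<nu> J)"
        using 2 Jle by (simp add: merge_nu_def algebra_simps)
      also have "\<dots> = real (k (J - 1)) * (b + a + c) + real (k J) * (b + real (k J) + b + c)"
        unfolding phase_dataD(5)[OF pd 3(1)] phase_dataD(5)[OF pd 3(2)] qq_merged pJ a_def b_def ..
      also have "\<dots> = (real (k (J - 1)) + real (k J)) * (b + real (k J) + a + c)"
        unfolding b by (simp add: algebra_simps)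
      also have "\<dots> = real (merge_k J k j) *
        (pp (merge_k J k) (merge_s J s) j + qq (merge_k J k) (merge_s J s) j + c)"
        unfolding merge_qq_pp[OF j1] using 2 Jle pJ by (simp add: merge_k_def a_def del: pp.simps)
      finally show ?thesis .
    next
      case 3
      then have "\<not> j \<le> J - 1" using Jle by linarith
      then show ?thesis using 3 phase_dataD(5)[OF pd, of "j + 1"] j Jle
        unfolding merge_qq_pp[OF j1] by (simp add: merge_nu_def merge_k_def del: pp.simps)
    qed
  qed
  then show ?thesis unfolding phase_data_def using k' s' phase_dataD(2)[OF pd] Jle by auto
qed

lemma merge_bij:
  defines "f \<equiv> \<lambda>j. if j \<le> J - 1 then j else j + 1"
  shows "inj_on f {1..M - 1}" "f ` {1..M - 1} = {1..M} - {J}"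
proof -
  show "inj_on f {1..M - 1}" by (rule inj_onI) (auto simp: f_def split: if_splits)
  show "f ` {1..M - 1} = {1..M} - {J}"
  proof (intro equalityI subsetI)
    fix j assume "j \<in> {1..M} - {J}"
    then show "j \<in> f ` {1..M - 1}"
      using J by (intro image_eqI[of _ _ "if j < J then j else j - 1"]) (auto simp: f_def)
  qed (use J in \<open>auto simp: f_def split: if_splits\<close>)
qed

lemma merge_bigN: "bigN (M - 1) (merge_k J k) = bigN M k"
proof -
  let ?f = "\<lambda>j. if j \<le> J - 1 then j else j + 1"
  define g where "g = k(J - 1 := k (J - 1) + k J)"
  have J1: "J - 1 \<in> {1..M} - {J}" "J \<in> {1..M}" using J by auto
  have "bigN (M - 1) (merge_k J k) = (\<Sum>j\<in>{1..M - 1}. g (?f j))"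
    unfolding bigN_def by (rule sum.cong) (use J in \<open>auto simp: merge_k_def g_def\<close>)
  also have "\<dots> = (\<Sum>j\<in>{1..M} - {J}. g j)"
    using sum.reindex[OF merge_bij(1), of g] unfolding merge_bij(2) by (simp add: o_def)
  also have "\<dots> = k (J - 1) + k J + (\<Sum>j\<in>{1..M} - {J} - {J - 1}. k j)"
    by (subst sum.remove[OF _ J1(1)]) (auto simp: g_def)
  also have "\<dots> = bigN M k"
    unfolding bigN_def
    by (subst sum.remove[OF _ J1(2)], simp, subst sum.remove[OF _ J1(1), of k]) auto
  finally show ?thesis .
qed

text \<open>Since \<open>qq k s J = pp k s (J - 1)\<close>, the coupling of \<open>J - 1\<close> and
  \<open>J\<close> is zero and \<open>LY_merge\<close> applies. The merged couplings are those of
  the union by \<open>pair_coeff_mult\<close>, and the product of the two square roots in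
  \<open>bb\<close> telescopes through the common endpoint.\<close>

lemma merge_bo_P:
  assumes lam: "lam \<noteq> 0"
  shows "bo_P (M - 1) (merge_k J k) (merge_nu J \<nu>) (merge_s J s) (merge_x J k x0) z lam = bo_P M k \<nu> s x0 z lam"
proof -
  let ?f = "\<lambda>j. if j \<le> J - 1 then j else j + 1"
  define V where "V = {1..M} - {J - 1, J}"
  define y where "y = (\<lambda>m. bb k s x0 m * lam powi \<nu> m)"
  define a where "a = aa k s"
  define a' where "a' = (\<lambda>j m. if j = J - 1 then a (J - 1) m * a J m
      else if m = J - 1 then a j (J - 1) * a j J else a j m)"
  have Jle: "2 \<le> J" "J \<le> M" "\<not> J - 1 \<le> J - 2" using J by auto
  have J1: "J - 1 \<in> {1..M}" "J \<in> {1..M}" "J - 1 \<noteq> J" using J by auto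
  have a0: "a (J - 1) J = 0" unfolding a_def aa_def qq_merged by simp
  have a0': "a J (J - 1) = 0" using a0 aa_commute unfolding a_def by metis
  have V: "finite V" "J - 1 \<notin> V" "J \<notin> V" "J - 1 \<noteq> J" using J by (auto simp: V_def)
  have I: "{1..M} = insert (J - 1) (insert J V)" "insert (J - 1) V = ?f ` {1..M - 1}"
    using J1 unfolding merge_bij(2) V_def by auto
  have "bo_P M k \<nu> s x0 z lam = LY (insert (J - 1) (insert J V)) a y (\<lambda>j. z ^ k j)"
    unfolding bo_P_LY[OF lam] a_def y_def I(1)[symmetric] ..
  also have "\<dots> = LY (insert (J - 1) V) a' (y(J - 1 := y (J - 1) * y J))
     ((\<lambda>j. z ^ k j)(J - 1 := z ^ k (J - 1) * z ^ k J))"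
    unfolding a'_def by (rule LY_merge[OF V a0 a0'])
  also have "\<dots> = LY {1..M - 1} (\<lambda>j m. a' (?f j) (?f m)) (\<lambda>j. (y(J - 1 := y (J - 1) * y J)) (?f j))
     (\<lambda>j. ((\<lambda>j. z ^ k j)(J - 1 := z ^ k (J - 1) * z ^ k J)) (?f j))"
    unfolding I(2) by (rule LY_reindex[OF merge_bij(1)])
  also have "\<dots> = LY {1..M - 1} (aa (merge_k J k) (merge_s J s))
      (\<lambda>m. bb (merge_k J k) (merge_s J s) (merge_x J k x0) m * lam powi merge_nu J \<nu> m) (\<lambda>j. z ^ merge_k J k j)"
  proof (rule LY_cong)
    fix j assume j: "j \<in> {1..M - 1}"
    then have j1: "1 \<le> j" by simp
    show "((\<lambda>j. z ^ k j)(J - 1 := z ^ k (J - 1) * z ^ k J)) (?f j) = z ^ merge_k J k j"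
      using Jle by (auto simp: merge_k_def power_add)
    show "(y(J - 1 := y (J - 1) * y J)) (?f j) =
       bb (merge_k J k) (merge_s J s) (merge_x J k x0) j * lam powi merge_nu J \<nu> j"
    proof (cases "j = J - 1")
      case True
      have "pp k s (J - 1) > 0" using phase_data_pp_pos J1 by blast
      then have "sqrt (qq k s (J - 1) / pp k s (J - 1)) * sqrt (qq k s J / pp k s J) = sqrt (qq k s (J - 1) / pp k s J)"
        unfolding real_sqrt_mult[symmetric] qq_merged by (simp del: pp.simps)
      \<comment> \<open>The mean weighted by \<open>k\<close> in \<open>merge_x\<close> is the
        choice for which the two phases add up.\<close>
      moreover have "cis (- (real (k (J - 1)) * x0 (J - 1))) * cis (- (real (k J) * x0 J)) =
         cis (- (real (merge_k J k j) * merge_x J k x0 j))"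
        using True Jle phase_dataD(3)[OF pd J1(1)] by (simp add: cis_mult merge_k_def merge_x_def)
      ultimately have "bb k s x0 (J - 1) * bb k s x0 J = bb (merge_k J k) (merge_s J s) (merge_x J k x0) j"
        using True Jle unfolding bb_def merge_qq_pp[OF j1]
        by (simp del: pp.simps add: mult_ac flip: of_real_mult)
      moreover have "lam powi \<nu> (J - 1) * lam powi \<nu> J = lam powi merge_nu J \<nu> j"
        using True Jle lam by (simp add: merge_nu_def power_int_add)
      ultimately show ?thesis using True by (simp add: y_def) (metis mult.assoc mult.left_commute)
    next
      case False
      have "bb (merge_k J k) (merge_s J s) (merge_x J k x0) j = bb k s x0 (?f j)"
        using False Jle unfolding bb_def merge_qq_pp[OF j1]
        by (auto simp: merge_k_def merge_x_def simp del: pp.simps)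
      moreover have "merge_nu J \<nu> j = \<nu> (?f j)" using False Jle by (auto simp: merge_nu_def)
      moreover have "?f j \<noteq> J - 1" using False by auto
      ultimately show ?thesis by (simp add: y_def)
    qed
  next
    fix j m assume j: "j \<in> {1..M - 1}" and m: "m \<in> {1..M - 1}" and jm: "j \<noteq> m"
    have fI: "?f i \<in> {1..M}" "?f i \<noteq> J" if "i \<in> {1..M - 1}" for i using that Jle by auto
    have fn: "?f i \<noteq> J - 1" if "i \<noteq> J - 1" for i using that Jle by auto
    have qp: "qq (merge_k J k) (merge_s J s) i = qq k s (?f i)"
      "i \<noteq> J - 1 \<Longrightarrow> pp (merge_k J k) (merge_s J s) i = pp k s (?f i)"
      "i = J - 1 \<Longrightarrow> pp (merge_k J k) (merge_s J s) i = pp k s J" if "i \<in> {1..M - 1}" for i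
      using merge_qq_pp[of i] that Jle by (auto simp del: pp.simps)
    have main: "aa k s (J - 1) (?f i) * aa k s J (?f i) = aa (merge_k J k) (merge_s J s) (J - 1) i"
      if i: "i \<in> {1..M - 1}" "i \<noteq> J - 1" for i
    proof -
      have n1: "qq k s (?f i) \<noteq> pp k s (J - 1)"
        using phase_data_inj_qq fI[OF i(1)] J1(2) unfolding qq_merged[symmetric] by (metis inj_onD)
      have n2: "pp k s (?f i) \<noteq> pp k s (J - 1)"
        using phase_data_inj_pp fI(1)[OF i(1)] fn[OF i(2)] J1(1) by (metis inj_onD)
      have J': "J - 1 \<in> {1..M - 1}" using Jle by auto
      have fJ: "?f (J - 1) = J - 1" by simp
      show ?thesis
        unfolding aa_pair_coeff qp(1)[OF i(1)] qp(2)[OF i] qp(1)[OF J'] qp(3)[OF J' refl] fJ qq_merged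
        by (rule pair_coeff_mult[OF n1 n2])
    qed
    show "a' (?f j) (?f m) = aa (merge_k J k) (merge_s J s) j m"
    proof -
      consider "j = J - 1" | "m = J - 1" "j \<noteq> J - 1" | "j \<noteq> J - 1" "m \<noteq> J - 1" by blast
      then show ?thesis
      proof cases
        case 1
        then show ?thesis using main[OF m] jm by (simp add: a'_def a_def)
      next
        case 2
        have "?f m = J - 1" using 2 by simp
        then have "a' (?f j) (?f m) = aa k s (?f j) (J - 1) * aa k s (?f j) J"
          using fn[OF 2(2)] by (simp only: a'_def a_def if_False if_True refl)
        also have "\<dots> = aa k s (J - 1) (?f j) * aa k s J (?f j)"
          by (simp only: aa_commute[of k s "?f j"])
        finally show ?thesis using main[OF j 2(2)] 2(1) aa_commute by metis
      next
        case 3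
        then have "a' (?f j) (?f m) = aa k s (?f j) (?f m)"
          using fn[OF 3(1)] fn[OF 3(2)] by (simp only: a'_def a_def if_False)
        then show ?thesis unfolding aa_pair_coeff qp(1)[OF j] qp(1)[OF m] qp(2)[OF j 3(1)] qp(2)[OF m 3(2)] .
      qed
    qed
  qed
  finally show ?thesis unfolding bo_P_LY[OF lam] ..
qed

end

end

section \<open>Shifting, repeated merging and travelling waves\<close>

text \<open>A comparison that tolerates polynomials of different degree: equality of E for all
  complex x forces equality of the x-derivative, and E with this derivative determines the
  solution.\<close>

lemma gen_u_cong_hier_E:
  assumes "\<And>j. j \<in> {1..M} \<Longrightarrow> k j > 0" "\<And>j. j \<in> {1..M} \<Longrightarrow> s j \<ge> 0" "M \<ge> 1"
    and "\<And>j. j \<in> {1..M'} \<Longrightarrow> k' j > 0" "\<And>j. j \<in> {1..M'} \<Longrightarrow> s' j \<ge> 0" "M' \<ge> 1"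
    and E: "\<And>x t. hier_E M k \<nu> s x0 \<omega> 0 0 x (of_real t) = hier_E M' k' \<nu>' s' x0' \<omega> 0 0 x (of_real t)"
  shows "gen_u M k \<nu> s x0 \<alpha> \<omega> = gen_u M' k' \<nu>' s' x0' \<alpha> \<omega>"
proof (intro ext)
  fix x t
  have "((\<lambda>x. hier_E M k \<nu> s x0 \<omega> 0 0 x (of_real t)) has_field_derivative
      hier_E M k \<nu> s x0 \<omega> 1 0 (of_real x) (of_real t)) (at (of_real x))"
    unfolding hier_E_def using expsum_deriv_x by fastforce
  moreover have "((\<lambda>x. hier_E M' k' \<nu>' s' x0' \<omega> 0 0 x (of_real t)) has_field_derivative
      hier_E M' k' \<nu>' s' x0' \<omega> 1 0 (of_real x) (of_real t)) (at (of_real x))"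
    unfolding hier_E_def using expsum_deriv_x by fastforce
  ultimately have "hier_E M k \<nu> s x0 \<omega> 1 0 (of_real x) (of_real t) = hier_E M' k' \<nu>' s' x0' \<omega> 1 0 (of_real x) (of_real t)"
    unfolding E by (rule DERIV_unique)
  then show "gen_u M k \<nu> s x0 \<alpha> \<omega> x t = gen_u M' k' \<nu>' s' x0' \<alpha> \<omega> x t"
    using gen_u_hier_E[where M=M and k=k and s=s, OF assms(1-3)] gen_u_hier_E[where M=M' and k=k' and s=s', OF assms(4-6)] E by simp
qed

section \<open>Annihilation at the origin\<close>

context
  fixes M :: nat and k :: "nat \<Rightarrow> nat" and \<nu> :: "nat \<Rightarrow> int" and s :: "nat \<Rightarrow> real" and \<omega> c :: real
    and x0 :: "nat \<Rightarrow> real"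
  assumes pd: "phase_data M k \<nu> s \<omega> c" and M: "M \<ge> 2" and s1: "s 1 = 0"
begin

text \<open>With \<open>s 1 = 0\<close> the first interval reaches from 0 to \<open>k 1\<close>;
  removing it translates all the others by \<open>k 1\<close>.\<close>

lemma shift_qq_pp:
  assumes "1 \<le> j"
  shows "qq (\<lambda>j. k (j+1)) (\<lambda>j. s (j+1)) j = qq k s (j+1) - real (k 1)"
    and "pp (\<lambda>j. k (j+1)) (\<lambda>j. s (j+1)) j = pp k s (j+1) - real (k 1)"
proof -
  show q: "qq (\<lambda>j. k (j+1)) (\<lambda>j. s (j+1)) j = qq k s (j+1) - real (k 1)"
    using assms
  proof (induction j rule: dec_induct)
    case base
    then show ?case using s1 by (simp add: numeral_2_eq_2)
  next
    case (step j)
    then show ?case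
      using qq_Suc[OF step(1), of "\<lambda>j. k (j+1)" "\<lambda>j. s (j+1)"] qq_Suc[of "Suc j" k s] by simp
  qed
  show "pp (\<lambda>j. k (j+1)) (\<lambda>j. s (j+1)) j = pp k s (j+1) - real (k 1)"
    using q by simp
qed

text \<open>The translation lowers \<open>pp + qq\<close> by \<open>2 * k 1\<close>, which the new
  constant restores. As N drops by \<open>k 1\<close>, the mean value 2 N + c stays the
  same.\<close>

lemma shift_phase_data: "phase_data (M - 1) (\<lambda>j. k (j+1)) (\<lambda>j. \<nu> (j+1)) (\<lambda>j. s (j+1)) \<omega> (c + 2 * real (k 1))"
proof -
  have "\<omega> * of_int (\<nu> (j+1)) = real (k (j+1)) * (pp (\<lambda>j. k (j+1)) (\<lambda>j. s (j+1)) j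
       + qq (\<lambda>j. k (j+1)) (\<lambda>j. s (j+1)) j + (c + 2 * real (k 1)))"
    if "j \<in> {1..M - 1}" for j
  proof -
    have "1 \<le> j" "j + 1 \<in> {1..M}" using that by auto
    then show ?thesis unfolding shift_qq_pp[OF \<open>1 \<le> j\<close>] phase_dataD(5)[OF pd \<open>j + 1 \<in> {1..M}\<close>]
      by (simp add: algebra_simps del: pp.simps)
  qed
  then show ?thesis unfolding phase_data_def using phase_dataD(2-4)[OF pd] M by auto
qed

lemma shift_bij: "{1..M} = insert 1 (Suc ` {1..M - 1})" "1 \<notin> Suc ` {1..M - 1}"
proof -
  have "Suc ` {1..M - 1} = {2..M}"
    using M by (simp add: image_Suc_atLeastAtMost numeral_2_eq_2)
  then show "{1..M} = insert 1 (Suc ` {1..M - 1})" using M by auto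
qed auto

lemma shift_bigN: "bigN M k = k 1 + bigN (M - 1) (\<lambda>j. k (j+1))"
proof -
  have "bigN M k = k 1 + (\<Sum>j\<in>Suc ` {1..M - 1}. k j)"
    unfolding bigN_def by (subst shift_bij(1), rule sum.insert) (use shift_bij(2) in auto)
  also have "(\<Sum>j\<in>Suc ` {1..M - 1}. k j) = (\<Sum>j\<in>{1..M - 1}. k (j + 1))"
    by (subst sum.reindex) auto
  finally show ?thesis by (simp only: bigN_def)
qed

text \<open>\<open>bb k s x0 1 = 0\<close> leaves only the sets \<open>S\<close> that contain 1. The
  surviving coupling with site 1 turns the square root of q/p in \<open>bb\<close> into that of (q -
  k_1)/(p - k_1), the value for the translated endpoints.\<close>

lemma shift_bo_P:
  assumes lam: "lam \<noteq> 0"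
  shows "bo_P M k \<nu> s x0 z lam =
    z ^ k 1 * bo_P (M-1) (\<lambda>j. k (j+1)) (\<lambda>j. \<nu> (j+1)) (\<lambda>j. s (j+1)) (\<lambda>j. x0 (j+1)) z lam"
proof -
  define y where "y = (\<lambda>m. bb k s x0 m * lam powi \<nu> m)"
  define V where "V = Suc ` {1..M - 1}"
  have y1: "y 1 = 0" using s1 by (simp add: y_def bb_def)
  have V: "finite V" "1 \<notin> V" "insert 1 V = {1..M}" using shift_bij by (auto simp: V_def)
  have "bo_P M k \<nu> s x0 z lam = LY (insert 1 V) (aa k s) y (\<lambda>j. z ^ k j)"
    unfolding bo_P_LY[OF lam] y_def V(3) ..
  also have "\<dots> = z ^ k 1 * LY V (aa k s) (\<lambda>m. of_real (aa k s 1 m) * y m) (\<lambda>j. z ^ k j)"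
    unfolding LY_insert[OF V(1,2)] y1 by simp
  also have "LY V (aa k s) (\<lambda>m. of_real (aa k s 1 m) * y m) (\<lambda>j. z ^ k j) =
     LY {1..M - 1} (\<lambda>j m. aa k s (Suc j) (Suc m)) (\<lambda>m. of_real (aa k s 1 (Suc m)) * y (Suc m)) (\<lambda>j. z ^ k (Suc j))"
    unfolding V_def by (rule LY_reindex) simp
  also have "\<dots> = LY {1..M - 1} (aa (\<lambda>j. k (j+1)) (\<lambda>j. s (j+1)))
     (\<lambda>m. bb (\<lambda>j. k (j+1)) (\<lambda>j. s (j+1)) (\<lambda>j. x0 (j+1)) m * lam powi \<nu> (m+1)) (\<lambda>j. z ^ k (j+1))"
  proof (rule LY_cong)
    fix j m assume jm: "j \<in> {1..M - 1}" "m \<in> {1..M - 1}"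
    show "aa k s (Suc j) (Suc m) = aa (\<lambda>j. k (j+1)) (\<lambda>j. s (j+1)) j m"
    proof -
      have "1 \<le> j" "1 \<le> m" using jm by auto
      then show ?thesis unfolding aa_def shift_qq_pp[OF \<open>1 \<le> j\<close>] shift_qq_pp[OF \<open>1 \<le> m\<close>]
        by (simp del: pp.simps qq.simps)
    qed
  next
    fix m assume m: "m \<in> {1..M - 1}"
    then have m1: "1 \<le> m" "Suc m \<in> {1..M}" "Suc m \<le> M" by auto
    have q1: "qq k s 1 = 0" "pp k s 1 = real (k 1)" using s1 by simp_all
    have "0 < pp k s 1" using phase_data_pp_pos[OF pd, of 1] M by simp
    moreover have "pp k s 1 \<le> qq k s (Suc m)" using phase_data_pp_le_qq[OF pd, of 1 "Suc m"] m1 by simp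
    moreover have "0 < pp k s (Suc m)" using phase_data_pp_pos[OF pd m1(2)] .
    ultimately have nz: "qq k s (Suc m) \<noteq> 0" "pp k s (Suc m) \<noteq> 0" by linarith+
    have "(B * (C - K)) / (C * (B - K)) * (C / B) = (C - K) / (B - K)" if "B \<noteq> 0" "C \<noteq> 0" for B C K :: real
      using that by (cases "B = K") (simp_all add: field_simps)
    from this[OF nz(2,1)] have "aa k s 1 (Suc m) * sqrt (qq k s (Suc m) / pp k s (Suc m)) =
        sqrt ((qq k s (Suc m) - real (k 1)) / (pp k s (Suc m) - real (k 1)))"
      unfolding aa_def real_sqrt_mult[symmetric] q1 by (simp del: pp.simps qq.simps)
    then have "of_real (aa k s 1 (Suc m)) * bb k s x0 (Suc m) = bb (\<lambda>j. k (j+1)) (\<lambda>j. s (j+1)) (\<lambda>j. x0 (j+1)) m"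
      unfolding bb_def shift_qq_pp[OF m1(1)] by (simp del: pp.simps qq.simps add: mult.assoc[symmetric] flip: of_real_mult)
    then show "of_real (aa k s 1 (Suc m)) * y (Suc m) =
      bb (\<lambda>j. k (j+1)) (\<lambda>j. s (j+1)) (\<lambda>j. x0 (j+1)) m * lam powi \<nu> (m+1)"
      by (simp add: y_def mult.assoc[symmetric])
  qed simp
  also have "\<dots> = bo_P (M-1) (\<lambda>j. k (j+1)) (\<lambda>j. \<nu> (j+1)) (\<lambda>j. s (j+1)) (\<lambda>j. x0 (j+1)) z lam"
    unfolding bo_P_LY[OF lam] ..
  finally show ?thesis .
qed

lemma shift_gen_u:
  "gen_u M k \<nu> s x0 \<alpha> \<omega> = gen_u (M-1) (\<lambda>j. k (j+1)) (\<lambda>j. \<nu> (j+1)) (\<lambda>j. s (j+1)) (\<lambda>j. x0 (j+1)) \<alpha> \<omega>"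
proof (rule gen_u_cong_hier_E)
  fix x t
  have "exp (\<i> * (of_nat (bigN M k) * x)) * exp (- (\<i> * x)) ^ k 1 = exp (\<i> * (of_nat (bigN (M - 1) (\<lambda>j. k (j+1))) * x))"
    unfolding shift_bigN exp_of_nat_mult[symmetric] exp_add[symmetric] by (simp add: algebra_simps)
  then show "hier_E M k \<nu> s x0 \<omega> 0 0 x (complex_of_real t) =
      hier_E (M-1) (\<lambda>j. k (j+1)) (\<lambda>j. \<nu> (j+1)) (\<lambda>j. s (j+1)) (\<lambda>j. x0 (j+1)) \<omega> 0 0 x (of_real t)"
    unfolding hier_E_bo_P by (subst shift_bo_P) (simp_all add: mult.assoc[symmetric])
qed (use phase_dataD(3,4)[OF pd] M in auto)

end

lemma gen_u_cong_bo_P: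
  assumes "\<And>z lam. lam \<noteq> 0 \<Longrightarrow> bo_P M k \<nu> s x0 z lam = bo_P M' k' \<nu>' s' x0' z lam" "bigN M' k' = bigN M k"
  shows "gen_u M k \<nu> s x0 \<alpha> \<omega> = gen_u M' k' \<nu>' s' x0' \<alpha> \<omega>"
  unfolding gen_u_def by (subst assms(1)) (simp_all add: assms(2))

text \<open>A merge at \<open>d\<close> leaves \<open>s j\<close> unchanged for
  \<open>j < d\<close>. In decreasing order the remaining indices therefore stay in range and still
  have \<open>s j = 0\<close>, with no renumbering.\<close>

lemma fold_merge_step:
  assumes "phase_data M k \<nu> s \<omega> c" "sorted_wrt (>) ds" "set ds \<subseteq> {j\<in>{2..M}. s j = 0}"
    "fold merge_step ds (M, k, \<nu>, s, x0) = (M', k', \<nu>', s', x0')"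
  shows "phase_data M' k' \<nu>' s' \<omega> c \<and> bigN M' k' = bigN M k \<and>
    (\<forall>z lam. lam \<noteq> 0 \<longrightarrow> bo_P M k \<nu> s x0 z lam = bo_P M' k' \<nu>' s' x0' z lam)"
  using assms
proof (induction ds arbitrary: M k \<nu> s x0)
  case (Cons d ds)
  have d: "d \<in> {2..M}" "s d = 0" using Cons.prems by auto
  have "set ds \<subseteq> {j\<in>{2..M - 1}. merge_s d s j = 0}"
  proof
    fix j assume j: "j \<in> set ds"
    then have jd: "j < d" "j \<in> {2..M}" "s j = 0" using Cons.prems by auto
    then have "merge_s d s j = s j" by (auto simp: merge_s_def)
    then show "j \<in> {j\<in>{2..M - 1}. merge_s d s j = 0}" using jd d by auto
  qed
  moreover have "fold merge_step ds (M - 1, merge_k d k, merge_nu d \<nu>, merge_s d s, merge_x d k x0) = (M', k', \<nu>', s', x0')"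
  proof -
    have "merge_step d (M, k, \<nu>, s, x0) = (M - 1, merge_k d k, merge_nu d \<nu>, merge_s d s, merge_x d k x0)"
      by (simp add: merge_step_def)
    then show ?thesis using Cons.prems(4) by (simp only: fold_simps)
  qed
  ultimately have "phase_data M' k' \<nu>' s' \<omega> c \<and> bigN M' k' = bigN (M - 1) (merge_k d k) \<and>
    (\<forall>z lam. lam \<noteq> 0 \<longrightarrow> bo_P (M - 1) (merge_k d k) (merge_nu d \<nu>) (merge_s d s) (merge_x d k x0) z lam
       = bo_P M' k' \<nu>' s' x0' z lam)"
    using Cons.prems(2) by (intro Cons.IH merge_phase_data[OF Cons.prems(1) d]) auto
  then show ?case using merge_bigN[OF Cons.prems(1) d] merge_bo_P[OF Cons.prems(1) d] by metis
qed simp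

text \<open>Only terms with nonzero coefficient need the common ratio of frequency to wave number;
  this is how vanishing parameters produce a travelling wave.\<close>

lemma expsum_travelling:
  assumes "\<And>A. A \<in> \<A> \<Longrightarrow> c A \<noteq> 0 \<Longrightarrow> \<omega> A = v * \<kappa> A"
  shows "expsum \<A> c \<kappa> \<omega> i 0 (of_real x) (of_real t) = expsum \<A> c \<kappa> \<omega> i 0 (of_real (x - v * t)) 0"
  unfolding expsum_def
proof (rule sum.cong[OF refl])
  fix A assume "A \<in> \<A>"
  then show "c A * (\<i> * of_real (\<kappa> A)) ^ i * (- \<i> * of_real (\<omega> A)) ^ 0 *
        exp (\<i> * (of_real (\<kappa> A) * of_real x - of_real (\<omega> A) * of_real t)) =
     c A * (\<i> * of_real (\<kappa> A)) ^ i * (- \<i> * of_real (\<omega> A)) ^ 0 *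
        exp (\<i> * (of_real (\<kappa> A) * of_real (x - v * t) - of_real (\<omega> A) * 0))"
    using assms[of A] by (cases "c A = 0") (simp_all add: algebra_simps)
qed

lemma Pow_12: "Pow {1..2::nat} = {{}, {1}, {2}, {1,2}}"
proof -
  have "{1..2::nat} = {1,2}" by auto
  then show ?thesis by (auto simp: Pow_insert)
qed

context
  fixes k :: "nat \<Rightarrow> nat" and \<nu> :: "nat \<Rightarrow> int" and s :: "nat \<Rightarrow> real" and \<omega> c :: real and x0 :: "nat \<Rightarrow> real"
  assumes pd: "phase_data 2 k \<nu> s \<omega> c"
begin

text \<open>\<open>s 1 = 0\<close> makes \<open>bb\<close> vanish at 1, and \<open>s 2 = 0\<close>
  makes the coupling of 1 and 2 vanish. Here \<open>A\<close> is the complement of the set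
  \<open>S\<close> in \<open>bo_P\<close>.\<close>

lemma hier_coeffs_12:
  defines "C \<equiv> \<lambda>A. mixed_prod (aa k s) ({1..2} - A) A * (\<Prod>m\<in>A. bb k s x0 m)"
  shows "s 1 = 0 \<Longrightarrow> C {1} = 0" "s 1 = 0 \<Longrightarrow> C {1,2} = 0" "s 2 = 0 \<Longrightarrow> C {1} = 0" "s 2 = 0 \<Longrightarrow> C {2} = 0"
proof -
  have d: "{1..2::nat} - {1} = {2}" "{1..2::nat} - {2} = {1}" by auto
  have b: "bb k s x0 1 = 0" if "s 1 = 0" using that by (simp add: bb_def)
  have a: "aa k s 1 2 = 0" if "s 2 = 0" using that by (simp add: aa_def numeral_2_eq_2)
  then have a': "aa k s 2 1 = 0" if "s 2 = 0" using that aa_commute by metis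
  show "s 1 = 0 \<Longrightarrow> C {1} = 0" "s 1 = 0 \<Longrightarrow> C {1,2} = 0" using b by (simp_all add: C_def)
  show "s 2 = 0 \<Longrightarrow> C {1} = 0" "s 2 = 0 \<Longrightarrow> C {2} = 0" unfolding C_def d mixed_prod_def using a a' by simp_all
qed

lemma gen_u_12_travelling:
  assumes "s 1 = 0 \<or> s 2 = 0"
  shows "\<exists>v f. \<forall>x t. gen_u 2 k \<nu> s x0 \<alpha> \<omega> x t = f (x - v * t)"
proof -
  have k: "k 1 > 0" "k 2 > 0" using phase_dataD(3)[OF pd] by auto
  \<comment> \<open>At most one nonempty \<open>A\<close> survives: \<open>{1,2}\<close> if
    \<open>s 2 = 0\<close>, otherwise \<open>{2}\<close>. The speed is its frequency divided by its
    wave number.\<close>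
  define v where "v = (if s 2 = 0 then \<omega> * (real_of_int (\<nu> 1) + of_int (\<nu> 2)) / (real (k 1) + real (k 2))
      else \<omega> * of_int (\<nu> 2) / real (k 2))"
  have "hier_E 2 k \<nu> s x0 \<omega> i 0 (of_real x) (of_real t) = hier_E 2 k \<nu> s x0 \<omega> i 0 (of_real (x - v * t)) 0" for i x t
    unfolding hier_E_def
  proof (rule expsum_travelling)
    fix A assume A: "A \<in> Pow {1..2::nat}"
      and nz: "mixed_prod (aa k s) ({1..2} - A) A * (\<Prod>m\<in>A. bb k s x0 m) \<noteq> 0"
    have "A = {} \<or> (A = {2} \<and> s 2 \<noteq> 0) \<or> (A = {1,2} \<and> s 2 = 0)"
      using A nz assms hier_coeffs_12 unfolding Pow_12 by auto
    then show "\<omega> * (\<Sum>m\<in>A. real_of_int (\<nu> m)) = v * (\<Sum>m\<in>A. real (k m))"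
      using k by (auto simp: v_def)
  qed
  moreover define f where "f = (\<lambda>y. \<alpha> - 4 * Im (hier_E 2 k \<nu> s x0 \<omega> 1 0 (of_real y) 0 /
       hier_E 2 k \<nu> s x0 \<omega> 0 0 (of_real y) 0))"
  ultimately have "gen_u 2 k \<nu> s x0 \<alpha> \<omega> x t = f (x - v * t)" for x t
    using gen_u_hier_E[where M=2 and k=k and s=s, OF phase_dataD(3,4,1)[OF pd]] by simp
  then show ?thesis by blast
qed

lemma gen_u_12_constant:
  assumes "s 1 = 0" "s 2 = 0"
  shows "gen_u 2 k \<nu> s x0 \<alpha> \<omega> x t = \<alpha>"
proof -
  have "hier_E 2 k \<nu> s x0 \<omega> 1 0 (of_real x) (of_real t) = 0"
    unfolding hier_E_def expsum_def
  proof (rule sum.neutral, rule ballI)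
    fix A assume A: "A \<in> Pow {1..2::nat}"
    have "A = {} \<or> mixed_prod (aa k s) ({1..2} - A) A * (\<Prod>m\<in>A. bb k s x0 m) = 0"
      using A assms hier_coeffs_12 unfolding Pow_12 by auto
    then show "mixed_prod (aa k s) ({1..2} - A) A * (\<Prod>m\<in>A. bb k s x0 m) *
      (\<i> * of_real (\<Sum>m\<in>A. real (k m))) ^ 1 * (- \<i> * of_real (\<omega> * (\<Sum>m\<in>A. real_of_int (\<nu> m)))) ^ 0 *
      exp (\<i> * (of_real (\<Sum>m\<in>A. real (k m)) * of_real x - of_real (\<omega> * (\<Sum>m\<in>A. real_of_int (\<nu> m))) * of_real t)) = 0"
      by (elim disjE) (simp, simp only: mult_zero_left)
  qed
  then show ?thesis
    using gen_u_hier_E[where M=2 and k=k and s=s, OF phase_dataD(3,4,1)[OF pd]] by simp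
qed

end

section \<open>The two-phase case\<close>

lemma bigN_2: "bigN 2 k = k 1 + k 2"
  by (simp add: bigN_def numeral_2_eq_2)

context
  fixes k :: "nat \<Rightarrow> nat" and \<nu> :: "nat \<Rightarrow> int" and s :: "nat \<Rightarrow> real" and \<omega> c :: real
    and x0 :: "nat \<Rightarrow> real"
  assumes pd: "phase_data 2 k \<nu> s \<omega> c"
begin

lemma k_pos_12: "k 1 > 0" "k 2 > 0"
  using phase_dataD(3)[OF pd] by auto

lemma m2_eq_mj: "m2 (k 1 + k 2) (k 2) (\<nu> 1 + \<nu> 2) (\<nu> 2) = mj k \<nu> 2"
  by (simp add: m2_def mj_def algebra_simps)

lemma mj_pos_12: "mj k \<nu> 2 > 0" "\<omega> * mj k \<nu> 2 = real (k 1) * real (k 2) * (real (k 1) + real (k 2) + 2 * s 2)"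
proof -
  have 2: "(2::nat) \<in> {2..2}" by simp
  show m: "mj k \<nu> 2 > 0" by (rule phase_data_tau(1)[OF pd 2])
  show "\<omega> * mj k \<nu> 2 = real (k 1) * real (k 2) * (real (k 1) + real (k 2) + 2 * s 2)"
    using omega_mj_iff[of k \<nu> 2 s \<omega>] m phase_data_tau(2)[OF pd 2] by (simp add: algebra_simps)
qed

lemma omega2_eq: "omega2 (k 1 + k 2) (k 2) (\<nu> 1 + \<nu> 2) (\<nu> 2) (s 2) = \<omega>"
  unfolding omega2_def m2_eq_mj using mj_pos_12 by (simp add: field_simps)

lemma alpha2_eq: "alpha2 (k 1 + k 2) (k 2) (\<nu> 1 + \<nu> 2) (\<nu> 2) (s 1) (s 2) = 2 * real (bigN 2 k) + c"
proof -
  define m where "m = mj k \<nu> 2"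
  define K1 K2 n1 n2 where "K1 = real (k 1)" and "K2 = real (k 2)" and "n1 = real_of_int (\<nu> 1)" and "n2 = real_of_int (\<nu> 2)"
  have m: "m = K1 * n2 - K2 * n1" by (simp add: m_def mj_def K1_def K2_def n1_def n2_def)
  have m0: "m > 0" using mj_pos_12 by (simp add: m_def)
  have w: "\<omega> * m = K1 * K2 * (K1 + K2 + 2 * s 2)" using mj_pos_12 by (simp add: m_def K1_def K2_def)
  have K1: "K1 > 0" using k_pos_12 by (simp add: K1_def)
  have c: "\<omega> * n1 = K1 * (2 * s 1 + K1 + c)" using phase_dataD(5)[OF pd, of 1] by (simp add: K1_def n1_def)
  have "K1 * ((2 * s 1 + K1 + c) * m) = \<omega> * m * n1" using c by (simp add: mult_ac)
  also have "\<dots> = K1 * (K2 * (K1 + K2 + 2 * s 2) * n1)" unfolding w by (simp add: mult_ac)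
  \<comment> \<open>The frequency has been eliminated between the relation at \<open>j = 1\<close>
    and the equation for \<open>\<omega> * m\<close>.\<close>
  finally have cm: "(2 * s 1 + K1 + c) * m = K2 * (K1 + K2 + 2 * s 2) * n1" using K1 by simp
  have "alpha2 (k 1 + k 2) (k 2) (\<nu> 1 + \<nu> 2) (\<nu> 2) (s 1) (s 2) * m =
     (K1 + K2)\<^sup>2 * n2 - K2\<^sup>2 * (n1 + n2) - 2 * s 1 * m + 2 * K2 * n1 * s 2"
    unfolding alpha2_def m2_eq_mj m_def[symmetric] using m0
    by (simp add: K1_def K2_def n1_def n2_def field_simps)
  also have "\<dots> = (2 * (K1 + K2) + c) * m"
    using cm unfolding m by (simp add: algebra_simps power2_eq_square)
  finally show ?thesis using m0 by (simp add: bigN_2 K1_def K2_def)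
qed

text \<open>The shift by \<open>x0'\<close> rotates \<open>z\<close>, and the shift by
  \<open>t0\<close> is absorbed since
  \<open>k m * x0 m = k m * x0' - \<nu> m * \<omega> * t0\<close>. Of the four terms,
  \<open>A2\<close>, \<open>B2\<close> and \<open>C2\<close> are the coupling times the modulus of
  the second \<open>bb\<close>, the coupling times that of the first, and the product of the two
  moduli.\<close>

lemma Q2_bo_P:
  assumes x1: "x0 1 = x0' - real_of_int (\<nu> 1) / real (k 1) * \<omega> * t0"
    and x2: "x0 2 = x0' - real_of_int (\<nu> 2) / real (k 2) * \<omega> * t0"
  shows "Q2 (k 1 + k 2) (k 2) (\<nu> 1 + \<nu> 2) (\<nu> 2) (s 1) (s 2) (t - t0) z =
    cis (real (k 1 + k 2) * x0') * bo_P 2 k \<nu> s x0 (z * cis (- x0')) (cis (- (\<omega> * t)))"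
proof -
  define \<theta> where "\<theta> = (\<lambda>m. cis (- (real_of_int (\<nu> m) * \<omega> * (t - t0))))"
  define r where "r = (\<lambda>m. complex_of_real (sqrt (qq k s m / pp k s m)))"
  define d where "d = (\<lambda>m. cis (- (real (k m) * x0')))"
  have I: "{1..2} = insert 1 (insert 2 ({}::nat set))" by auto
  have ph: "cis (- (real (k m) * x0 m)) * cis (- (\<omega> * t)) powi \<nu> m = d m * \<theta> m" if "m \<in> {1..2}" for m
  proof -
    consider "m = 1" | "m = 2" using \<open>m \<in> {1..2}\<close> by force
    then have kx: "real (k m) * x0 m = real (k m) * x0' - real_of_int (\<nu> m) * \<omega> * t0"
      using x1 x2 k_pos_12 by cases (simp_all add: field_simps)
    show ?thesis unfolding cis_power_int d_def \<theta>_def cis_mult kx by (simp add: algebra_simps)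
  qed
  have "bo_P 2 k \<nu> s x0 (z * cis (- x0')) (cis (- (\<omega> * t))) =
     LY {1..2} (aa k s) (\<lambda>m. d m * (r m * \<theta> m)) (\<lambda>j. d j * z ^ k j)"
    unfolding bo_P_LY[OF cis_neq_zero]
  proof (rule LY_cong)
    fix m assume m: "m \<in> {1..2::nat}"
    show "bb k s x0 m * cis (- (\<omega> * t)) powi \<nu> m = d m * (r m * \<theta> m)"
      using ph[OF m] by (simp add: bb_def r_def mult_ac)
    show "(z * cis (- x0')) ^ k m = d m * z ^ k m"
      by (simp add: d_def power_mult_distrib Complex.DeMoivre mult_ac)
  qed simp
  also have "\<dots> = (\<Prod>m\<in>{1..2}. d m) * LY {1..2} (aa k s) (\<lambda>m. r m * \<theta> m) (\<lambda>j. z ^ k j)"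
    by (rule LY_scale) simp
  also have "(\<Prod>m\<in>{1..2}. d m) = cis (- (real (k 1 + k 2) * x0'))"
    unfolding I by (simp add: d_def cis_mult algebra_simps)
  also have "LY {1..2} (aa k s) (\<lambda>m. r m * \<theta> m) (\<lambda>j. z ^ k j) =
      (r 1 * \<theta> 1) * (r 2 * \<theta> 2 + aa k s 1 2 * z ^ k 2) + z ^ k 1 * (aa k s 1 2 * (r 2 * \<theta> 2) + z ^ k 2)"
    unfolding I by (subst LY_insert | simp; fail)+ (simp add: LY_insert aa_commute[of k s 2] algebra_simps)
  finally have P: "cis (real (k 1 + k 2) * x0') * bo_P 2 k \<nu> s x0 (z * cis (- x0')) (cis (- (\<omega> * t))) =
      (r 1 * \<theta> 1) * (r 2 * \<theta> 2 + aa k s 1 2 * z ^ k 2) + z ^ k 1 * (aa k s 1 2 * (r 2 * \<theta> 2) + z ^ k 2)"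
    by (simp add: mult.assoc[symmetric] cis_mult)
  have pq: "qq k s 1 = s 1" "pp k s 1 = s 1 + real (k 1)" "qq k s 2 = s 1 + real (k 1) + s 2"
    "pp k s 2 = s 1 + real (k 1) + s 2 + real (k 2)"
    by (simp_all add: numeral_2_eq_2)
  have r1: "r 1 = of_real (sqrt (s 1 / (real (k 1 + k 2) - real (k 2) + s 1)))"
    unfolding r_def pq by (simp add: add_ac)
  have r2: "r 2 = of_real (sqrt ((real (k 1 + k 2) - real (k 2) + s 1 + s 2) / (real (k 1 + k 2) + s 1 + s 2)))"
    unfolding r_def pq by (simp add: add_ac)
  have a: "aa k s 1 2 = sqrt ((real (k 1 + k 2) + s 2) * s 2 /
      (real (k 2) * (real (k 1 + k 2) - real (k 2)) + (real (k 1 + k 2) + s 2) * s 2))"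
    unfolding aa_def pq by (rule arg_cong[of _ _ sqrt], rule arg_cong2[of _ _ _ _ "(/)"]) (simp_all add: algebra_simps)
  have t12: "\<theta> 1 * \<theta> 2 = cis (- (real_of_int (\<nu> 1 + \<nu> 2) * \<omega> * (t - t0)))"
    by (simp add: \<theta>_def cis_mult algebra_simps)
  have t1: "cis (- (real_of_int (\<nu> 1 + \<nu> 2 - \<nu> 2) * \<omega> * (t - t0))) = \<theta> 1" by (simp add: \<theta>_def)
  have t2: "cis (- (real_of_int (\<nu> 2) * \<omega> * (t - t0))) = \<theta> 2" by (simp add: \<theta>_def)
  show ?thesis
    unfolding Q2_def Let_def omega2_eq P t12[symmetric] t1 t2 A2_def B2_def C2_def of_real_mult
      r1[symmetric] r2[symmetric] a[symmetric]
    by (simp add: power_add algebra_simps)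
qed

text \<open>The roots of \<open>Q2\<close> are those of \<open>bo_P\<close> multiplied by
  \<open>cis x0'\<close>, and this rotation compensates the argument \<open>x - x0'\<close>. In
  terms of E it is the translation of \<open>hier_E\<close> by \<open>x0'\<close>, so the two root
  lists need not be matched.\<close>

lemma gen_u_eq_u2:
  assumes x: "x0 1 = x0' - real_of_int (\<nu> 1) / real (k 1) * \<omega> * t0"
    "x0 2 = x0' - real_of_int (\<nu> 2) / real (k 2) * \<omega> * t0"
  shows "gen_u 2 k \<nu> s x0 (2 * real (bigN 2 k) + c) \<omega> =
    u2 (k 1 + k 2) (k 2) (\<nu> 1 + \<nu> 2) (\<nu> 2) (s 1) (s 2) x0' t0"
proof (intro ext)
  fix x t
  define f where "f = Q2 (k 1 + k 2) (k 2) (\<nu> 1 + \<nu> 2) (\<nu> 2) (s 1) (s 2) (t - t0)"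
  define N where "N = k 1 + k 2"
  define P where "P = (\<lambda>z. bo_P 2 k \<nu> s x0 z (cis (- (\<omega> * t))))"
  have f: "f z = cis (real N * x0') * P (z * cis (- x0'))" for z
    unfolding f_def N_def P_def by (rule Q2_bo_P[OF x])
  have "\<exists>bs. length bs = bigN 2 k \<and> (\<forall>z. P z = (\<Prod>b\<leftarrow>bs. z - b))"
    unfolding P_def using bo_P_factorization[where M=2 and k=k and s=s] phase_dataD(1,3,4)[OF pd] by blast
  then obtain bs where bs: "length bs = N" "\<And>z. P z = (\<Prod>b\<leftarrow>bs. z - b)" unfolding N_def bigN_2 by blast
  have "f z = (\<Prod>b\<leftarrow>map (\<lambda>b. b * cis x0') bs. z - b)" for z
  proof -
    have "cis (real (length bs) * x0') * (\<Prod>b\<leftarrow>bs. z * cis (- x0') - b) = (\<Prod>b\<leftarrow>bs. z - b * cis x0')"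
    proof (induction bs)
      case (Cons b bs)
      have "cis (real (length (b # bs)) * x0') = cis x0' * cis (real (length bs) * x0')"
        by (simp add: cis_mult algebra_simps)
      moreover have "cis x0' * (z * cis (- x0') - b) = z - b * cis x0'"
      proof -
        have "cis x0' * cis (- x0') = 1" by (simp add: cis_mult)
        then show ?thesis by (simp add: algebra_simps)
      qed
      ultimately show ?case using Cons by (simp add: mult_ac)
    qed simp
    then show ?thesis unfolding f bs(2) bs(1)[symmetric] by (simp add: o_def)
  qed
  then have ex: "\<exists>bs. length bs = N \<and> (\<forall>z. f z = (\<Prod>b\<leftarrow>bs. z - b))"
    using bs(1) by (intro exI[of _ "map (\<lambda>b. b * cis x0') bs"]) simp
  have nz: "f z \<noteq> 0" if "1 \<le> cmod z" for z
  proof -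
    have "1 \<le> cmod (z * cis (- x0'))" using that by (simp add: norm_mult)
    then have "P (z * cis (- x0')) \<noteq> 0"
      unfolding P_def using bo_P_nonzero[where M=2 and k=k and s=s] phase_dataD(3,4)[OF pd] by simp
    then show ?thesis by (simp add: f)
  qed
  define E where "E = (\<lambda>y. hier_E 2 k \<nu> s x0 \<omega> 0 0 (y + of_real x0') (of_real t))"
  have E: "E y = exp (\<i> * (of_nat N * y)) * f (exp (- (\<i> * y)))" for y
  proof -
    have "exp (\<i> * (of_nat N * (y + of_real x0'))) = exp (\<i> * (of_nat N * y)) * cis (real N * x0')"
      by (simp add: cis_conv_exp algebra_simps flip: exp_add)
    moreover have "exp (- (\<i> * (y + of_real x0'))) = exp (- (\<i> * y)) * cis (- x0')"
      by (simp add: cis_conv_exp algebra_simps flip: exp_add)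
    ultimately show ?thesis unfolding E_def hier_E_bo_P f P_def bigN_2 N_def[symmetric] by (simp add: mult_ac)
  qed
  have E': "(E has_field_derivative hier_E 2 k \<nu> s x0 \<omega> 1 0 (of_real x) (of_real t)) (at (of_real (x - x0')))"
  proof -
    have D: "((\<lambda>y. hier_E 2 k \<nu> s x0 \<omega> 0 0 y (of_real t)) has_field_derivative
        hier_E 2 k \<nu> s x0 \<omega> 1 0 (of_real x) (of_real t)) (at (of_real (x - x0') + of_real x0'))"
      unfolding hier_E_def using expsum_deriv_x[where x = "of_real x"] by simp
    show ?thesis unfolding E_def by (rule DERIV_shift[THEN iffD1, OF D])
  qed
  have "(\<Sum>b\<leftarrow>root_list f N. ubeta b (x - x0')) =
     - 4 * Im (hier_E 2 k \<nu> s x0 \<omega> 1 0 (of_real x) (of_real t) / E (of_real (x - x0')))"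
    by (rule sum_ubeta_root_list(1)[OF ex nz E E'])
  also have "E (of_real (x - x0')) = hier_E 2 k \<nu> s x0 \<omega> 0 0 (of_real x) (of_real t)"
    by (simp add: E_def)
  finally show "gen_u 2 k \<nu> s x0 (2 * real (bigN 2 k) + c) \<omega> x t =
      u2 (k 1 + k 2) (k 2) (\<nu> 1 + \<nu> 2) (\<nu> 2) (s 1) (s 2) x0' t0 x t"
    unfolding u2_def alpha2_eq unfolding f_def[symmetric] unfolding N_def[symmetric]
    using gen_u_hier_E[where M=2 and k=k and s=s, OF phase_dataD(3,4,1)[OF pd]] by simp
qed

end

lemma gen_u_period:
  assumes "\<omega> \<noteq> 0"
  shows "gen_u M k \<nu> s x0 \<alpha> \<omega> x (t + 2 * pi / \<omega>) = gen_u M k \<nu> s x0 \<alpha> \<omega> x t"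
proof -
  have "\<omega> * (t + 2 * pi / \<omega>) = \<omega> * t + 2 * pi" using assms by (simp add: field_simps)
  then have "cis (\<omega> * (t + 2 * pi / \<omega>)) = cis (\<omega> * t)" by (simp add: complex_eq_iff)
  then have "cis (- (\<omega> * (t + 2 * pi / \<omega>))) = cis (- (\<omega> * t))" unfolding cis_cnj[symmetric] by (rule arg_cong)
  then show ?thesis by (simp add: gen_u_def)
qed

theorem theorem2:
  fixes M :: nat and k :: "nat \<Rightarrow> nat" and \<nu> :: "nat \<Rightarrow> int" and J :: nat
    and s1 sJ :: real and x0 :: "nat \<Rightarrow> real"
  assumes M2: "M \<ge> 2"
    and kpos: "\<forall>j\<in>{1..M}. k j > 0"
    and nu: "\<forall>j\<in>{2..M}. real_of_int (\<nu> (j-1)) < real (k (j-1)) / real (k j) * real_of_int (\<nu> j)"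
    and J: "J \<in> {2..M}" and Jmax: "\<forall>j\<in>{2..M}. tau k \<nu> j \<le> tau k \<nu> J"
    and s1: "s1 \<ge> 0" and sJ: "sJ \<ge> 0"
  defines "s \<equiv> s_of k \<nu> J s1 sJ"
    and "\<omega> \<equiv> omegaJ k \<nu> J (s_of k \<nu> J s1 sJ)"
    and "T \<equiv> 2 * pi / omegaJ k \<nu> J (s_of k \<nu> J s1 sJ)"
    and "u \<equiv> hier_u M k \<nu> J (s_of k \<nu> J s1 sJ) x0"
  shows
    "(\<forall>j\<in>{1..M}. s j \<ge> 0) \<and> 0 \<le> qq k s 1 \<and> (\<forall>j\<in>{1..M}. qq k s j < pp k s j)
       \<and> (\<forall>j\<in>{1..<M}. pp k s j \<le> qq k s (j+1))
     \<and> (\<forall>t. \<forall>b\<in>set (root_list (\<lambda>z. bo_P M k \<nu> s x0 z (cis (- (\<omega> * t)))) (bigN M k)). cmod b < 1)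
     \<and> bo_solution u
     \<and> (\<forall>x t. u x (t + T) = u x t)
     \<and> (M = 2 \<longrightarrow>
          (\<forall>x0' t0. x0 1 = x0' - real_of_int (\<nu> 1) / real (k 1) * \<omega> * t0
                  \<and> x0 2 = x0' - real_of_int (\<nu> 2) / real (k 2) * \<omega> * t0 \<longrightarrow>
               u = u2 (k 1 + k 2) (k 2) (\<nu> 1 + \<nu> 2) (\<nu> 2) (s 1) (s 2) x0' t0)
          \<and> (s 1 = 0 \<or> s 2 = 0 \<longrightarrow> (\<exists>c f. \<forall>x t. u x t = f (x - c * t)))
          \<and> (s 1 = 0 \<and> s 2 = 0 \<longrightarrow> (\<exists>a. \<forall>x t. u x t = a)))
     \<and> (3 \<le> M \<and> s 1 = 0 \<longrightarrow>
          (\<forall>z lam. lam \<noteq> 0 \<longrightarrow> bo_P M k \<nu> s x0 z lam =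
              z ^ k 1 * bo_P (M-1) (\<lambda>j. k (j+1)) (\<lambda>j. \<nu> (j+1)) (\<lambda>j. s (j+1)) (\<lambda>j. x0 (j+1)) z lam)
          \<and> hier_member (M-1) (\<lambda>j. k (j+1)) (\<lambda>j. \<nu> (j+1)) (\<lambda>j. s (j+1)) (\<lambda>j. x0 (j+1)) u)
     \<and> (3 \<le> M \<and> s J = 0 \<longrightarrow>
          (\<forall>z lam. lam \<noteq> 0 \<longrightarrow> bo_P M k \<nu> s x0 z lam =
              bo_P (M-1) (merge_k J k) (merge_nu J \<nu>) (merge_s J s) (merge_x J k x0) z lam)
          \<and> hier_member (M-1) (merge_k J k) (merge_nu J \<nu>) (merge_s J s) (merge_x J k x0) u)
     \<and> (s J = 0 \<longrightarrow>
          (\<forall>D. D \<subseteq> {j\<in>{2..M}. s j = 0} \<longrightarrow>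
             (case merges D (M, k, \<nu>, s, x0) of (M', k', \<nu>', s', x') \<Rightarrow>
                (\<forall>z lam. lam \<noteq> 0 \<longrightarrow> bo_P M k \<nu> s x0 z lam = bo_P M' k' \<nu>' s' x' z lam)
                \<and> (M' \<ge> 2 \<longrightarrow> hier_member M' k' \<nu>' s' x' u)
                \<and> (M' = 1 \<longrightarrow> u = gen_u 1 k' \<nu>' s' x'
                      (2 * real (bigN 1 k') - real (k' 1) - 2 * s' 1
                         + real_of_int (\<nu>' 1) / real (k' 1) * \<omega>) \<omega>))))"
proof -
  define c where "c = \<omega> * of_int (\<nu> 1) / real (k 1) - (real (k 1) + 2 * s 1)"
  have s_eq: "s 1 = s1" "s J = sJ" using J by (auto simp: s_def s_of_def)
  have "hier_params M k \<nu> J s"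
    unfolding hier_params_def s_eq
  proof (intro conjI ballI impI)
    show "s j = (tau k \<nu> J - tau k \<nu> j) / gam k \<nu> j + gam k \<nu> J / gam k \<nu> j * sJ"
      if "j \<in> {2..M}" "j \<noteq> J" for j
      using that by (simp add: s_def s_of_def)
  qed (use M2 kpos nu J Jmax s1 sJ in blast)+
  note hp = this
  have \<omega>: "\<omega> = omegaJ k \<nu> J s" by (simp add: \<omega>_def s_def)
  have pd: "phase_data M k \<nu> s \<omega> c"
    unfolding c_def \<omega> by (rule hier_params_phase_data[OF hp])
  note kp = phase_dataD(3)[OF pd] and sp = phase_dataD(4)[OF pd]
  have u: "u = gen_u M k \<nu> s x0 (2 * real (bigN M k) + c) \<omega>"
    unfolding u_def hier_u_def s_def[symmetric] using phase_data_hier_params[OF pd hp] by simp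
  have T: "T = 2 * pi / \<omega>" by (simp add: T_def \<omega>_def)
  have J1: "1 \<in> {1..M}" using M2 by simp
  have order: "(\<forall>j\<in>{1..M}. s j \<ge> 0) \<and> 0 \<le> qq k s 1 \<and> (\<forall>j\<in>{1..M}. qq k s j < pp k s j)
       \<and> (\<forall>j\<in>{1..<M}. pp k s j \<le> qq k s (j+1))"
  proof (intro conjI ballI)
    show "0 \<le> qq k s 1" by (rule qq_nonneg[where M=M and k=k and s=s, OF kp sp J1])
    show "qq k s j < pp k s j" if "j \<in> {1..M}" for j
      by (rule qq_less_pp[where M=M and k=k and s=s, OF kp sp that])
    show "pp k s j \<le> qq k s (j+1)" if "j \<in> {1..<M}" for j
      by (rule phase_data_pp_le_qq[OF pd]) (use that in auto)
  qed (rule sp)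
  have roots: "\<forall>t. \<forall>b\<in>set (root_list (\<lambda>z. bo_P M k \<nu> s x0 z (cis (- (\<omega> * t)))) (bigN M k)). cmod b < 1"
    using hier_E_root_list(1)[where M=M and k=k and s=s, OF kp sp phase_dataD(1)[OF pd]] by blast
  have sol: "bo_solution u" unfolding u by (rule bo_solution_gen_u[OF pd])
  have per: "\<forall>x t. u x (t + T) = u x t"
    unfolding u T using gen_u_period phase_dataD(2)[OF pd] by simp
  have two: "(\<forall>x0' t0. x0 1 = x0' - real_of_int (\<nu> 1) / real (k 1) * \<omega> * t0
                  \<and> x0 2 = x0' - real_of_int (\<nu> 2) / real (k 2) * \<omega> * t0 \<longrightarrow>
               u = u2 (k 1 + k 2) (k 2) (\<nu> 1 + \<nu> 2) (\<nu> 2) (s 1) (s 2) x0' t0)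
          \<and> (s 1 = 0 \<or> s 2 = 0 \<longrightarrow> (\<exists>c f. \<forall>x t. u x t = f (x - c * t)))
          \<and> (s 1 = 0 \<and> s 2 = 0 \<longrightarrow> (\<exists>a. \<forall>x t. u x t = a))" if M: "M = 2"
  proof -
    note pd2 = pd[unfolded M]
    show ?thesis unfolding u M
    proof (intro conjI allI impI)
      show "gen_u 2 k \<nu> s x0 (2 * real (bigN 2 k) + c) \<omega> =
          u2 (k 1 + k 2) (k 2) (\<nu> 1 + \<nu> 2) (\<nu> 2) (s 1) (s 2) x0' t0"
        if "x0 1 = x0' - real_of_int (\<nu> 1) / real (k 1) * \<omega> * t0
                  \<and> x0 2 = x0' - real_of_int (\<nu> 2) / real (k 2) * \<omega> * t0" for x0' t0
        using that by (intro gen_u_eq_u2[OF pd2]) simp_all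
      show "\<exists>v f. \<forall>x t. gen_u 2 k \<nu> s x0 (2 * real (bigN 2 k) + c) \<omega> x t = f (x - v * t)"
        if "s 1 = 0 \<or> s 2 = 0"
        by (rule gen_u_12_travelling[OF pd2 that])
      show "\<exists>a. \<forall>x t. gen_u 2 k \<nu> s x0 (2 * real (bigN 2 k) + c) \<omega> x t = a"
        if "s 1 = 0 \<and> s 2 = 0"
        using gen_u_12_constant[OF pd2] that by blast
    qed
  qed
  have shift: "(\<forall>z lam. lam \<noteq> 0 \<longrightarrow> bo_P M k \<nu> s x0 z lam =
              z ^ k 1 * bo_P (M-1) (\<lambda>j. k (j+1)) (\<lambda>j. \<nu> (j+1)) (\<lambda>j. s (j+1)) (\<lambda>j. x0 (j+1)) z lam)
          \<and> hier_member (M-1) (\<lambda>j. k (j+1)) (\<lambda>j. \<nu> (j+1)) (\<lambda>j. s (j+1)) (\<lambda>j. x0 (j+1)) u"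
    if M: "3 \<le> M" and z: "s 1 = 0"
  proof (intro conjI allI impI)
    show "bo_P M k \<nu> s x0 z lam =
        z ^ k 1 * bo_P (M-1) (\<lambda>j. k (j+1)) (\<lambda>j. \<nu> (j+1)) (\<lambda>j. s (j+1)) (\<lambda>j. x0 (j+1)) z lam"
      if "lam \<noteq> 0" for z lam
      by (rule shift_bo_P[OF pd M2 z that])
    have \<alpha>: "2 * real (bigN (M - 1) (\<lambda>j. k (j + 1))) + (c + 2 * real (k 1)) = 2 * real (bigN M k) + c"
      unfolding shift_bigN[OF pd M2 z] by simp
    show "hier_member (M-1) (\<lambda>j. k (j+1)) (\<lambda>j. \<nu> (j+1)) (\<lambda>j. s (j+1)) (\<lambda>j. x0 (j+1)) u"
      unfolding u shift_gen_u[OF pd M2 z] \<alpha>[symmetric]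
      by (rule hier_memberI[OF shift_phase_data[OF pd M2 z] _ refl]) (use M in simp)
  qed
  have merging: "(\<forall>z lam. lam \<noteq> 0 \<longrightarrow> bo_P M k \<nu> s x0 z lam = bo_P M' k' \<nu>' s' x' z lam)
                \<and> (M' \<ge> 2 \<longrightarrow> hier_member M' k' \<nu>' s' x' u)
                \<and> (M' = 1 \<longrightarrow> u = gen_u 1 k' \<nu>' s' x'
                      (2 * real (bigN 1 k') - real (k' 1) - 2 * s' 1
                         + real_of_int (\<nu>' 1) / real (k' 1) * \<omega>) \<omega>)"
    if D: "D \<subseteq> {j\<in>{2..M}. s j = 0}" and m: "merges D (M, k, \<nu>, s, x0) = (M', k', \<nu>', s', x')"
    for D M' k' \<nu>' s' x'
  proof -
    have fin: "finite D" using D finite_subset by fastforce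
    have "sorted_wrt (>) (rev (sorted_list_of_set D))" "set (rev (sorted_list_of_set D)) \<subseteq> {j\<in>{2..M}. s j = 0}"
      using D fin by (simp_all add: sorted_wrt_rev strict_sorted_list_of_set)
    from fold_merge_step[OF pd this m[unfolded merges_def]]
    have pd': "phase_data M' k' \<nu>' s' \<omega> c" and N: "bigN M' k' = bigN M k"
      and P: "\<And>z lam. lam \<noteq> 0 \<Longrightarrow> bo_P M k \<nu> s x0 z lam = bo_P M' k' \<nu>' s' x' z lam" by blast+
    have u': "u = gen_u M' k' \<nu>' s' x' (2 * real (bigN M' k') + c) \<omega>"
      unfolding u N by (rule gen_u_cong_bo_P[OF P N])
    \<comment> \<open>The relation at \<open>j = 1\<close> expresses \<open>c\<close> without any
      \<open>J\<close>; this covers the end result \<open>M' = 1\<close>, to which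
      \<open>hier_params\<close> does not apply.\<close>
    have "2 * real (bigN M' k') + c = 2 * real (bigN M' k') - real (k' 1) - 2 * s' 1
        + real_of_int (\<nu>' 1) / real (k' 1) * \<omega>"
    proof -
      have 1: "1 \<in> {1..M'}" using phase_dataD(1)[OF pd'] by simp
      show ?thesis using phase_dataD(5)[OF pd' 1] phase_dataD(3)[OF pd' 1] by (simp add: field_simps)
    qed
    then show ?thesis using P u' hier_memberI[OF pd'] by metis
  qed
  have single: "merges {J} (M, k, \<nu>, s, x0) = (M - 1, merge_k J k, merge_nu J \<nu>, merge_s J s, merge_x J k x0)"
    by (simp add: merges_def merge_step_def)
  have merge1: "(\<forall>z lam. lam \<noteq> 0 \<longrightarrow> bo_P M k \<nu> s x0 z lam =
              bo_P (M-1) (merge_k J k) (merge_nu J \<nu>) (merge_s J s) (merge_x J k x0) z lam)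
          \<and> hier_member (M-1) (merge_k J k) (merge_nu J \<nu>) (merge_s J s) (merge_x J k x0) u"
    if "3 \<le> M" "s J = 0"
    using merging[OF _ single] that J by auto
  have merge_all: "\<forall>D. D \<subseteq> {j\<in>{2..M}. s j = 0} \<longrightarrow>
             (case merges D (M, k, \<nu>, s, x0) of (M', k', \<nu>', s', x') \<Rightarrow>
                (\<forall>z lam. lam \<noteq> 0 \<longrightarrow> bo_P M k \<nu> s x0 z lam = bo_P M' k' \<nu>' s' x' z lam)
                \<and> (M' \<ge> 2 \<longrightarrow> hier_member M' k' \<nu>' s' x' u)
                \<and> (M' = 1 \<longrightarrow> u = gen_u 1 k' \<nu>' s' x'
                      (2 * real (bigN 1 k') - real (k' 1) - 2 * s' 1
                         + real_of_int (\<nu>' 1) / real (k' 1) * \<omega>) \<omega>))"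
    using merging by (auto split: prod.split)
  show ?thesis
    using order roots sol per two shift merge1 merge_all by blast
qed

end
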